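(* Let $f$ be a transcendental meromorphic function on $\mathbb{C}$ with hyper order $\rho_2(f)<1$, let $c\in\mathbb{C}\setminus\{0\}$, and let $L(f)(z)=af(z+c)-bf(z)$, where $a,b$ are nonzero constants. Suppose that $E(0,f(z))\subseteq E(0,L(f))$, $E(\infty,L(f))\subseteq E(\infty,f(z))$ and $\overline{E}(1,f(z))\subseteq\overline{E}(1,L(f))$. Then $L(f)\equiv f$ or $f(z+c)\equiv f(z)$.
   Context: For a meromorphic function $g$ and $a\in\mathbb{C}\cup\{\infty\}$, $E(a,g)$ denotes the set of zeros of $g-a$ (poles of $g$ if $a=\infty$) counted with multiplicity (a zero of multiplicity $m$ counted $m$ times), and $\overline{E}(a,g)$ denotes the set of such points each counted once. An inclusion $E(a,g)\subseteq E(b,h)$ means every $a$-point of $g$ of multiplicity $m$ is a $b$-point of $h$ of multiplicity at least $m$; $\overline{E}(a,g)\subseteq\overline{E}(b,h)$ means every $a$-point of $g$ is a $b$-point of $h$. The hyper order is $\rho_2(f)=\limsup_{r\to\infty}\frac{\log\log T(r,f)}{\log r}$, where $T(r,f)$ is the Nevanlinna characteristic. *)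

theory Defs
  imports "HOL-Complex_Analysis.Complex_Analysis" "HOL-Computational_Algebra.Polynomial"
    "HOL-Library.Extended_Nat" "HOL-Library.Extended_Real"
begin

text \<open>Meromorphic functions on the plane are represented as nicely meromorphic functions
  (no removable singularities, value 0 at poles).  All multiplicity notions below only
  depend on the germ of the function on punctured neighbourhoods.\<close>

definition apoint_mult :: "(complex \<Rightarrow> complex) \<Rightarrow> complex \<Rightarrow> complex \<Rightarrow> enat" where
  "apoint_mult g a z =
     (if eventually (\<lambda>w. g w = a) (at z) then \<infinity>
      else if is_pole g z then 0
      else enat (nat (zorder (\<lambda>w. g w - a) z)))"

definition pole_mult :: "(complex \<Rightarrow> complex) \<Rightarrow> complex \<Rightarrow> nat" where
  "pole_mult g z = (if is_pole g z then nat (- zorder g z) else 0)"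

definition E_subset :: "complex \<Rightarrow> (complex \<Rightarrow> complex) \<Rightarrow> complex \<Rightarrow> (complex \<Rightarrow> complex) \<Rightarrow> bool" where
  "E_subset a g b h \<longleftrightarrow> (\<forall>z. apoint_mult g a z \<le> apoint_mult h b z)"

definition Ebar_subset :: "complex \<Rightarrow> (complex \<Rightarrow> complex) \<Rightarrow> complex \<Rightarrow> (complex \<Rightarrow> complex) \<Rightarrow> bool" where
  "Ebar_subset a g b h \<longleftrightarrow> (\<forall>z. apoint_mult g a z > 0 \<longrightarrow> apoint_mult h b z > 0)"

definition E_pole_subset :: "(complex \<Rightarrow> complex) \<Rightarrow> (complex \<Rightarrow> complex) \<Rightarrow> bool" where
  "E_pole_subset g h \<longleftrightarrow> (\<forall>z. pole_mult g z \<le> pole_mult h z)"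

definition lnplus :: "real \<Rightarrow> real" where
  "lnplus x = (if x \<le> 1 then 0 else ln x)"

definition pole_count :: "(complex \<Rightarrow> complex) \<Rightarrow> real \<Rightarrow> real" where
  "pole_count f t = real (\<Sum>z\<in>{z. norm z \<le> t \<and> is_pole f z}. pole_mult f z)"

definition integrated_count :: "(complex \<Rightarrow> complex) \<Rightarrow> real \<Rightarrow> real" where
  "integrated_count f r =
     integral {0..r} (\<lambda>t. (pole_count f t - pole_count f 0) / t) + pole_count f 0 * ln r"

definition proximity :: "(complex \<Rightarrow> complex) \<Rightarrow> real \<Rightarrow> real" where
  "proximity f r = integral {0..2*pi} (\<lambda>\<theta>. lnplus (cmod (f (of_real r * cis \<theta>)))) / (2*pi)"

definition nev_char :: "(complex \<Rightarrow> complex) \<Rightarrow> real \<Rightarrow> real" where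
  "nev_char f r = proximity f r + integrated_count f r"

definition hyper_order :: "(complex \<Rightarrow> complex) \<Rightarrow> ereal" where
  "hyper_order f = Limsup at_top (\<lambda>r. ereal (ln (ln (nev_char f r)) / ln r))"

definition rational_function :: "(complex \<Rightarrow> complex) \<Rightarrow> bool" where
  "rational_function f \<longleftrightarrow>
     (\<exists>p q :: complex poly. q \<noteq> 0 \<and> (\<forall>z. poly q z \<noteq> 0 \<longrightarrow> f z = poly p z / poly q z))"

definition transcendental_meromorphic :: "(complex \<Rightarrow> complex) \<Rightarrow> bool" where
  "transcendental_meromorphic f \<longleftrightarrow> f nicely_meromorphic_on UNIV \<and> \<not> rational_function f"

end

theory Submission
  imports Defs "HOL-Real_Asymp.Real_Asymp"
begin

text \<open>
  Write \<open>f(z + c) = H(z) f(z)\<close>. The first two hypotheses make \<open>H\<close> entire, and hyper order less than one makes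
  it small compared with \<open>f\<close> (difference analogue of the lemma on the logarithmic derivative). If \<open>L(f) \<noteq> f\<close>, the third
  hypothesis puts the 1-points of \<open>f\<close>, counted once, among the \<open>k\<close>-points of \<open>H\<close>, \<open>k = (1 + b)/a\<close>, so there are few
  of them. The 1-points of the shifts \<open>f(z + c)\<close> and \<open>f(z + 2c)\<close> are then equally few, so \<open>f\<close> has few
  distinct points over each of the small functions \<open>1\<close>, \<open>1/H(z)\<close>, \<open>1/(H(z) H(z + c))\<close>; if these are distinct, the second main
  theorem fails for their cross ratio with \<open>f\<close>. For \<open>H \<noteq> 1\<close> they can coincide only if \<open>H(z) H(z + c) = 1\<close>. A zero- and
  pole-free \<open>u\<close> with \<open>u(z) u(z + c) = 1\<close> and hyper order less than one is constant, because \<open>u(z + c)/u(z) = u(z)\<^sup>-\<^sup>2\<close>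
  would be small compared with \<open>u\<close>. Hence \<open>H = -1\<close>, so that \<open>f\<close> omits \<open>1\<close> and \<open>-1\<close>, and the same argument applied to
  \<open>(f - 1)/(f + 1)\<close> makes \<open>f\<close> constant.

  No exceptional sets are needed: all estimates are made along one sequence of radii on which the
  characteristic of \<open>f\<close> grows slowly.
\<close>

section \<open>Means over circles\<close>

text \<open>The value \<open>k\<close> is dictated by the 1-points: where
  \<open>f = L(f) = 1\<close>, one has \<open>a f(z + c) = 1 + b\<close>, hence
  \<open>H = (1 + b)/a\<close>; and \<open>H = k\<close> identically is just
  \<open>L(f) = f\<close>. A small \<open>H\<close> has few \<open>k\<close>-points by the first
  main theorem.

  No general second main theorem is proved. The cross ratio \<open>\<phi>\<close> sends
  \<open>1\<close>, \<open>1/H\<close>, \<open>1/(H H_c)\<close> to \<open>0\<close>, infinity,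
  \<open>1\<close>. Its zeros, poles and 1-points then lie over zeros of small functions, so the
  logarithmic derivatives \<open>A\<close> of \<open>\<phi>\<close> and \<open>B\<close> of
  \<open>\<phi> - 1\<close> have few poles. These poles are simple, which is why 1-points may be
  counted once. Both have the numerator \<open>\<phi>'\<close>, so
  \<open>\<phi> = B / (B - A)\<close> is small, and \<open>f\<close>, a Moebius transform of
  \<open>\<phi>\<close> with small coefficients, would be small compared with itself.

  The obstacle is infinite order: \<open>T\<close> at \<open>2 r\<close> need not be comparable with
  \<open>T\<close> at \<open>r\<close>. The estimates must therefore stay effective for radii
  \<open>r < \<rho>\<close> whose gap grows slowly; they lose only \<open>1/(\<rho> - r)\<close> in
  the zero-free factor and gain \<open>r powr -\<alpha>\<close> for each zero or pole.\<close>

definition circle_mean :: "real \<Rightarrow> (complex \<Rightarrow> 'a::real_normed_vector) \<Rightarrow> 'a" where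
  "circle_mean r h = (1 / (2 * pi)) *\<^sub>R integral {0..2 * pi} (\<lambda>t. h (of_real r * cis t))"

lemma continuous_on_circle:
  assumes "continuous_on (sphere 0 r) h" "0 \<le> r"
  shows "continuous_on A (\<lambda>t. h (of_real r * cis t))"
  by (rule continuous_on_compose2[OF assms(1)])
     (use assms(2) in \<open>auto intro!: continuous_intros simp: norm_mult\<close>)

lemma integrable_on_circle:
  fixes h :: "complex \<Rightarrow> 'a::banach"
  assumes "continuous_on (sphere 0 r) h" "0 \<le> r"
  shows "(\<lambda>t. h (of_real r * cis t)) integrable_on {0..2*pi}"
  by (intro integrable_continuous_real continuous_on_circle assms)

lemma circle_mean_cong:
  assumes "0 \<le> r" "\<And>z. norm z = r \<Longrightarrow> h z = g z"
  shows "circle_mean r h = circle_mean r g"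
  unfolding circle_mean_def using assms by (auto intro!: integral_cong simp: norm_mult)

lemma circle_mean_const [simp]: "circle_mean r (\<lambda>_. c) = (c :: 'a::banach)"
  by (simp add: circle_mean_def)

lemma circle_mean_add:
  fixes h :: "complex \<Rightarrow> 'a::banach"
  assumes "continuous_on (sphere 0 r) h" "continuous_on (sphere 0 r) g" "0 \<le> r"
  shows "circle_mean r (\<lambda>z. h z + g z) = circle_mean r h + circle_mean r g"
  unfolding circle_mean_def
  by (subst integral_add) (auto intro!: integrable_on_circle assms simp: scaleR_add_right)

lemma circle_mean_cmult:
  fixes h :: "complex \<Rightarrow> real"
  shows "circle_mean r (\<lambda>z. c * h z) = c * circle_mean r h"
  unfolding circle_mean_def by (simp add: integral_mult_right)

lemma circle_mean_diff:
  fixes h :: "complex \<Rightarrow> 'a::banach"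
  assumes "continuous_on (sphere 0 r) h" "continuous_on (sphere 0 r) g" "0 \<le> r"
  shows "circle_mean r (\<lambda>z. h z - g z) = circle_mean r h - circle_mean r g"
  unfolding circle_mean_def
  by (subst integral_diff) (auto intro!: integrable_on_circle assms simp: scaleR_diff_right)

lemma circle_mean_sum:
  fixes h :: "'b \<Rightarrow> complex \<Rightarrow> 'a::banach"
  assumes "finite I" "\<And>i. i \<in> I \<Longrightarrow> continuous_on (sphere 0 r) (h i)" "0 \<le> r"
  shows "circle_mean r (\<lambda>z. \<Sum>i\<in>I. h i z) = (\<Sum>i\<in>I. circle_mean r (h i))"
  unfolding circle_mean_def
  by (subst integral_sum) (auto intro!: integrable_on_circle assms simp: scaleR_sum_right)

lemma circle_mean_mono:
  fixes h :: "complex \<Rightarrow> real"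
  assumes "continuous_on (sphere 0 r) h" "continuous_on (sphere 0 r) g" "0 \<le> r"
    and "\<And>z. norm z = r \<Longrightarrow> h z \<le> g z"
  shows "circle_mean r h \<le> circle_mean r g"
  unfolding circle_mean_def
  using assms by (auto intro!: divide_right_mono integral_le integrable_on_circle simp: norm_mult)

lemma circle_mean_nonneg:
  fixes h :: "complex \<Rightarrow> real"
  assumes "continuous_on (sphere 0 r) h" "0 \<le> r" "\<And>z. norm z = r \<Longrightarrow> 0 \<le> h z"
  shows "0 \<le> circle_mean r h"
  using circle_mean_mono[of r "\<lambda>_. 0" h] assms by simp

lemma norm_circle_mean_le:
  fixes h :: "complex \<Rightarrow> complex"
  assumes "continuous_on (sphere 0 r) h" "0 \<le> r"
  shows "norm (circle_mean r h) \<le> circle_mean r (\<lambda>z. norm (h z))"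
proof -
  have "norm (integral {0..2*pi} (\<lambda>t. h (of_real r * cis t)))
        \<le> integral {0..2*pi} (\<lambda>t. norm (h (of_real r * cis t)))"
    by (rule integral_norm_bound_integral)
       (auto intro!: integrable_on_circle assms continuous_on_norm
         integrable_continuous_real continuous_on_circle)
  then show ?thesis
    by (simp add: circle_mean_def divide_right_mono)
qed

lemma circle_mean_swap:
  fixes h :: "complex \<Rightarrow> complex \<Rightarrow> real"
  assumes "continuous_on (sphere 0 r \<times> sphere 0 s) (\<lambda>(x, y). h x y)" "0 \<le> r" "0 \<le> s"
  shows "circle_mean r (\<lambda>x. circle_mean s (h x)) = circle_mean s (\<lambda>y. circle_mean r (\<lambda>x. h x y))"
proof -
  have "continuous_on (cbox (0, 0) (2*pi, 2*pi)) (\<lambda>p. (\<lambda>(x, y). h x y) (of_real r * cis (fst p), of_real s * cis (snd p)))"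
    by (rule continuous_on_compose2[OF assms(1)])
       (use assms(2,3) in \<open>auto intro!: continuous_intros simp: norm_mult\<close>)
  then have "continuous_on (cbox (0, 0) (2*pi, 2*pi)) (\<lambda>(t, u). h (of_real r * cis t) (of_real s * cis u))"
    by (simp add: case_prod_unfold)
  from integral_swap_continuous[OF this] show ?thesis
    unfolding circle_mean_def by (simp add: integral_mult_right)
qed

section \<open>Cauchy, Schwarz and Poisson formulas as circle means\<close>

lemma circle_mean_Cauchy:
  assumes "continuous_on (cball 0 r) F" "F holomorphic_on ball 0 r" "norm w < r"
  shows "circle_mean r (\<lambda>u. F u * u / (u - w)) = F w"
proof -
  have r: "r > 0" using assms(3) norm_ge_zero[of w] by linarith
  have "((\<lambda>u. F u / (u - w)) has_contour_integral (2 * of_real pi * \<i> * F w)) (part_circlepath 0 r 0 (2*pi))"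
    using Cauchy_integral_circlepath[of 0 r F w] assms by (simp add: circlepath_def)
  then have "((\<lambda>t. F (0 + r * cis t) / ((0 + r * cis t) - w) * r * \<i> * cis t) has_integral (2 * of_real pi * \<i> * F w)) {0..2*pi}"
    by (subst (asm) has_contour_integral_part_circlepath_iff) auto
  \<comment> \<open>Since \<open>du = i u dt\<close> on the circle, the factor \<open>- \<i>\<close>
    turns the contour integral into an integral in \<open>t\<close> and leaves \<open>u\<close> in
    the numerator of the kernel.\<close>
  from has_integral_mult_right[OF this, of "- \<i>"]
  have "((\<lambda>t. F (r * cis t) * (r * cis t) / ((r * cis t) - w)) has_integral (2 * of_real pi * F w)) {0..2*pi}"
    by (simp add: mult_ac)
  then show ?thesis
    unfolding circle_mean_def by (simp add: integral_unique scaleR_conv_of_real)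
qed

lemma circle_mean_holomorphic:
  assumes "continuous_on (cball 0 r) F" "F holomorphic_on ball 0 r" "0 < r"
  shows "circle_mean r F = F 0"
proof -
  have "circle_mean r F = circle_mean r (\<lambda>u. F u * u / (u - 0))"
    by (rule circle_mean_cong) (use assms in auto)
  then show ?thesis using circle_mean_Cauchy[of r F 0] assms by simp
qed

lemma circle_mean_Cauchy_deriv:
  assumes "continuous_on (cball 0 r) F" "F holomorphic_on ball 0 r" "norm w < r"
  shows "circle_mean r (\<lambda>u. F u * u / (u - w)^2) = deriv F w"
proof -
  have r: "r > 0" using assms(3) norm_ge_zero[of w] by linarith
  have w: "w \<in> ball 0 r" using assms by simp
  have 1: "(\<lambda>u. F u / (u - w)^2) contour_integrable_on (circlepath 0 r)"
    using Cauchy_derivative_integral_circlepath(1)[OF assms(1,2) w] .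
  have 2: "contour_integral (circlepath 0 r) (\<lambda>u. F u / (u - w)^2) = (2 * pi * \<i>) * deriv F w"
    using Cauchy_contour_integral_circlepath_2[OF assms(1,2) w] .
  have "((\<lambda>u. F u / (u - w)^2) has_contour_integral (2 * of_real pi * \<i> * deriv F w)) (part_circlepath 0 r 0 (2*pi))"
    using 1 2 has_contour_integral_integral by (fastforce simp: circlepath_def)
  then have "((\<lambda>t. F (0 + r * cis t) / ((0 + r * cis t) - w)^2 * r * \<i> * cis t) has_integral (2 * of_real pi * \<i> * deriv F w)) {0..2*pi}"
    by (subst (asm) has_contour_integral_part_circlepath_iff) auto
  from has_integral_mult_right[OF this, of "- \<i>"]
  have "((\<lambda>t. F (r * cis t) * (r * cis t) / ((r * cis t) - w)^2) has_integral (2 * of_real pi * deriv F w)) {0..2*pi}"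
    by (simp add: mult_ac)
  then show ?thesis
    unfolding circle_mean_def by (simp add: integral_unique scaleR_conv_of_real)
qed

lemma circle_mean_cnj: "circle_mean r (\<lambda>z. cnj (h z)) = cnj (circle_mean r h)"
  unfolding circle_mean_def by (simp add: integral_cnj)

lemma circle_mean_Re:
  assumes "continuous_on (sphere 0 r) h" "0 \<le> r"
  shows "circle_mean r (\<lambda>z. Re (h z)) = Re (circle_mean r h)"
proof -
  have "((\<lambda>t. h (of_real r * cis t)) has_integral integral {0..2*pi} (\<lambda>t. h (of_real r * cis t))) {0..2*pi}"
    using integrable_on_circle[OF assms] by blast
  from has_integral_Re[OF this] show ?thesis
    unfolding circle_mean_def by (simp add: integral_unique)
qed

lemma cnj_on_circle: "norm u = r \<Longrightarrow> u \<noteq> 0 \<Longrightarrow> cnj u = of_real r ^ 2 / u"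
  using complex_norm_square[of u] by (simp add: field_simps)

text \<open>On the circle \<open>cnj u = r^2 / u\<close>, so the conjugate of each kernel is the
  restriction of a function holomorphic in the disc. The mean of its product with \<open>F\<close>
  is then the value at \<open>0\<close>: the first conjugated kernel is \<open>1\<close> there and
  the second vanishes.\<close>

lemma circle_mean_Cauchy_cnj:
  assumes "continuous_on (cball 0 r) F" "F holomorphic_on ball 0 r" "norm w < r"
  shows "circle_mean r (\<lambda>u. cnj (F u) * u / (u - w)) = cnj (F 0)"
    and "circle_mean r (\<lambda>u. cnj (F u) * u / (u - w)^2) = 0"
proof -
  have r: "r > 0" using assms(3) norm_ge_zero[of w] by linarith
  \<comment> \<open>The only possible pole of the conjugated kernels is the mirror image of
    \<open>w\<close> in the circle, which lies outside the closed disc.\<close>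
  have nz: "of_real r ^ 2 - cnj w * u \<noteq> 0" if "norm u \<le> r" for u
  proof
    assume "of_real r ^ 2 - cnj w * u = 0"
    then have "norm (cnj w * u) = r^2" by (metis eq_iff_diff_eq_0 norm_of_real norm_power power2_abs)
    moreover have "norm w * norm u < r * r"
      using that assms(3) r mult_less_le_imp_less[of "norm w" r "norm u" r]
      by (metis mult_le_less_imp_less mult_less_le_imp_less norm_ge_zero mult_left_mono mult_strict_right_mono order.strict_trans1 order_less_imp_le)
    ultimately show False by (simp add: norm_mult power2_eq_square)
  qed
  have cj: "cnj (u / (u - w)) = of_real r ^ 2 / (of_real r ^ 2 - cnj w * u)"
      and cj2: "cnj (u / (u - w)^2) = of_real r ^ 2 * u / (of_real r ^ 2 - cnj w * u)^2" if "norm u = r" for u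
  proof -
    have u: "u \<noteq> 0" using that r by auto
    have *: "cnj u - cnj w = (of_real r ^ 2 - cnj w * u) / u"
      using u by (subst cnj_on_circle[OF that u]) (simp add: field_simps)
    show "cnj (u / (u - w)) = of_real r ^ 2 / (of_real r ^ 2 - cnj w * u)"
      unfolding complex_cnj_divide complex_cnj_diff * using u by (simp add: cnj_on_circle[OF that u])
    show "cnj (u / (u - w)^2) = of_real r ^ 2 * u / (of_real r ^ 2 - cnj w * u)^2"
      unfolding complex_cnj_divide complex_cnj_diff complex_cnj_power * 
      using u by (simp add: cnj_on_circle[OF that u] power_divide) (simp add: power2_eq_square)
  qed
  have "circle_mean r (\<lambda>u. F u * (of_real r ^ 2 / (of_real r ^ 2 - cnj w * u))) = F 0"
    by (subst circle_mean_holomorphic)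
       (use assms r nz in \<open>auto intro!: continuous_intros holomorphic_intros\<close>)
  moreover have "circle_mean r (\<lambda>u. cnj (F u) * u / (u - w))
     = circle_mean r (\<lambda>u. cnj (F u * (of_real r ^ 2 / (of_real r ^ 2 - cnj w * u))))"
    by (rule circle_mean_cong) (use r in \<open>auto simp: cj[symmetric] simp del: complex_cnj_diff complex_cnj_power complex_cnj_divide\<close>)
  ultimately show "circle_mean r (\<lambda>u. cnj (F u) * u / (u - w)) = cnj (F 0)"
    by (simp only: circle_mean_cnj)
  have "circle_mean r (\<lambda>u. F u * (of_real r ^ 2 * u / (of_real r ^ 2 - cnj w * u)^2)) = 0"
    by (subst circle_mean_holomorphic)
       (use assms r nz in \<open>auto intro!: continuous_intros holomorphic_intros\<close>)
  moreover have "circle_mean r (\<lambda>u. cnj (F u) * u / (u - w)^2)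
     = circle_mean r (\<lambda>u. cnj (F u * (of_real r ^ 2 * u / (of_real r ^ 2 - cnj w * u)^2)))"
    by (rule circle_mean_cong) (use r in \<open>auto simp: cj2[symmetric] simp del: complex_cnj_diff complex_cnj_power complex_cnj_divide\<close>)
  ultimately show "circle_mean r (\<lambda>u. cnj (F u) * u / (u - w)^2) = 0"
    by (simp only: circle_mean_cnj complex_cnj_zero)
qed

text \<open>Adding the Cauchy formulas for \<open>F\<close> and its conjugate leaves only
  \<open>Re F\<close> on the circle. This matters for a logarithm \<open>F\<close> of a zero-free
  function, whose real part is a known \<open>ln (norm _)\<close> while its imaginary part is
  uncontrolled.\<close>

lemma circle_mean_Schwarz:
  assumes "continuous_on (cball 0 r) F" "F holomorphic_on ball 0 r" "norm w < r"
  shows "circle_mean r (\<lambda>u. of_real (2 * Re (F u)) * u / (u - w)) = F w + cnj (F 0)"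
    and "circle_mean r (\<lambda>u. of_real (2 * Re (F u)) * u / (u - w)^2) = deriv F w"
proof -
  have r: "r > 0" using assms(3) norm_ge_zero[of w] by linarith
  have c: "continuous_on (sphere 0 r) F" using assms(1) continuous_on_subset by fastforce
  have 2: "of_real (2 * Re x) = x + cnj x" for x by (simp add: complex_add_cnj)
  have ne: "norm u = r \<Longrightarrow> u \<noteq> w" for u using assms(3) by auto
  show "circle_mean r (\<lambda>u. of_real (2 * Re (F u)) * u / (u - w)) = F w + cnj (F 0)"
    unfolding 2 ring_distribs add_divide_distrib
    by (subst circle_mean_add)
       (use r c ne in \<open>auto intro!: continuous_intros simp: circle_mean_Cauchy circle_mean_Cauchy_cnj assms\<close>)
  show "circle_mean r (\<lambda>u. of_real (2 * Re (F u)) * u / (u - w)^2) = deriv F w"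
    unfolding 2 ring_distribs add_divide_distrib
    by (subst circle_mean_add)
       (use r c ne in \<open>auto intro!: continuous_intros simp: circle_mean_Cauchy_deriv circle_mean_Cauchy_cnj assms\<close>)
qed

text \<open>In essence the mean value of the Poisson kernel. With \<open>v\<close> the mirror image
  of \<open>w\<close> in the circle, \<open>1 / (norm (w - z))^2\<close> is the Cauchy kernel at
  \<open>v\<close> times the function \<open>F\<close> of the proof, which is holomorphic in the
  disc because \<open>w\<close> lies outside.\<close>

lemma circle_mean_inverse_square:
  assumes "0 < r" "norm w > r"
  shows "circle_mean r (\<lambda>z. 1 / (norm (w - z))^2) = 1 / ((norm w)^2 - r^2)"
proof -
  define v where "v = of_real (r^2) / cnj w"
  have w0: "w \<noteq> 0" using assms by auto
  have v: "norm v < r" using assms by (simp add: v_def norm_divide norm_mult power2_eq_square divide_simps)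
  define F where "F = (\<lambda>z. 1 / ((w - z) * cnj w))"
  have ne: "w \<noteq> z" if "norm z \<le> r" for z :: complex using assms that by auto
  have "circle_mean r (\<lambda>u. F u * u / (u - v)) = F v"
    by (rule circle_mean_Cauchy)
       (use v w0 ne in \<open>auto simp: F_def intro!: continuous_intros holomorphic_intros\<close>)
  also have "F v = of_real (1 / ((norm w)^2 - r^2))"
  proof -
    have "w - v = (w * cnj w - of_real (r^2)) / cnj w" using w0 by (simp add: v_def field_simps)
    also have "w * cnj w = of_real ((norm w)^2)" using complex_norm_square[of w] by simp
    finally show ?thesis using w0 by (simp add: F_def)
  qed
  also have "circle_mean r (\<lambda>u. F u * u / (u - v)) = circle_mean r (\<lambda>z. of_real (1 / (norm (w - z))^2))"
  proof (rule circle_mean_cong)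
    fix z :: complex assume z: "norm z = r"
    have z0: "z \<noteq> 0" using z assms by auto
    have zw: "w \<noteq> z" using ne[of z] z by auto
    have *: "cnj w - cnj z = cnj w * (z - v) / z"
      using z0 w0 by (simp add: cnj_on_circle[OF z z0] v_def field_simps)
    have zv: "z \<noteq> v" using v z by auto
    have "of_real ((norm (w - z))^2) = (w - z) * (cnj w * (z - v) / z)"
      unfolding *[symmetric] using complex_norm_square[of "w - z"] by simp
    then have "complex_of_real (1 / (norm (w - z))^2) = 1 / ((w - z) * (cnj w * (z - v) / z))"
      by (metis of_real_1 of_real_divide)
    also have "\<dots> = F z * z / (z - v)" using z0 w0 zw zv by (simp add: F_def)
    finally show "F z * z / (z - v) = complex_of_real (1 / (norm (w - z))^2)" ..
  qed (use assms in auto)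
  finally have "circle_mean r (\<lambda>z. of_real (1 / (norm (w - z))^2)) = complex_of_real (1 / ((norm w)^2 - r^2))" .
  then have "Re (circle_mean r (\<lambda>z. of_real (1 / (norm (w - z))^2))) = 1 / ((norm w)^2 - r^2)"
    by simp
  then show ?thesis
    using assms ne by (subst (asm) circle_mean_Re[symmetric]) (auto intro!: continuous_intros)
qed

section \<open>Estimates for kernels on circles\<close>

lemma abs_sin_ge_half:
  fixes x :: real
  assumes "\<bar>x\<bar> \<le> pi / 2"
  shows "\<bar>x\<bar> / 2 \<le> \<bar>sin x\<bar>"
proof -
  have "\<bar>sin x - (\<Sum>m<3. sin_coeff m * x ^ m)\<bar> \<le> inverse (fact 3) * \<bar>x\<bar> ^ 3"
    by (rule Maclaurin_sin_bound)
  then have 1: "\<bar>sin x - x\<bar> \<le> \<bar>x\<bar> ^ 3 / 6"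
    by (simp add: eval_nat_numeral sin_coeff_def fact_numeral)
  \<comment> \<open>\<open>pi / 2 < 1.6\<close>, and \<open>1.6^2 < 3\<close> keeps the cubic
    remainder below half of the linear term.\<close>
  have "\<bar>x\<bar>^2 \<le> 1.6^2"
    by (rule power_mono) (use assms pi_approx in auto)
  then have "\<bar>x\<bar> * \<bar>x\<bar>^2 \<le> \<bar>x\<bar> * 3"
    by (intro mult_left_mono) (auto simp: power2_eq_square)
  then have "\<bar>x\<bar> ^ 3 / 6 \<le> \<bar>x\<bar> / 2" by (simp add: power3_eq_cube power2_eq_square)
  with 1 show ?thesis by linarith
qed

text \<open>Rounding \<open>x / pi\<close> to the nearest integer reduces to
  \<open>[-pi/2, pi/2]\<close>. The range \<open>3 * pi\<close> accommodates
  \<open>t - Arg b\<close> for \<open>t\<close> in \<open>[0, 2 * pi]\<close>.\<close>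

lemma abs_sin_ge_dist:
  fixes x :: real
  assumes "\<bar>x\<bar> \<le> 3 * pi"
  obtains j :: int where "j \<in> {-3..3}" "\<bar>x - of_int j * pi\<bar> / 2 \<le> \<bar>sin x\<bar>"
proof -
  define j where "j = \<lfloor>x / pi + 1/2\<rfloor>"
  have j1: "of_int j \<le> x / pi + 1/2" and j2: "x / pi + 1/2 < of_int j + 1"
    unfolding j_def by linarith+
  have "\<bar>x / pi\<bar> \<le> 3" using assms by (simp add: divide_le_eq)
  then have "of_int j < (4::real)" "of_int j > (-4::real)" using j1 j2 by linarith+
  then have jr: "j \<in> {-3..3}" by simp
  have 1: "\<bar>x - of_int j * pi\<bar> \<le> pi / 2"
  proof -
    have "\<bar>x / pi - of_int j\<bar> \<le> 1/2" using j1 j2 by linarith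
    then have "\<bar>x / pi - of_int j\<bar> * pi \<le> 1/2 * pi" by (intro mult_right_mono) auto
    moreover have "\<bar>x / pi - of_int j\<bar> * pi = \<bar>x - of_int j * pi\<bar>"
    proof -
      have "x / pi - of_int j = (x - of_int j * pi) / pi" by (simp add: diff_divide_distrib)
      then show ?thesis by (simp add: abs_divide)
    qed
    ultimately show ?thesis by simp
  qed
  have "\<bar>sin (x - of_int j * pi)\<bar> = \<bar>sin x\<bar>"
  proof -
    have "(cos (of_int j * pi))^2 = 1"
    proof -
      have "sin (of_int j * pi) = 0" using sin_zero_iff_int2 by blast
      with sin_cos_squared_add[of "of_int j * pi"] show ?thesis by simp
    qed
    then have "\<bar>cos (of_int j * pi)\<bar> = 1" by (auto simp: power2_eq_1_iff)
    moreover have "sin (of_int j * pi) = 0" using sin_zero_iff_int2 by blast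
    ultimately show ?thesis by (simp add: sin_diff abs_mult)
  qed
  with abs_sin_ge_half[OF 1] jr that show ?thesis by auto
qed

text \<open>For \<open>\<alpha> < 1\<close> the antiderivative \<open>g\<close> is continuous across
  the singularity, so the fundamental theorem applies with \<open>u\<close> as the only exceptional
  point.\<close>

lemma has_integral_abs_powr:
  fixes \<alpha> a u :: real
  assumes "0 < \<alpha>" "\<alpha> < 1" "0 \<le> a"
  defines "g \<equiv> \<lambda>x. sgn x * \<bar>x\<bar> powr (1 - \<alpha>) / (1 - \<alpha>)"
  shows "((\<lambda>x. \<bar>x - u\<bar> powr -\<alpha>) has_integral (g (a - u) - g (0 - u))) {0..a}"
proof (rule fundamental_theorem_of_calculus_interior_strong[of "{u}" 0 a "\<lambda>x. g (x - u)"])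
  have *: "(g has_real_derivative (\<bar>x\<bar> powr -\<alpha>)) (at x)" if "x \<noteq> 0" for x
  proof (cases "x > 0")
    case True
    have "((\<lambda>x. x powr (1 - \<alpha>) / (1 - \<alpha>)) has_real_derivative (\<bar>x\<bar> powr -\<alpha>)) (at x)"
      using True assms by (auto intro!: derivative_eq_intros)
    moreover have "eventually (\<lambda>y. y powr (1 - \<alpha>) / (1 - \<alpha>) = g y) (nhds x)"
      by (rule eventually_mono[OF eventually_nhds_in_open[of "{0<..}" x]]) (use True in \<open>auto simp: g_def\<close>)
    ultimately show ?thesis using DERIV_cong_ev by fast
  next
    case False
    then have x: "x < 0" using that by simp
    have "((\<lambda>x. - ((-x) powr (1 - \<alpha>) / (1 - \<alpha>))) has_real_derivative (\<bar>x\<bar> powr -\<alpha>)) (at x)"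
      using x assms by (auto intro!: derivative_eq_intros)
    moreover have "eventually (\<lambda>y. - ((-y) powr (1 - \<alpha>) / (1 - \<alpha>)) = g y) (nhds x)"
      by (rule eventually_mono[OF eventually_nhds_in_open[of "{..<0}" x]]) (use x in \<open>auto simp: g_def\<close>)
    ultimately show ?thesis using DERIV_cong_ev by fast
  qed
  show "((\<lambda>x. g (x - u)) has_vector_derivative \<bar>x - u\<bar> powr - \<alpha>) (at x)" if "x \<in> {0<..<a} - {u}" for x
  proof -
    have "((\<lambda>x. g (x - u)) has_real_derivative \<bar>x - u\<bar> powr - \<alpha>) (at x)"
      by (rule DERIV_chain'[where f = "\<lambda>x. x - u" and D = 1, simplified])
         (use * that in \<open>auto intro!: derivative_eq_intros\<close>)
    then show ?thesis by (simp add: has_real_derivative_iff_has_vector_derivative)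
  qed
  have "isCont g x" for x
  proof (cases "x = 0")
    case False then show ?thesis using * DERIV_isCont by blast
  next
    case True
    have "((\<lambda>x. \<bar>x\<bar> powr (1 - \<alpha>) / (1 - \<alpha>)) \<longlongrightarrow> \<bar>0::real\<bar> powr (1 - \<alpha>) / (1 - \<alpha>)) (at 0)"
      using assms by (intro tendsto_intros) auto
    then have "((\<lambda>x. \<bar>x\<bar> powr (1 - \<alpha>) / (1 - \<alpha>)) \<longlongrightarrow> 0) (at 0)" by simp
    then have "(g \<longlongrightarrow> 0) (at 0)"
      by (rule Lim_null_comparison[rotated])
         (use assms in \<open>auto simp: g_def abs_mult abs_sgn_eq intro!: always_eventually\<close>)
    then show ?thesis using True by (simp add: isCont_def g_def)
  qed
  then have "continuous_on UNIV g" by (simp add: continuous_at_imp_continuous_on)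
  then show "continuous_on {0..a} (\<lambda>x. g (x - u))"
    by (rule continuous_on_compose2) (auto intro!: continuous_intros)
qed (use assms in auto)

text \<open>\<open>14\<close> is the seven values of \<open>j\<close> in
  \<open>abs_sin_ge_dist\<close> times the two endpoints of an antiderivative; \<open>8 * pi\<close>
  bounds the endpoint arguments, \<open>2 powr \<alpha>\<close> undoes the factor
  \<open>1 / 2\<close> of the sine bound, and \<open>2 * pi\<close> normalizes the mean.\<close>

definition circle_powr_const :: "real \<Rightarrow> real" where
  "circle_powr_const \<alpha> = 14 * (2 powr \<alpha> * ((8 * pi) powr (1 - \<alpha>) / (1 - \<alpha>))) / (2 * pi)"

text \<open>Rotating \<open>b\<close> to the positive axis and taking imaginary parts gives
  \<open>norm (z - b) \<ge> r * \<bar>sin (t - Arg b)\<bar>\<close> whatever the modulus of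
  \<open>b\<close>. Hence the bound is uniform in \<open>b\<close>, even for points very close to
  the circle.\<close>

lemma circle_mean_powr_le:
  fixes b :: complex
  assumes "0 < \<alpha>" "\<alpha> < 1" "0 < r" "norm b \<noteq> r"
  shows "circle_mean r (\<lambda>z. norm (z - b) powr -\<alpha>) \<le> circle_powr_const \<alpha> * r powr -\<alpha>"
proof -
  define \<beta> where "\<beta> = Arg b"
  have \<beta>: "-pi < \<beta>" "\<beta> \<le> pi" using Arg_bounded[of b] by (auto simp: \<beta>_def)
  have b: "b = norm b * cis \<beta>" unfolding \<beta>_def using rcis_cmod_Arg[of b] by (simp add: rcis_def)
  define g where "g = (\<lambda>x::real. sgn x * \<bar>x\<bar> powr (1 - \<alpha>) / (1 - \<alpha>))"
  define k where "k = (\<lambda>j::int. \<lambda>t::real. \<bar>t - (\<beta> + of_int j * pi)\<bar> powr -\<alpha>)"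
  have lower: "norm (of_real r * cis t - b) \<ge> r * \<bar>sin (t - \<beta>)\<bar>" for t
  proof -
    have "norm (of_real r * cis t - b) = norm ((of_real r * cis t - b) * cis (-\<beta>))" by (simp add: norm_mult)
    also have "(of_real r * cis t - b) * cis (-\<beta>) = of_real r * cis (t - \<beta>) - norm b"
    proof -
      have "b * cis (-\<beta>) = norm b" by (subst b) (simp add: cis_mult mult.assoc)
      moreover have "of_real r * cis t * cis (-\<beta>) = of_real r * cis (t - \<beta>)" by (simp add: cis_mult mult.assoc)
      ultimately show ?thesis by (simp only: left_diff_distrib)
    qed
    also have "norm \<dots> \<ge> \<bar>Im (of_real r * cis (t - \<beta>) - norm b)\<bar>" by (rule abs_Im_le_cmod)
    finally show ?thesis using assms by (simp add: abs_mult)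
  qed
  have gb: "\<bar>g x\<bar> \<le> (8 * pi) powr (1 - \<alpha>) / (1 - \<alpha>)" if "\<bar>x\<bar> \<le> 8 * pi" for x
    using that assms by (auto simp: g_def abs_mult abs_sgn_eq intro!: divide_right_mono powr_mono2)
  have kint: "(k j has_integral (g (2 * pi - (\<beta> + of_int j * pi)) - g (0 - (\<beta> + of_int j * pi)))) {0..2*pi}" for j
    unfolding k_def g_def by (rule has_integral_abs_powr) (use assms in auto)
  have kle: "integral {0..2*pi} (k j) \<le> 2 * ((8 * pi) powr (1 - \<alpha>) / (1 - \<alpha>))" if "j \<in> {-3..3}" for j
  proof -
    have "\<bar>of_int j * pi\<bar> \<le> 3 * pi" using that by (auto simp: abs_mult)
    then have "\<bar>2 * pi - (\<beta> + of_int j * pi)\<bar> \<le> 8 * pi" "\<bar>0 - (\<beta> + of_int j * pi)\<bar> \<le> 8 * pi"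
      using \<beta> pi_gt_zero by linarith+
    from gb[OF this(1)] gb[OF this(2)] integral_unique[OF kint] show ?thesis by simp
  qed
  have sumint: "((\<lambda>t. (2 powr \<alpha> * r powr -\<alpha>) * (\<Sum>j\<in>{-3..3}. k j t)) has_integral
       (2 powr \<alpha> * r powr -\<alpha>) * (\<Sum>j\<in>{-3..3}. integral {0..2*pi} (k j))) {0..2*pi}"
    by (intro has_integral_mult_right has_integral_sum) (use kint in blast)+
  have ne: "norm z = r \<Longrightarrow> z - b \<noteq> 0" for z using assms by auto
  have cont: "continuous_on (sphere 0 r) (\<lambda>z. norm (z - b) powr -\<alpha>)"
    using ne by (auto intro!: continuous_intros)
  \<comment> \<open>At the removed points \<open>0 powr -\<alpha>\<close> is \<open>0\<close> and
    the pointwise bound may fail; they are finitely many and do not affect the integral.\<close>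
  have pw: "norm (of_real r * cis t - b) powr -\<alpha> \<le> (2 powr \<alpha> * r powr -\<alpha>) * (\<Sum>j\<in>{-3..3}. k j t)"
    if t: "t \<in> {0..2*pi} - (\<Union>j\<in>{-3..3}. {\<beta> + of_int j * pi})" for t
  proof -
    have "\<bar>t - \<beta>\<bar> \<le> 3 * pi" using t \<beta> by auto
    then obtain j :: int where j: "j \<in> {-3..3}" "\<bar>t - \<beta> - of_int j * pi\<bar> / 2 \<le> \<bar>sin (t - \<beta>)\<bar>"
      using abs_sin_ge_dist by blast
    have pos: "\<bar>t - (\<beta> + of_int j * pi)\<bar> > 0" using t j(1) by auto
    have "r * (\<bar>t - (\<beta> + of_int j * pi)\<bar> / 2) \<le> norm (of_real r * cis t - b)"
      using order_trans[OF mult_left_mono[OF j(2), of r] lower[of t]] assms(3) by (simp add: diff_diff_eq)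
    then have "norm (of_real r * cis t - b) powr -\<alpha> \<le> (r * (\<bar>t - (\<beta> + of_int j * pi)\<bar> / 2)) powr -\<alpha>"
      using assms pos by (intro powr_mono2') auto
    also have "\<dots> = (2 powr \<alpha> * r powr -\<alpha>) * k j t"
      using assms pos by (simp add: powr_mult powr_divide k_def powr_minus field_simps)
    also have "\<dots> \<le> (2 powr \<alpha> * r powr -\<alpha>) * (\<Sum>j\<in>{-3..3}. k j t)"
      by (intro mult_left_mono member_le_sum) (use j in \<open>auto simp: k_def\<close>)
    finally show ?thesis .
  qed
  have I: "integral {0..2*pi} (\<lambda>t. norm (of_real r * cis t - b) powr -\<alpha>)
     \<le> (2 powr \<alpha> * r powr -\<alpha>) * (\<Sum>j\<in>{-3..3}. integral {0..2*pi} (k j))"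
  proof (rule has_integral_le[where f = "\<lambda>t. if t \<in> (\<Union>j\<in>{-3..3}. {\<beta> + of_int j * pi}) then 0 else norm (of_real r * cis t - b) powr -\<alpha>"])
    show "((\<lambda>t. if t \<in> (\<Union>j\<in>{-3..3}. {\<beta> + of_int j * pi}) then 0 else norm (of_real r * cis t - b) powr -\<alpha>) has_integral
       integral {0..2*pi} (\<lambda>t. norm (of_real r * cis t - b) powr -\<alpha>)) {0..2*pi}"
      by (rule has_integral_spike_finite[where S = "\<Union>j\<in>{-3..3}. {\<beta> + of_int j * pi}"
            and f = "\<lambda>t. norm (of_real r * cis t - b) powr -\<alpha>"])
         (use integrable_on_circle[OF cont] assms in auto)
    show "(if t \<in> (\<Union>j\<in>{-3..3}. {\<beta> + of_int j * pi}) then 0 else norm (of_real r * cis t - b) powr -\<alpha>)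
       \<le> (2 powr \<alpha> * r powr -\<alpha>) * (\<Sum>j\<in>{-3..3}. k j t)" if "t \<in> {0..2*pi}" for t
    proof (cases "t \<in> (\<Union>j\<in>{-3..3}. {\<beta> + of_int j * pi})")
      case True
      have "0 \<le> (2 powr \<alpha> * r powr -\<alpha>) * (\<Sum>j\<in>{-3..3}. k j t)"
        by (intro mult_nonneg_nonneg sum_nonneg) (auto simp: k_def)
      with True show ?thesis by simp
    next
      case False then show ?thesis using pw[of t] that by simp
    qed
  qed (fact sumint)
  have J: "(2 powr \<alpha> * r powr -\<alpha>) * (\<Sum>j\<in>{-3..3}. integral {0..2*pi} (k j))
      \<le> (2 powr \<alpha> * r powr -\<alpha>) * (\<Sum>j\<in>{-3..3::int}. 2 * ((8 * pi) powr (1 - \<alpha>) / (1 - \<alpha>)))"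
    by (intro mult_left_mono sum_mono kle) auto
  have "integral {0..2*pi} (\<lambda>t. norm (of_real r * cis t - b) powr -\<alpha>) / (2 * pi)
     \<le> ((2 powr \<alpha> * r powr -\<alpha>) * (\<Sum>j\<in>{-3..3::int}. 2 * ((8 * pi) powr (1 - \<alpha>) / (1 - \<alpha>)))) / (2 * pi)"
    by (intro divide_right_mono order_trans[OF I J]) auto
  then show ?thesis by (simp add: circle_mean_def circle_powr_const_def mult_ac)
qed

lemma circle_powr_const_nonneg: "\<alpha> < 1 \<Longrightarrow> 0 \<le> circle_powr_const \<alpha>"
  by (simp add: circle_powr_const_def)

text \<open>The term \<open>cnj (G 0)\<close> of the Schwarz formula cancels in the difference, and
  the two kernels differ by \<open>u * (w1 - w2) / ((u - w1) * (u - w2))\<close>.\<close>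

lemma holomorphic_diff_le_circle_mean:
  assumes G: "continuous_on (cball 0 \<rho>) G" "G holomorphic_on ball 0 \<rho>"
    and w: "norm w1 < \<rho>" "norm w2 < \<rho>"
  shows "norm (G w1 - G w2) \<le> circle_mean \<rho> (\<lambda>u. 2 * \<bar>Re (G u)\<bar> * (\<rho> * norm (w1 - w2)) / (norm (u - w1) * norm (u - w2)))"
proof -
  have r: "\<rho> > 0" using w(1) norm_ge_zero[of w1] by linarith
  have c: "continuous_on (sphere 0 \<rho>) G" using G(1) continuous_on_subset by fastforce
  have ne: "u \<noteq> w1" "u \<noteq> w2" if "norm u = \<rho>" for u using w that by auto
  have "G w1 - G w2 = circle_mean \<rho> (\<lambda>u. of_real (2 * Re (G u)) * u / (u - w1)) - circle_mean \<rho> (\<lambda>u. of_real (2 * Re (G u)) * u / (u - w2))"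
    using circle_mean_Schwarz(1)[OF G] w by simp
  also have "\<dots> = circle_mean \<rho> (\<lambda>u. of_real (2 * Re (G u)) * u / (u - w1) - of_real (2 * Re (G u)) * u / (u - w2))"
    by (rule circle_mean_diff[symmetric]) (use c r ne in \<open>auto intro!: continuous_intros\<close>)
  finally have "norm (G w1 - G w2) = norm \<dots>" by (rule arg_cong)
  also have "\<dots> \<le> circle_mean \<rho> (\<lambda>u. norm (of_real (2 * Re (G u)) * u / (u - w1) - of_real (2 * Re (G u)) * u / (u - w2)))"
    by (rule norm_circle_mean_le) (use c r ne in \<open>auto intro!: continuous_intros\<close>)
  also have "\<dots> = circle_mean \<rho> (\<lambda>u. 2 * \<bar>Re (G u)\<bar> * (\<rho> * norm (w1 - w2)) / (norm (u - w1) * norm (u - w2)))"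
  proof (rule circle_mean_cong)
    fix u :: complex assume u: "norm u = \<rho>"
    have "of_real (2 * Re (G u)) * u / (u - w1) - of_real (2 * Re (G u)) * u / (u - w2)
        = of_real (2 * Re (G u)) * (u * (w1 - w2)) / ((u - w1) * (u - w2))"
      using ne[OF u] by (simp add: field_simps)
    then show "norm (of_real (2 * Re (G u)) * u / (u - w1) - of_real (2 * Re (G u)) * u / (u - w2))
       = 2 * \<bar>Re (G u)\<bar> * (\<rho> * norm (w1 - w2)) / (norm (u - w1) * norm (u - w2))"
      using u by (simp add: norm_mult norm_divide abs_mult del: of_real_mult)
  qed (use r in auto)
  finally show ?thesis .
qed

lemma holomorphic_deriv_le_circle_mean:
  assumes G: "continuous_on (cball 0 \<rho>) G" "G holomorphic_on ball 0 \<rho>" and w: "norm w < \<rho>"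
  shows "norm (deriv G w) \<le> circle_mean \<rho> (\<lambda>u. 2 * \<bar>Re (G u)\<bar> * \<rho> / (norm (u - w))^2)"
proof -
  have r: "\<rho> > 0" using w norm_ge_zero[of w] by linarith
  have c: "continuous_on (sphere 0 \<rho>) G" using G(1) continuous_on_subset by fastforce
  have ne: "u \<noteq> w" if "norm u = \<rho>" for u using w that by auto
  have "deriv G w = circle_mean \<rho> (\<lambda>u. of_real (2 * Re (G u)) * u / (u - w)^2)"
    using circle_mean_Schwarz(2)[OF G] w by simp
  then have "norm (deriv G w) = norm \<dots>" by (rule arg_cong)
  also have "\<dots> \<le> circle_mean \<rho> (\<lambda>u. norm (of_real (2 * Re (G u)) * u / (u - w)^2))"
    by (rule norm_circle_mean_le) (use c r ne in \<open>auto intro!: continuous_intros\<close>)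
  also have "\<dots> = circle_mean \<rho> (\<lambda>u. 2 * \<bar>Re (G u)\<bar> * \<rho> / (norm (u - w))^2)"
    by (rule circle_mean_cong) (use r in \<open>auto simp: norm_mult norm_divide norm_power abs_mult\<close>)
  finally show ?thesis .
qed

text \<open>With a gap of at least \<open>2 * norm c\<close> the shift at most halves the distance
  to a point of the outer circle. Shifted kernels are thus dominated by multiples of the kernel
  centred at \<open>z\<close>, whose mean over \<open>z\<close> is explicit.\<close>

lemma norm_diff_shift_ge:
  fixes u z c :: complex
  assumes "norm u = \<rho>" "norm z = r" "2 * norm c \<le> \<rho> - r"
  shows "norm (u - z) \<le> 2 * norm (u - (z + c))"
proof -
  have "\<rho> - r \<le> norm (u - z)" using norm_triangle_ineq2[of u z] assms by simp
  moreover have "norm (u - z) \<le> norm (u - (z + c)) + norm c"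
    using norm_triangle_ineq[of "u - (z + c)" c] by simp
  ultimately show ?thesis using assms by linarith
qed

text \<open>Averaging over \<open>z\<close> before \<open>u\<close> replaces the kernel by its
  Poisson mean, a constant on the outer circle. After multiplication by \<open>\<rho>\<close> the
  loss is \<open>\<rho> / (\<rho>^2 - r^2) \<le> 1 / (\<rho> - r)\<close>, governed by the gap
  alone.\<close>

lemma circle_mean_kernel_swap:
  fixes h :: "complex \<Rightarrow> real"
  assumes "continuous_on (sphere 0 \<rho>) h" "0 < r" "r < \<rho>"
  shows "continuous_on (sphere 0 r) (\<lambda>z. circle_mean \<rho> (\<lambda>u. h u / (norm (u - z))^2))"
    and "circle_mean r (\<lambda>z. circle_mean \<rho> (\<lambda>u. h u / (norm (u - z))^2)) = circle_mean \<rho> h / (\<rho>^2 - r^2)"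
proof -
  have ne: "u \<noteq> z" if "norm u = \<rho>" "norm z = r" for u z :: complex using assms that by auto
  have joint: "continuous_on (sphere 0 r \<times> sphere 0 \<rho>) (\<lambda>(z, u). h u / (norm (u - z))^2)"
    unfolding case_prod_unfold
    by (intro continuous_intros continuous_on_compose2[OF assms(1)]) (use assms in auto)
  have "continuous_on (sphere 0 r \<times> cbox 0 (2*pi)) (\<lambda>p. (\<lambda>(z, u). h u / (norm (u - z))^2) (fst p, of_real \<rho> * cis (snd p)))"
    by (rule continuous_on_compose2[OF joint]) (use assms in \<open>auto intro!: continuous_intros simp: norm_mult\<close>)
  then have "continuous_on (sphere 0 r \<times> cbox 0 (2*pi)) (\<lambda>(z, t). h (of_real \<rho> * cis t) / (norm (of_real \<rho> * cis t - z))^2)"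
    by (simp add: case_prod_unfold)
  from integral_continuous_on_param[OF this]
  show "continuous_on (sphere 0 r) (\<lambda>z. circle_mean \<rho> (\<lambda>u. h u / (norm (u - z))^2))"
    unfolding circle_mean_def by (auto intro!: continuous_intros)
  have "circle_mean r (\<lambda>z. circle_mean \<rho> (\<lambda>u. h u / (norm (u - z))^2))
     = circle_mean \<rho> (\<lambda>u. circle_mean r (\<lambda>z. h u / (norm (u - z))^2))"
    by (rule circle_mean_swap) (use joint assms in auto)
  also have "\<dots> = circle_mean \<rho> (\<lambda>u. (1 / (\<rho>^2 - r^2)) * h u)"
  proof (rule circle_mean_cong)
    fix u :: complex assume u: "norm u = \<rho>"
    have "circle_mean r (\<lambda>z. h u / (norm (u - z))^2) = h u * circle_mean r (\<lambda>z. 1 / (norm (u - z))^2)"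
      by (subst circle_mean_cmult[symmetric]) simp
    then show "circle_mean r (\<lambda>z. h u / (norm (u - z))^2) = (1 / (\<rho>^2 - r^2)) * h u"
      using circle_mean_inverse_square[of r u] assms u by simp
  qed (use assms in auto)
  also have "\<dots> = circle_mean \<rho> h / (\<rho>^2 - r^2)" by (simp only: circle_mean_cmult) simp
  finally show "circle_mean r (\<lambda>z. circle_mean \<rho> (\<lambda>u. h u / (norm (u - z))^2)) = circle_mean \<rho> h / (\<rho>^2 - r^2)" .
qed

section \<open>Zeros, poles and Blaschke factorization\<close>

text \<open>Nonvanishing is required near every point, the form that the \<open>zorder\<close> rules
  consume; by the identity theorem it can only fail everywhere at once
  (\<open>nz_mero_dichotomy\<close>).\<close>

definition nz_mero :: "(complex \<Rightarrow> complex) \<Rightarrow> bool" where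
  "nz_mero u \<longleftrightarrow> u meromorphic_on UNIV \<and> (\<forall>z. eventually (\<lambda>w. u w \<noteq> 0) (at z))"

text \<open>Stronger than \<open>zorder u z = 0\<close>: it also constrains the value
  \<open>u z\<close>, which is arbitrary for a merely meromorphic function and an artefact of
  division by zero for many quotients.\<close>

definition unit_at :: "(complex \<Rightarrow> complex) \<Rightarrow> complex \<Rightarrow> bool" where
  "unit_at u z \<longleftrightarrow> u analytic_on {z} \<and> u z \<noteq> 0"

lemma nz_mero_meromorphic: "nz_mero u \<Longrightarrow> u meromorphic_on A"
  unfolding nz_mero_def using meromorphic_on_subset by blast

lemma nz_mero_eventually: "nz_mero u \<Longrightarrow> eventually (\<lambda>w. u w \<noteq> 0) (at z)"
  by (simp add: nz_mero_def)

lemma nz_mero_frequently: "nz_mero u \<Longrightarrow> frequently (\<lambda>w. u w \<noteq> 0) (at z)"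
  using nz_mero_eventually eventually_frequently by (metis trivial_limit_at)

lemma nz_mero_dichotomy:
  assumes "u meromorphic_on UNIV"
  shows "nz_mero u \<or> (\<forall>z. eventually (\<lambda>w. u w = 0) (at z))"
  using meromorphic_imp_constant_or_avoid[OF assms, of 0] assms
  by (auto simp: nz_mero_def eventually_cosparse_open_eq)

lemma nz_mero_const: "c \<noteq> 0 \<Longrightarrow> nz_mero (\<lambda>_. c)"
  by (auto simp: nz_mero_def intro!: meromorphic_intros)

lemma nz_mero_times: "nz_mero u \<Longrightarrow> nz_mero v \<Longrightarrow> nz_mero (\<lambda>z. u z * v z)"
  by (auto simp: nz_mero_def intro!: meromorphic_intros eventually_conj)

lemma nz_mero_inverse: "nz_mero u \<Longrightarrow> nz_mero (\<lambda>z. inverse (u z))"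
  by (auto simp: nz_mero_def intro!: meromorphic_intros)

lemma nz_mero_divide: "nz_mero u \<Longrightarrow> nz_mero v \<Longrightarrow> nz_mero (\<lambda>z. u z / v z)"
  using nz_mero_times[OF _ nz_mero_inverse] by (simp add: divide_inverse)

lemma nz_mero_power_int: "nz_mero u \<Longrightarrow> nz_mero (\<lambda>z. u z powi n)"
  unfolding nz_mero_def
proof (intro conjI allI meromorphic_intros)
  fix z assume "u meromorphic_on UNIV \<and> (\<forall>z. eventually (\<lambda>w. u w \<noteq> 0) (at z))"
  then have "eventually (\<lambda>w. u w \<noteq> 0) (at z)" by blast
  then show "eventually (\<lambda>w. u w powi n \<noteq> 0) (at z)" by eventually_elim simp
qed simp

lemma nz_mero_prod: "(\<And>i. i \<in> I \<Longrightarrow> nz_mero (h i)) \<Longrightarrow> nz_mero (\<lambda>z. \<Prod>i\<in>I. h i z)"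
  by (induction I rule: infinite_finite_induct) (auto intro: nz_mero_times nz_mero_const)

lemma nz_mero_shift:
  assumes "nz_mero u" shows "nz_mero (\<lambda>z. u (z + c))"
  unfolding nz_mero_def
proof safe
  show "(\<lambda>z. u (z + c)) meromorphic_on UNIV"
    by (rule meromorphic_on_compose[OF nz_mero_meromorphic[OF assms, of UNIV]]) (auto intro!: analytic_intros)
  fix z
  have "eventually (\<lambda>w. u w \<noteq> 0) (at (z + c))" using assms by (rule nz_mero_eventually)
  moreover have "filterlim (\<lambda>w. w + c) (at (z + c)) (at z)"
    by (rule filterlim_atI) (auto intro!: tendsto_intros simp: eventually_at_filter)
  ultimately show "eventually (\<lambda>w. u (w + c) \<noteq> 0) (at z)"
    by (rule eventually_compose_filterlim)
qed

lemma zorder_nz_mero_times: "nz_mero u \<Longrightarrow> nz_mero v \<Longrightarrow> zorder (\<lambda>z. u z * v z) z = zorder u z + zorder v z"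
  by (intro zorder_mult nz_mero_meromorphic nz_mero_frequently)

lemma zorder_nz_mero_divide: "nz_mero u \<Longrightarrow> nz_mero v \<Longrightarrow> zorder (\<lambda>z. u z / v z) z = zorder u z - zorder v z"
  by (intro zorder_divide nz_mero_meromorphic nz_mero_frequently)

lemma zorder_nz_mero_inverse: "nz_mero u \<Longrightarrow> zorder (\<lambda>z. inverse (u z)) z = - zorder u z"
  by (intro zorder_inverse nz_mero_frequently meromorphic_on_isolated_singularity meromorphic_on_not_essential nz_mero_meromorphic)

lemma zorder_nz_mero_power_int: "nz_mero u \<Longrightarrow> zorder (\<lambda>z. u z powi n) z = n * zorder u z"
  by (intro zorder_power_int nz_mero_meromorphic nz_mero_frequently)

lemma zorder_nz_mero_prod:
  "(\<And>i. i \<in> I \<Longrightarrow> nz_mero (h i)) \<Longrightarrow> zorder (\<lambda>z. \<Prod>i\<in>I. h i z) z = (\<Sum>i\<in>I. zorder (h i) z)"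
  by (intro zorder_prod nz_mero_meromorphic nz_mero_eventually nz_mero_prod)

lemma zorder_translate: "zorder (\<lambda>z. u (z + c)) z = zorder u (z + c)"
  using zorder_shift[of "\<lambda>z. u (z + c)" z] zorder_shift[of u "z + c"] by (simp add: add_ac)

lemma unit_at_zorder: "unit_at u z \<Longrightarrow> zorder u z = 0"
  unfolding unit_at_def by (metis analytic_at zorder_eqI[of _ z u u 0] mult_1_right power_int_0_right)

lemma zorder_const [simp]: "c \<noteq> 0 \<Longrightarrow> zorder (\<lambda>_. c) z = 0"
  by (rule unit_at_zorder) (auto simp: unit_at_def)

lemma unit_at_times: "unit_at u z \<Longrightarrow> unit_at v z \<Longrightarrow> unit_at (\<lambda>z. u z * v z) z"
  by (auto simp: unit_at_def intro!: analytic_intros)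

lemma unit_at_inverse: "unit_at u z \<Longrightarrow> unit_at (\<lambda>z. inverse (u z)) z"
  by (auto simp: unit_at_def intro!: analytic_intros)

lemma unit_at_divide: "unit_at u z \<Longrightarrow> unit_at v z \<Longrightarrow> unit_at (\<lambda>z. u z / v z) z"
  by (auto simp: unit_at_def intro!: analytic_intros)

lemma analytic_at_shift: "u analytic_on {z + c} \<Longrightarrow> (\<lambda>z. u (z + c)) analytic_on {z}"
proof -
  assume "u analytic_on {z + c}"
  moreover have "(\<lambda>z. z + c) analytic_on {z}" by (intro analytic_intros)
  ultimately show ?thesis using analytic_on_compose[of "\<lambda>z. z + c" "{z}" u] by (simp add: o_def)
qed

lemma unit_at_shift: "unit_at u (z + c) \<Longrightarrow> unit_at (\<lambda>z. u (z + c)) z"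
  by (auto simp: unit_at_def intro!: analytic_at_shift)

lemma nz_mero_sparse: "nz_mero u \<Longrightarrow> {z. \<not> unit_at u z} sparse_in UNIV"
proof -
  assume u: "nz_mero u"
  have "eventually (\<lambda>z. u analytic_on {z}) (cosparse UNIV)"
    by (rule meromorphic_on_imp_analytic_cosparse) (rule nz_mero_meromorphic[OF u])
  moreover have "eventually (\<lambda>z. u z \<noteq> 0) (cosparse UNIV)"
    using nz_mero_eventually[OF u] by (simp add: eventually_cosparse_open_eq)
  ultimately have "eventually (\<lambda>z. unit_at u z) (cosparse UNIV)"
    by eventually_elim (simp add: unit_at_def)
  then show ?thesis by (simp add: eventually_cosparse)
qed

lemma nz_mero_eventually_unit_at: "nz_mero u \<Longrightarrow> eventually (unit_at u) (at z)"
  using nz_mero_sparse[of u] by (simp add: sparse_in_eventually_iff)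

lemma nz_mero_finite:
  assumes "nz_mero u" "bounded A"
  shows "finite {z \<in> A. \<not> unit_at u z}"
proof -
  have "finite (closure A \<inter> {z. \<not> unit_at u z})"
    by (rule sparse_in_compact_finite)
       (use assms nz_mero_sparse[of u] sparse_in_subset in \<open>auto simp: compact_closure\<close>)
  then show ?thesis by (rule finite_subset[rotated]) (use closure_subset in auto)
qed

definition zeros_poles :: "(complex \<Rightarrow> complex) \<Rightarrow> real \<Rightarrow> complex set" where
  "zeros_poles u \<rho> = {b \<in> ball 0 \<rho>. zorder u b \<noteq> 0}"

lemma finite_zeros_poles: "nz_mero u \<Longrightarrow> finite (zeros_poles u \<rho>)"
  by (rule finite_subset[OF _ nz_mero_finite[of u "ball 0 \<rho>"]]) (auto simp: zeros_poles_def unit_at_zorder)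

lemma zeros_poles_notin_unit_at: "unit_at u z \<Longrightarrow> b \<in> zeros_poles u \<rho> \<Longrightarrow> z \<noteq> b"
  by (auto simp: zeros_poles_def unit_at_zorder)

definition unit_on_circle :: "(complex \<Rightarrow> complex) \<Rightarrow> real \<Rightarrow> bool" where
  "unit_on_circle u r \<longleftrightarrow> (\<forall>z\<in>sphere 0 r. unit_at u z)"

lemma unit_on_circle_continuous_ln: 
  assumes "unit_on_circle u r" shows "continuous_on (sphere 0 r) (\<lambda>z. ln (norm (u z)))"
proof -
  have "u analytic_on sphere 0 r" using assms by (subst analytic_on_analytic_at) (auto simp: unit_on_circle_def unit_at_def)
  then have "continuous_on (sphere 0 r) u" by (intro holomorphic_on_imp_continuous_on analytic_imp_holomorphic)
  then show ?thesis using assms by (intro continuous_intros) (auto simp: unit_on_circle_def unit_at_def)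
qed

section \<open>Blaschke factors and factorization on a disc\<close>

definition blaschke :: "real \<Rightarrow> complex \<Rightarrow> complex \<Rightarrow> complex" where
  "blaschke \<rho> b z = of_real \<rho> * (z - b) / (of_real (\<rho>^2) - cnj b * z)"

context
  fixes \<rho> :: real and b :: complex
  assumes b: "norm b < \<rho>"
begin

lemma rho_pos: "\<rho> > 0"
  using b norm_ge_zero[of b] by linarith

lemma blaschke_denom: "norm z \<le> \<rho> \<Longrightarrow> of_real (\<rho>^2) - cnj b * z \<noteq> 0"
proof
  assume z: "norm z \<le> \<rho>" and "of_real (\<rho>^2) - cnj b * z = 0"
  then have "norm (cnj b * z) = \<rho>^2"
    by (metis eq_iff_diff_eq_0 norm_of_real abs_power2)
  moreover have "norm b * norm z < \<rho> * \<rho>"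
    using mult_left_mono[OF z, of "norm b"] mult_strict_right_mono[OF b rho_pos] by simp
  ultimately show False by (simp add: norm_mult power2_eq_square)
qed

lemma norm_blaschke: "norm z = \<rho> \<Longrightarrow> norm (blaschke \<rho> b z) = 1"
proof -
  assume z: "norm z = \<rho>"
  have "z \<noteq> 0" using z rho_pos by auto
  have "of_real (\<rho>^2) - cnj b * z = z * (cnj z - cnj b)"
    using complex_norm_square[of z] z by (simp add: algebra_simps)
  then have "norm (of_real (\<rho>^2) - cnj b * z) = \<rho> * norm (z - b)"
    using z by (metis norm_mult complex_cnj_diff complex_mod_cnj)
  moreover have "z \<noteq> b" using z b by auto
  ultimately show ?thesis using rho_pos by (simp add: blaschke_def norm_divide norm_mult)
qed

lemma unit_at_blaschke: "norm z \<le> \<rho> \<Longrightarrow> z \<noteq> b \<Longrightarrow> unit_at (blaschke \<rho> b) z"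
  using blaschke_denom[of z] rho_pos
  unfolding unit_at_def blaschke_def by (auto intro!: analytic_intros)

lemma zorder_blaschke_self: "zorder (blaschke \<rho> b) b = 1"
proof (rule zorder_eqI[where S = "ball 0 \<rho>" and g = "\<lambda>z. of_real \<rho> / (of_real (\<rho>^2) - cnj b * z)"])
  show "(\<lambda>z. of_real \<rho> / (of_real (\<rho>^2) - cnj b * z)) holomorphic_on ball 0 \<rho>"
    using blaschke_denom by (intro holomorphic_intros) auto
qed (use b blaschke_denom[of b] rho_pos in \<open>auto simp: blaschke_def\<close>)

lemma zorder_blaschke: "norm z \<le> \<rho> \<Longrightarrow> zorder (blaschke \<rho> b) z = (if z = b then 1 else 0)"
  using zorder_blaschke_self unit_at_zorder[OF unit_at_blaschke] by auto

lemma nz_mero_blaschke: "nz_mero (blaschke \<rho> b)"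
  unfolding nz_mero_def
proof safe
  show "blaschke \<rho> b meromorphic_on UNIV"
    unfolding blaschke_def[abs_def] by (intro meromorphic_intros)
  fix z
  have "{w. blaschke \<rho> b w = 0} \<subseteq> {b, of_real (\<rho>^2) / cnj b}"
    using rho_pos by (auto simp: blaschke_def)
  then have "finite {w. blaschke \<rho> b w = 0}" using finite_subset by blast
  then have "\<not> z islimpt {w. blaschke \<rho> b w = 0}" by (rule islimpt_finite)
  then show "eventually (\<lambda>w. blaschke \<rho> b w \<noteq> 0) (at z)"
    by (simp add: islimpt_iff_eventually)
qed

end

lemma remove_sings_zorder_0:
  assumes "nz_mero u" "zorder u z = 0"
  shows "unit_at (remove_sings u) z"
proof -
  have iso: "isolated_singularity_at u z" and ne: "not_essential u z"
    using nz_mero_meromorphic[OF assms(1), of "{z}"] by (auto simp: meromorphic_at_iff)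
  have np: "\<not> is_pole u z"
    using iso isolated_pole_imp_neg_zorder assms(2) by fastforce
  then obtain c where c: "u \<midarrow>z\<rightarrow> c" using ne by (auto simp: not_essential_def)
  have an: "remove_sings u analytic_on {z}" by (rule remove_sings_analytic_at[OF iso c])
  have "zorder (remove_sings u) z = 0" using iso assms(2) by simp
  moreover have "frequently (\<lambda>w. remove_sings u w \<noteq> 0) (at z)"
    using eventually_remove_sings_eq_at[OF iso] nz_mero_frequently[OF assms(1), of z]
    by (rule_tac frequently_rev_mp) (auto elim!: eventually_mono)
  ultimately have "remove_sings u z \<noteq> 0" using zorder_eq_0_iff[OF an] by blast
  with an show ?thesis by (simp add: unit_at_def)
qed

text \<open>Dividing by the Blaschke product cancels every zero and pole of \<open>u\<close> in the
  disc. The quotient, with its removable singularities filled, is zero free on the closed disc and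
  has a holomorphic logarithm there because the disc is convex. The identity is claimed at units
  only, since elsewhere the value \<open>u z\<close> says nothing about the germ.\<close>

lemma blaschke_factorization:
  assumes u: "nz_mero u" and g: "unit_on_circle u \<rho>" and \<rho>: "\<rho> > 0"
  obtains G where "continuous_on (cball 0 \<rho>) G" "G holomorphic_on ball 0 \<rho>"
    "\<And>z. norm z \<le> \<rho> \<Longrightarrow> unit_at u z \<Longrightarrow> u z = exp (G z) * (\<Prod>b\<in>zeros_poles u \<rho>. blaschke \<rho> b z powi zorder u b)"
proof -
  define P where "P = (\<lambda>z. \<Prod>b\<in>zeros_poles u \<rho>. blaschke \<rho> b z powi zorder u b)"
  define E where "E = (\<lambda>z. u z / P z)"
  have bz: "norm b < \<rho>" if "b \<in> zeros_poles u \<rho>" for b using that by (auto simp: zeros_poles_def)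
  have mP: "nz_mero P" unfolding P_def by (intro nz_mero_prod nz_mero_power_int nz_mero_blaschke bz)
  have mE: "nz_mero E" unfolding E_def by (intro nz_mero_divide u mP)
  have zP: "zorder P z = zorder u z" if "norm z \<le> \<rho>" for z
  proof -
    have "zorder P z = (\<Sum>b\<in>zeros_poles u \<rho>. zorder u b * zorder (blaschke \<rho> b) z)"
      unfolding P_def
      by (subst zorder_nz_mero_prod) (auto intro!: nz_mero_power_int nz_mero_blaschke bz sum.cong zorder_nz_mero_power_int)
    also have "\<dots> = (\<Sum>b\<in>zeros_poles u \<rho>. if z = b then zorder u b else 0)"
      by (rule sum.cong) (use that in \<open>auto simp: zorder_blaschke bz\<close>)
    also have "\<dots> = (if z \<in> zeros_poles u \<rho> then zorder u z else 0)"
      using finite_zeros_poles[OF u] by simp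
    \<comment> \<open>Points of the circle are not in \<open>zeros_poles\<close> but have order
      \<open>0\<close> by \<open>unit_on_circle\<close>; this bridges the open and the closed
      disc.\<close>
    also have "\<dots> = zorder u z"
      using g that unit_at_zorder[of u z] by (auto simp: zeros_poles_def unit_on_circle_def order_le_less)
    finally show ?thesis .
  qed
  have zE: "zorder E z = 0" if "norm z \<le> \<rho>" for z
    unfolding E_def using zorder_nz_mero_divide[OF u mP] zP[OF that] by simp
  have gE: "unit_at (remove_sings E) z" if "norm z \<le> \<rho>" for z
    by (rule remove_sings_zorder_0[OF mE zE[OF that]])
  have "remove_sings E analytic_on cball 0 \<rho>"
    using gE by (subst analytic_on_analytic_at) (auto simp: unit_at_def)
  then have "remove_sings E holomorphic_on cball 0 \<rho>" by (rule analytic_imp_holomorphic)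
  then obtain G where G: "G holomorphic_on cball 0 \<rho>" "\<And>z. z \<in> cball 0 \<rho> \<Longrightarrow> remove_sings E z = exp (G z)"
    by (rule contractible_imp_holomorphic_log)
       (use gE in \<open>auto simp: unit_at_def intro!: convex_imp_contractible\<close>)
  show thesis
  proof (rule that[of G])
    fix z assume z: "norm z \<le> \<rho>" "unit_at u z"
    have gP: "unit_at P z"
      unfolding P_def unit_at_def
      using unit_at_blaschke[OF bz z(1)] zeros_poles_notin_unit_at[OF z(2)] finite_zeros_poles[OF u]
      by (auto simp: unit_at_def intro!: analytic_intros)
    have "unit_at E z" unfolding E_def by (intro unit_at_divide z gP)
    then have "E z = exp (G z)" using G(2)[of z] z(1) by (simp add: unit_at_def)
    then show "u z = exp (G z) * (\<Prod>b\<in>zeros_poles u \<rho>. blaschke \<rho> b z powi zorder u b)"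
      using gP by (simp add: E_def unit_at_def P_def field_simps)
  qed (use G(1) holomorphic_on_imp_continuous_on holomorphic_on_subset ball_subset_cball in blast)+
qed

section \<open>Shift quotients and logarithmic derivatives on circles\<close>

lemma powr_add_le:
  fixes x y \<alpha> :: real
  assumes "0 \<le> x" "0 \<le> y" "0 < \<alpha>" "\<alpha> \<le> 1"
  shows "(x + y) powr \<alpha> \<le> x powr \<alpha> + y powr \<alpha>"
proof (cases "x + y = 0")
  case False
  then have p: "x + y > 0" using assms by linarith
  \<comment> \<open>After division by \<open>x + y\<close> both summands lie in
    \<open>[0, 1]\<close>, where raising to a power \<open>\<alpha> \<le> 1\<close> does not
    decrease them.\<close>
  have le: "t / (x + y) \<le> (t / (x + y)) powr \<alpha>" if "0 \<le> t" "t \<le> x + y" for t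
  proof (cases "t = 0")
    case False
    then show ?thesis using powr_mono'[of \<alpha> 1 "t / (x + y)"] assms p that by simp
  qed simp
  have "1 = x / (x + y) + y / (x + y)" using p by (simp add: add_divide_distrib[symmetric])
  also have "\<dots> \<le> (x / (x + y)) powr \<alpha> + (y / (x + y)) powr \<alpha>"
    using le[of x] le[of y] assms by simp
  also have "\<dots> = (x powr \<alpha> + y powr \<alpha>) / (x + y) powr \<alpha>"
    using assms p by (simp add: powr_divide add_divide_distrib)
  finally show ?thesis using p by (simp add: le_divide_eq)
qed (use assms in auto)

lemma powr_sum_le:
  fixes f :: "'a \<Rightarrow> real"
  assumes "\<And>i. i \<in> I \<Longrightarrow> 0 \<le> f i" "0 < \<alpha>" "\<alpha> \<le> 1"
  shows "(\<Sum>i\<in>I. f i) powr \<alpha> \<le> (\<Sum>i\<in>I. f i powr \<alpha>)"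
  using assms(1)
proof (induction I rule: infinite_finite_induct)
  case (insert i I)
  have "(\<Sum>i\<in>insert i I. f i) powr \<alpha> \<le> f i powr \<alpha> + (\<Sum>i\<in>I. f i) powr \<alpha>"
    using insert assms by (simp add: powr_add_le sum_nonneg)
  also have "\<dots> \<le> f i powr \<alpha> + (\<Sum>i\<in>I. f i powr \<alpha>)" using insert by simp
  finally show ?case using insert by simp
qed auto

lemma lnplus_max: "lnplus x = ln (max x 1)"
  by (auto simp: lnplus_def)

lemma lnplus_nonneg: "0 \<le> lnplus x"
  by (auto simp: lnplus_def)

lemma continuous_on_lnplus:
  fixes h :: "'a::t2_space \<Rightarrow> complex"
  assumes "continuous_on A h" shows "continuous_on A (\<lambda>z. lnplus (norm (h z)))"
  unfolding lnplus_max using assms by (intro continuous_intros) auto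

lemma lnplus_le_powr:
  assumes "0 < \<alpha>" shows "lnplus y \<le> y powr \<alpha> / \<alpha>"
proof (cases "y \<le> 1")
  case False
  have "\<alpha> * ln y = ln (y powr \<alpha>)" using False by (simp add: ln_powr)
  also have "\<dots> \<le> y powr \<alpha>" using ln_bound[of "y powr \<alpha>"] False by simp
  finally show ?thesis using False assms by (simp add: lnplus_def field_simps)
qed (use assms in \<open>simp add: lnplus_def\<close>)

lemma ln_1_add_le_powr:
  assumes "0 < \<alpha>" "\<alpha> \<le> 1" "0 \<le> (x::real)"
  shows "ln (1 + x) \<le> x powr \<alpha> / \<alpha>"
proof -
  have "\<alpha> * ln (1 + x) = ln ((1 + x) powr \<alpha>)" using assms by (simp add: ln_powr)
  also have "\<dots> \<le> ln (1 + x powr \<alpha>)"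
    using powr_add_le[of 1 x \<alpha>] assms by (subst ln_le_cancel_iff) (auto intro!: add_pos_nonneg)
  also have "\<dots> \<le> x powr \<alpha>" by (rule ln_add_one_self_le_self) simp
  finally show ?thesis using assms by (simp add: field_simps)
qed

text \<open>Using \<open>ln (1 + x) \<le> x powr \<alpha> / \<alpha>\<close> in place of
  \<open>ln (1 + x) \<le> x\<close> softens the singularities at \<open>p = 0\<close> and
  \<open>q = 0\<close> to order \<open>\<alpha>\<close>. For \<open>\<alpha> < 1\<close> their means
  over circles are bounded uniformly, however close the zero is to the circle.\<close>

lemma ln_norm_ratio_le:
  fixes p q :: complex
  assumes "p \<noteq> 0" "q \<noteq> 0" "0 < \<alpha>" "\<alpha> \<le> 1"
  shows "\<bar>ln (norm p) - ln (norm q)\<bar> \<le> norm (p - q) powr \<alpha> / \<alpha> * (norm p powr -\<alpha> + norm q powr -\<alpha>)"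
proof -
  have *: "ln (norm p) - ln (norm q) \<le> norm (p - q) powr \<alpha> / \<alpha> * (norm q powr -\<alpha>)"
    if "p \<noteq> 0" "q \<noteq> 0" for p q :: complex
  proof -
    have "norm p \<le> norm q + norm (p - q)" using norm_triangle_ineq[of q "p - q"] by simp
    then have "norm p / norm q \<le> 1 + norm (p - q) / norm q"
      using that by (simp add: field_simps)
    then have "ln (norm p / norm q) \<le> ln (1 + norm (p - q) / norm q)"
      using that by (intro ln_mono) (auto simp: add_pos_nonneg)
    also have "\<dots> \<le> (norm (p - q) / norm q) powr \<alpha> / \<alpha>"
      by (rule ln_1_add_le_powr) (use assms in auto)
    finally show ?thesis using that by (simp add: ln_div powr_divide powr_minus field_simps)
  qed
  have "norm (p - q) powr \<alpha> / \<alpha> * (norm q powr -\<alpha>) \<ge> 0" "norm (p - q) powr \<alpha> / \<alpha> * (norm p powr -\<alpha>) \<ge> 0"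
    using assms by auto
  with *[of p q] *[of q p] assms show ?thesis
    unfolding distrib_left norm_minus_commute[of q p] by linarith
qed

lemma circle_mean_sum_cmult:
  fixes h :: "'b \<Rightarrow> complex \<Rightarrow> real"
  assumes "finite I" "\<And>i. i \<in> I \<Longrightarrow> continuous_on (sphere 0 r) (h i)" "0 \<le> r"
  shows "circle_mean r (\<lambda>z. \<Sum>i\<in>I. a i * h i z) = (\<Sum>i\<in>I. a i * circle_mean r (h i))"
  using assms by (subst circle_mean_sum) (auto intro!: continuous_intros simp: circle_mean_cmult)

text \<open>The pole of the Blaschke factor; the junk value \<open>0\<close> for \<open>b = 0\<close> is harmless, since it only enters upper bounds.\<close>

definition reflect :: "real \<Rightarrow> complex \<Rightarrow> complex" where
  "reflect \<rho> b = of_real (\<rho>^2) / cnj b"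

text \<open>The reflected point is not in the open disc, except for the value \<open>0\<close> at
  \<open>b = 0\<close>, which the hypothesis \<open>x \<noteq> b\<close> excludes.\<close>

lemma ne_reflect:
  assumes "norm b < \<rho>" "norm x < \<rho>" "x \<noteq> b"
  shows "x \<noteq> reflect \<rho> b"
proof (cases "b = 0")
  case False
  have "\<rho> * norm b \<le> \<rho> * \<rho>" using assms(1) rho_pos[OF assms(1)] by simp
  then have "\<rho> \<le> norm (reflect \<rho> b)" using False
    by (simp add: reflect_def norm_divide norm_power power2_eq_square le_divide_eq norm_mult)
  then show ?thesis using assms by auto
qed (use assms in \<open>simp add: reflect_def\<close>)

lemma blaschke_denom_reflect: "b \<noteq> 0 \<Longrightarrow> of_real (\<rho>^2) - cnj b * x = - cnj b * (x - reflect \<rho> b)"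
  by (simp add: reflect_def field_simps)

text \<open>The zero \<open>b\<close> and the pole \<open>reflect \<rho> b\<close> of the factor
  each contribute the logarithm of one ratio.\<close>

lemma ln_norm_blaschke_diff_le:
  assumes b: "norm b < \<rho>" and xy: "norm x < \<rho>" "norm y < \<rho>" "x \<noteq> b" "y \<noteq> b"
    and \<alpha>: "0 < \<alpha>" "\<alpha> \<le> 1"
  shows "\<bar>ln (norm (blaschke \<rho> b x)) - ln (norm (blaschke \<rho> b y))\<bar>
    \<le> norm (x - y) powr \<alpha> / \<alpha> * (norm (x - b) powr -\<alpha> + norm (y - b) powr -\<alpha>
        + norm (x - reflect \<rho> b) powr -\<alpha> + norm (y - reflect \<rho> b) powr -\<alpha>)"
proof -
  have d: "of_real (\<rho>^2) - cnj b * x \<noteq> 0" "of_real (\<rho>^2) - cnj b * y \<noteq> 0"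
    using blaschke_denom[OF b] xy by auto
  have e: "ln (norm (blaschke \<rho> b w)) = ln \<rho> + ln (norm (w - b)) - ln (norm (of_real (\<rho>^2) - cnj b * w))"
    if "w \<noteq> b" "of_real (\<rho>^2) - cnj b * w \<noteq> 0" for w
    using that rho_pos[OF b] by (simp add: blaschke_def norm_divide norm_mult ln_mult ln_div)
  have 1: "\<bar>ln (norm (x - b)) - ln (norm (y - b))\<bar>
     \<le> norm (x - y) powr \<alpha> / \<alpha> * (norm (x - b) powr -\<alpha> + norm (y - b) powr -\<alpha>)"
    using ln_norm_ratio_le[of "x - b" "y - b" \<alpha>] xy \<alpha> by simp
  have 2: "\<bar>ln (norm (of_real (\<rho>^2) - cnj b * x)) - ln (norm (of_real (\<rho>^2) - cnj b * y))\<bar>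
     \<le> norm (x - y) powr \<alpha> / \<alpha> * (norm (x - reflect \<rho> b) powr -\<alpha> + norm (y - reflect \<rho> b) powr -\<alpha>)"
  \<comment> \<open>For \<open>b = 0\<close> the denominator is constant and the left side
    vanishes.\<close>
  proof (cases "b = 0")
    case False
    have ne: "x \<noteq> reflect \<rho> b" "y \<noteq> reflect \<rho> b" using ne_reflect[OF b] xy by auto
    have "ln (norm (of_real (\<rho>^2) - cnj b * w)) = ln (norm b) + ln (norm (w - reflect \<rho> b))"
      if "w \<noteq> reflect \<rho> b" for w
      unfolding blaschke_denom_reflect[OF False] using False that by (simp add: norm_mult ln_mult)
    then show ?thesis
      using ln_norm_ratio_le[of "x - reflect \<rho> b" "y - reflect \<rho> b" \<alpha>] ne \<alpha> by simp
  qed (use \<alpha> in simp)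
  show ?thesis
    using 1 2 unfolding e[OF xy(3) d(1)] e[OF xy(4) d(2)] distrib_left by linarith
qed

definition zeros_poles_count :: "(complex \<Rightarrow> complex) \<Rightarrow> real \<Rightarrow> real" where
  "zeros_poles_count u \<rho> = (\<Sum>b\<in>zeros_poles u \<rho>. \<bar>real_of_int (zorder u b)\<bar>)"

lemma zeros_poles_count_nonneg: "zeros_poles_count u \<rho> \<ge> 0"
  by (auto simp: zeros_poles_count_def intro!: sum_nonneg)

lemma ln_norm_factorization:
  assumes u: "nz_mero u" "unit_at u z" "norm z \<le> \<rho>"
    and eq: "u z = exp (G z) * (\<Prod>b\<in>zeros_poles u \<rho>. blaschke \<rho> b z powi zorder u b)"
  shows "ln (norm (u z)) = Re (G z) + (\<Sum>b\<in>zeros_poles u \<rho>. real_of_int (zorder u b) * ln (norm (blaschke \<rho> b z)))"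
proof -
  have B: "blaschke \<rho> b z \<noteq> 0" if "b \<in> zeros_poles u \<rho>" for b
    using unit_at_blaschke[of b \<rho> z] zeros_poles_notin_unit_at[OF u(2) that] u(3) that by (auto simp: unit_at_def zeros_poles_def)
  have "ln (norm (u z)) = ln (exp (Re (G z)) * (\<Prod>b\<in>zeros_poles u \<rho>. norm (blaschke \<rho> b z) powi zorder u b))"
    unfolding eq by (simp add: norm_mult prod_norm[symmetric] norm_power_int)
  also have "\<dots> = Re (G z) + (\<Sum>b\<in>zeros_poles u \<rho>. ln (norm (blaschke \<rho> b z) powi zorder u b))"
    using B finite_zeros_poles[OF u(1)] by (subst ln_mult) (auto intro!: prod_pos ln_prod simp: zero_less_power_int)
  also have "(\<Sum>b\<in>zeros_poles u \<rho>. ln (norm (blaschke \<rho> b z) powi zorder u b))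
     = (\<Sum>b\<in>zeros_poles u \<rho>. real_of_int (zorder u b) * ln (norm (blaschke \<rho> b z)))"
    by (rule sum.cong) (use B in \<open>auto simp: powr_real_of_int'[symmetric] ln_powr\<close>)
  finally show ?thesis .
qed

lemma norm_add_less:
  fixes z c :: complex
  assumes "norm z = r" "2 * norm c \<le> \<rho> - r" "r < \<rho>"
  shows "norm (z + c) < \<rho>"
  using norm_triangle_ineq[of z c] assms by linarith

text \<open>The distance from \<open>z + c\<close> to \<open>b\<close> is that from \<open>z\<close>
  to \<open>b - c\<close>, so the uniformity in the singular point covers all shifts.\<close>

lemma circle_mean_shift_powr_le:
  assumes "0 < \<alpha>" "\<alpha> < 1" "0 < r" "\<And>z. norm z = r \<Longrightarrow> z + c \<noteq> b"
  shows "circle_mean r (\<lambda>z. norm (z + c - b) powr -\<alpha>) \<le> circle_powr_const \<alpha> * r powr -\<alpha>"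
    and "continuous_on (sphere 0 r) (\<lambda>z. norm (z + c - b) powr -\<alpha>)"
proof -
  have "norm (b - c) \<noteq> r" using assms(4)[of "b - c"] by auto
  from circle_mean_powr_le[OF assms(1-3) this]
  show "circle_mean r (\<lambda>z. norm (z + c - b) powr -\<alpha>) \<le> circle_powr_const \<alpha> * r powr -\<alpha>"
    by (simp add: diff_diff_eq2)
  show "continuous_on (sphere 0 r) (\<lambda>z. norm (z + c - b) powr -\<alpha>)"
    using assms(4) by (intro continuous_intros) auto
qed

context
  fixes u :: "complex \<Rightarrow> complex" and \<rho> r \<alpha> :: real
  assumes u: "nz_mero u" and g\<rho>: "unit_on_circle u \<rho>" and r: "0 < r" "r < \<rho>" and \<alpha>: "0 < \<alpha>" "\<alpha> < 1"
begin

lemma mean_abs_ln_nonneg: "circle_mean \<rho> (\<lambda>z. \<bar>ln (norm (u z))\<bar>) \<ge> 0"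
  using r unit_on_circle_continuous_ln[OF g\<rho>] by (intro circle_mean_nonneg continuous_on_rabs) auto

text \<open>The \<open>8\<close> combines the \<open>2\<close> of the Schwarz formula with the
  \<open>4\<close> that arises when shifted distances are replaced by unshifted ones
  (\<open>norm_diff_shift_ge\<close>).\<close>

lemma kernel_mean_le:
  assumes "continuous_on (sphere 0 \<rho>) G" "\<And>z. norm z = \<rho> \<Longrightarrow> Re (G z) = ln (norm (u z))" "d \<ge> 0"
  shows "circle_mean r (\<lambda>z. circle_mean \<rho> (\<lambda>w. 8 * \<bar>Re (G w)\<bar> * (\<rho> * d) / (norm (w - z))^2))
     \<le> 8 * d / (\<rho> - r) * circle_mean \<rho> (\<lambda>z. \<bar>ln (norm (u z))\<bar>)"
proof -
  have "circle_mean r (\<lambda>z. circle_mean \<rho> (\<lambda>w. 8 * \<bar>Re (G w)\<bar> * (\<rho> * d) / (norm (w - z))^2))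
    = circle_mean \<rho> (\<lambda>w. 8 * \<bar>Re (G w)\<bar> * (\<rho> * d)) / (\<rho>^2 - r^2)"
    by (rule circle_mean_kernel_swap(2)) (use r assms in \<open>auto intro!: continuous_intros\<close>)
  also have "circle_mean \<rho> (\<lambda>w. 8 * \<bar>Re (G w)\<bar> * (\<rho> * d)) = circle_mean \<rho> (\<lambda>w. (8 * \<rho> * d) * \<bar>ln (norm (u w))\<bar>)"
    by (rule circle_mean_cong) (use r assms(2) in auto)
  also have "\<dots> / (\<rho>^2 - r^2) = (\<rho> / (\<rho> + r)) * (8 * d / (\<rho> - r) * circle_mean \<rho> (\<lambda>z. \<bar>ln (norm (u z))\<bar>))"
    using r unfolding circle_mean_cmult by (simp add: power2_eq_square square_diff_square_factored)
  also have "\<dots> \<le> 1 * (8 * d / (\<rho> - r) * circle_mean \<rho> (\<lambda>z. \<bar>ln (norm (u z))\<bar>))"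
    by (rule mult_right_mono) (use r mean_abs_ln_nonneg assms(3) in auto)
  finally show ?thesis by simp
qed

text \<open>Difference analogue of the lemma on the logarithmic derivative, for one pair of circles.
  The zero-free factor \<open>exp G\<close> yields the first term through the Schwarz kernel, each
  Blaschke factor a share of the second through \<open>ln_norm_blaschke_diff_le\<close>. The first
  is small when the gap \<open>\<rho> - r\<close> is large, the second when the count is small
  against \<open>r powr \<alpha>\<close> times the characteristic.\<close>

lemma mean_ln_shift_ratio_le:
  assumes c: "2 * norm c1 \<le> \<rho> - r" "2 * norm c2 \<le> \<rho> - r"
    and g: "\<And>z. norm z = r \<Longrightarrow> unit_at u (z + c1)" "\<And>z. norm z = r \<Longrightarrow> unit_at u (z + c2)"
  shows "circle_mean r (\<lambda>z. \<bar>ln (norm (u (z + c1))) - ln (norm (u (z + c2)))\<bar>)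
    \<le> 8 * norm (c1 - c2) / (\<rho> - r) * circle_mean \<rho> (\<lambda>z. \<bar>ln (norm (u z))\<bar>)
      + zeros_poles_count u \<rho> * (norm (c1 - c2) powr \<alpha> / \<alpha> * (4 * circle_powr_const \<alpha> * r powr -\<alpha>))"
proof -
  have \<rho>: "\<rho> > 0" using r by simp
  obtain G where G: "continuous_on (cball 0 \<rho>) G" "G holomorphic_on ball 0 \<rho>"
    "\<And>z. norm z \<le> \<rho> \<Longrightarrow> unit_at u z \<Longrightarrow> u z = exp (G z) * (\<Prod>b\<in>zeros_poles u \<rho>. blaschke \<rho> b z powi zorder u b)"
    using blaschke_factorization[OF u g\<rho> \<rho>] by blast
  have cG: "continuous_on (sphere 0 \<rho>) G" using G(1) continuous_on_subset by fastforce
  have lnu: "ln (norm (u z)) = Re (G z) + (\<Sum>b\<in>zeros_poles u \<rho>. real_of_int (zorder u b) * ln (norm (blaschke \<rho> b z)))"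
    if "norm z \<le> \<rho>" "unit_at u z" for z
    by (rule ln_norm_factorization[OF u that(2,1)]) (rule G(3)[OF that])
  have b\<rho>: "norm b < \<rho>" if "b \<in> zeros_poles u \<rho>" for b using that by (simp add: zeros_poles_def)
  \<comment> \<open>On the outer circle every Blaschke factor has modulus \<open>1\<close>, so
    \<open>Re G\<close> has the boundary values of \<open>ln (norm (u z))\<close>.\<close>
  have ReG: "Re (G z) = ln (norm (u z))" if "norm z = \<rho>" for z
    using lnu[of z] that g\<rho> b\<rho> by (simp add: unit_on_circle_def norm_blaschke)
  have n1: "norm (z + c1) < \<rho>" and n2: "norm (z + c2) < \<rho>" if "norm z = r" for z
    using norm_add_less[OF that c(1) r(2)] norm_add_less[OF that c(2) r(2)] by auto
  define S where "S = (\<lambda>b z. norm (z + c1 - b) powr -\<alpha> + norm (z + c2 - b) powr -\<alpha>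
        + norm (z + c1 - reflect \<rho> b) powr -\<alpha> + norm (z + c2 - reflect \<rho> b) powr -\<alpha>)"
  define K where "K = norm (c1 - c2) powr \<alpha> / \<alpha>"
  have K: "K \<ge> 0" using \<alpha> by (simp add: K_def)
  define M where "M = (\<lambda>z. circle_mean \<rho> (\<lambda>w. 8 * \<bar>Re (G w)\<bar> * (\<rho> * norm (c1 - c2)) / (norm (w - z))^2))"
  have ne: "z + c1 \<noteq> b" "z + c2 \<noteq> b" "z + c1 \<noteq> reflect \<rho> b" "z + c2 \<noteq> reflect \<rho> b"
    if "b \<in> zeros_poles u \<rho>" "norm z = r" for b z
    using zeros_poles_notin_unit_at[OF g(1)[OF that(2)] that(1)] zeros_poles_notin_unit_at[OF g(2)[OF that(2)] that(1)]
      ne_reflect[OF b\<rho>[OF that(1)]] n1[OF that(2)] n2[OF that(2)] by auto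
  have cS: "continuous_on (sphere 0 r) (S b)" if "b \<in> zeros_poles u \<rho>" for b
    unfolding S_def by (intro continuous_on_add circle_mean_shift_powr_le(2) \<alpha> r ne that)
  have mS: "circle_mean r (S b) \<le> 4 * (circle_powr_const \<alpha> * r powr -\<alpha>)" if b: "b \<in> zeros_poles u \<rho>" for b
  proof -
    note cont = circle_mean_shift_powr_le(2)[OF \<alpha> r(1) ne(1)[OF b]] circle_mean_shift_powr_le(2)[OF \<alpha> r(1) ne(2)[OF b]]
      circle_mean_shift_powr_le(2)[OF \<alpha> r(1) ne(3)[OF b]] circle_mean_shift_powr_le(2)[OF \<alpha> r(1) ne(4)[OF b]]
    note mean = circle_mean_shift_powr_le(1)[OF \<alpha> r(1) ne(1)[OF b]] circle_mean_shift_powr_le(1)[OF \<alpha> r(1) ne(2)[OF b]]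
      circle_mean_shift_powr_le(1)[OF \<alpha> r(1) ne(3)[OF b]] circle_mean_shift_powr_le(1)[OF \<alpha> r(1) ne(4)[OF b]]
    have "circle_mean r (S b) = circle_mean r (\<lambda>z. norm (z + c1 - b) powr -\<alpha>) + circle_mean r (\<lambda>z. norm (z + c2 - b) powr -\<alpha>)
        + circle_mean r (\<lambda>z. norm (z + c1 - reflect \<rho> b) powr -\<alpha>) + circle_mean r (\<lambda>z. norm (z + c2 - reflect \<rho> b) powr -\<alpha>)"
      unfolding S_def using r cont by (simp add: circle_mean_add continuous_on_add)
    with mean show ?thesis by linarith
  qed
  have cM: "continuous_on (sphere 0 r) M"
    unfolding M_def by (rule circle_mean_kernel_swap(1)) (use r cG in \<open>auto intro!: continuous_intros\<close>)
  have pw: "\<bar>ln (norm (u (z + c1))) - ln (norm (u (z + c2)))\<bar>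
      \<le> M z + (\<Sum>b\<in>zeros_poles u \<rho>. (\<bar>real_of_int (zorder u b)\<bar> * K) * S b z)" if z: "norm z = r" for z
  proof -
    have "\<bar>Re (G (z + c1)) - Re (G (z + c2))\<bar> \<le> norm (G (z + c1) - G (z + c2))"
      using abs_Re_le_cmod[of "G (z + c1) - G (z + c2)"] by simp
    also have "\<dots> \<le> circle_mean \<rho> (\<lambda>w. 2 * \<bar>Re (G w)\<bar> * (\<rho> * norm (z + c1 - (z + c2))) / (norm (w - (z + c1)) * norm (w - (z + c2))))"
      by (rule holomorphic_diff_le_circle_mean[OF G(1,2) n1[OF z] n2[OF z]])
    also have "\<dots> \<le> M z"
      unfolding M_def
    proof (rule circle_mean_mono)
      fix w :: complex assume w: "norm w = \<rho>"
      have a: "norm (w - z) \<le> 2 * norm (w - (z + c1))" "norm (w - z) \<le> 2 * norm (w - (z + c2))"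
        using norm_diff_shift_ge[OF w z] c by auto
      have "w \<noteq> z" using w z r by auto
      then have "norm (w - z) > 0" by simp
      have "(norm (w - z))^2 \<le> (2 * norm (w - (z + c1))) * (2 * norm (w - (z + c2)))"
        unfolding power2_eq_square by (rule mult_mono) (use a in auto)
      then have "1 / (norm (w - (z + c1)) * norm (w - (z + c2))) \<le> 4 / (norm (w - z))^2"
        using \<open>norm (w - z) > 0\<close> a
        by (subst frac_le_eq) (auto simp: divide_le_0_iff algebra_simps)
      then have "2 * \<bar>Re (G w)\<bar> * (\<rho> * norm (c1 - c2)) * (1 / (norm (w - (z + c1)) * norm (w - (z + c2))))
         \<le> 2 * \<bar>Re (G w)\<bar> * (\<rho> * norm (c1 - c2)) * (4 / (norm (w - z))^2)"
        using \<rho> by (intro mult_left_mono) auto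
      then show "2 * \<bar>Re (G w)\<bar> * (\<rho> * norm (z + c1 - (z + c2))) / (norm (w - (z + c1)) * norm (w - (z + c2)))
         \<le> 8 * \<bar>Re (G w)\<bar> * (\<rho> * norm (c1 - c2)) / (norm (w - z))^2" by simp
    next
      have "w \<noteq> z + c1" "w \<noteq> z + c2" "w \<noteq> z" if "norm w = \<rho>" for w using n1[OF z] n2[OF z] that z r by auto
      then show "continuous_on (sphere 0 \<rho>) (\<lambda>w. 2 * \<bar>Re (G w)\<bar> * (\<rho> * norm (z + c1 - (z + c2))) / (norm (w - (z + c1)) * norm (w - (z + c2))))"
         "continuous_on (sphere 0 \<rho>) (\<lambda>w. 8 * \<bar>Re (G w)\<bar> * (\<rho> * norm (c1 - c2)) / (norm (w - z))^2)"
        using cG by (auto intro!: continuous_intros)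
    qed (use \<rho> in auto)
    finally have 1: "\<bar>Re (G (z + c1)) - Re (G (z + c2))\<bar> \<le> M z" .
    have "\<bar>(\<Sum>b\<in>zeros_poles u \<rho>. real_of_int (zorder u b) * ln (norm (blaschke \<rho> b (z + c1))))
        - (\<Sum>b\<in>zeros_poles u \<rho>. real_of_int (zorder u b) * ln (norm (blaschke \<rho> b (z + c2))))\<bar>
      = \<bar>\<Sum>b\<in>zeros_poles u \<rho>. real_of_int (zorder u b) * (ln (norm (blaschke \<rho> b (z + c1))) - ln (norm (blaschke \<rho> b (z + c2))))\<bar>"
      by (simp add: sum_subtractf right_diff_distrib)
    also have "\<dots> \<le> (\<Sum>b\<in>zeros_poles u \<rho>. \<bar>real_of_int (zorder u b) * (ln (norm (blaschke \<rho> b (z + c1))) - ln (norm (blaschke \<rho> b (z + c2))))\<bar>)"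
      by (rule sum_abs)
    also have "\<dots> \<le> (\<Sum>b\<in>zeros_poles u \<rho>. (\<bar>real_of_int (zorder u b)\<bar> * K) * S b z)"
    proof (rule sum_mono)
      fix b assume b: "b \<in> zeros_poles u \<rho>"
      have "\<bar>ln (norm (blaschke \<rho> b (z + c1))) - ln (norm (blaschke \<rho> b (z + c2)))\<bar> \<le> K * S b z"
        unfolding K_def S_def
        using ln_norm_blaschke_diff_le[OF b\<rho>[OF b] n1[OF z] n2[OF z] ne(1,2)[OF b z], of \<alpha>] \<alpha> by simp
      then show "\<bar>real_of_int (zorder u b) * (ln (norm (blaschke \<rho> b (z + c1))) - ln (norm (blaschke \<rho> b (z + c2))))\<bar>
        \<le> (\<bar>real_of_int (zorder u b)\<bar> * K) * S b z"
        unfolding abs_mult mult.assoc by (rule mult_left_mono) simp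
    qed
    finally show ?thesis
      using 1 unfolding lnu[OF less_imp_le[OF n1[OF z]] g(1)[OF z]] lnu[OF less_imp_le[OF n2[OF z]] g(2)[OF z]]
      by linarith
  qed
  have cl: "continuous_on (sphere 0 r) (\<lambda>z. ln (norm (u (z + c))))"
    if "\<And>z. norm z = r \<Longrightarrow> unit_at u (z + c)" for c
    by (rule unit_on_circle_continuous_ln) (use that unit_at_shift in \<open>auto simp: unit_on_circle_def\<close>)
  have "circle_mean r (\<lambda>z. \<bar>ln (norm (u (z + c1))) - ln (norm (u (z + c2)))\<bar>)
     \<le> circle_mean r (\<lambda>z. M z + (\<Sum>b\<in>zeros_poles u \<rho>. (\<bar>real_of_int (zorder u b)\<bar> * K) * S b z))"
    by (intro circle_mean_mono continuous_on_rabs continuous_on_diff cl[OF g(1)] cl[OF g(2)]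
        continuous_on_add continuous_on_sum continuous_on_mult continuous_on_const cM cS)
       (use r pw in auto)
  also have "\<dots> = circle_mean r M + (\<Sum>b\<in>zeros_poles u \<rho>. (\<bar>real_of_int (zorder u b)\<bar> * K) * circle_mean r (S b))"
    using r cM cS finite_zeros_poles[OF u]
    by (subst circle_mean_add) (auto intro!: continuous_intros circle_mean_sum_cmult)
  also have "\<dots> \<le> 8 * norm (c1 - c2) / (\<rho> - r) * circle_mean \<rho> (\<lambda>z. \<bar>ln (norm (u z))\<bar>)
       + (\<Sum>b\<in>zeros_poles u \<rho>. (\<bar>real_of_int (zorder u b)\<bar> * K) * (4 * (circle_powr_const \<alpha> * r powr -\<alpha>)))"
    unfolding M_def using K
    by (intro add_mono kernel_mean_le cG ReG sum_mono mult_left_mono mS) auto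
  also have "(\<Sum>b\<in>zeros_poles u \<rho>. (\<bar>real_of_int (zorder u b)\<bar> * K) * (4 * (circle_powr_const \<alpha> * r powr -\<alpha>)))
     = zeros_poles_count u \<rho> * (K * (4 * circle_powr_const \<alpha> * r powr -\<alpha>))"
    by (simp add: zeros_poles_count_def sum_distrib_right sum_distrib_left mult_ac)
  finally show ?thesis unfolding K_def .
qed

text \<open>The power \<open>\<alpha>\<close> makes the sum over zeros and poles manageable:
  \<open>lnplus y \<le> y powr \<alpha> / \<alpha>\<close>, the power is subadditive, and each
  simple pole \<open>1 / norm (x - b)\<close> becomes an integrable kernel whose mean is of size
  \<open>r powr -\<alpha>\<close>.\<close>

lemma mean_lnplus_log_deriv_le:
  assumes c: "2 * norm c \<le> \<rho> - r" and g: "\<And>z. norm z = r \<Longrightarrow> unit_at u (z + c)"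
  shows "circle_mean r (\<lambda>z. lnplus (norm (deriv u (z + c) / u (z + c))))
    \<le> (1 + 8 / (\<rho> - r) * circle_mean \<rho> (\<lambda>z. \<bar>ln (norm (u z))\<bar>)
          + zeros_poles_count u \<rho> * (2 * circle_powr_const \<alpha> * r powr -\<alpha>)) / \<alpha>"
proof -
  have \<rho>: "\<rho> > 0" using r by simp
  obtain G where G: "continuous_on (cball 0 \<rho>) G" "G holomorphic_on ball 0 \<rho>"
    "\<And>z. norm z \<le> \<rho> \<Longrightarrow> unit_at u z \<Longrightarrow> u z = exp (G z) * (\<Prod>b\<in>zeros_poles u \<rho>. blaschke \<rho> b z powi zorder u b)"
    using blaschke_factorization[OF u g\<rho> \<rho>] by blast
  have cG: "continuous_on (sphere 0 \<rho>) G" using G(1) continuous_on_subset by fastforce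
  have b\<rho>: "norm b < \<rho>" if "b \<in> zeros_poles u \<rho>" for b using that by (simp add: zeros_poles_def)
  have ReG: "Re (G z) = ln (norm (u z))" if z: "norm z = \<rho>" for z
  proof -
    have "unit_at u z" using z g\<rho> by (simp add: unit_on_circle_def)
    with ln_norm_factorization[OF u this, of \<rho> G] G(3)[of z] z b\<rho> show ?thesis
      by (simp add: norm_blaschke)
  qed
  have n1: "norm (z + c) < \<rho>" if "norm z = r" for z
    using norm_add_less[OF that c r(2)] .
  define S where "S = (\<lambda>b z. norm (z + c - b) powr -\<alpha> + norm (z + c - reflect \<rho> b) powr -\<alpha>)"
  define M where "M = (\<lambda>z. circle_mean \<rho> (\<lambda>w. 8 * \<bar>Re (G w)\<bar> * (\<rho> * 1) / (norm (w - z))^2))"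
  have ne: "z + c \<noteq> b" "z + c \<noteq> reflect \<rho> b"
    if "b \<in> zeros_poles u \<rho>" "norm z = r" for b z
    using zeros_poles_notin_unit_at[OF g(1)[OF that(2)] that(1)] ne_reflect[OF b\<rho>[OF that(1)]] n1[OF that(2)] by auto
  have cS: "continuous_on (sphere 0 r) (S b)" if "b \<in> zeros_poles u \<rho>" for b
    unfolding S_def by (intro continuous_on_add circle_mean_shift_powr_le(2) \<alpha> r ne that)
  have mS: "circle_mean r (S b) \<le> 2 * circle_powr_const \<alpha> * r powr -\<alpha>" if b: "b \<in> zeros_poles u \<rho>" for b
  proof -
    note cont = circle_mean_shift_powr_le(2)[OF \<alpha> r(1) ne(1)[OF b]] circle_mean_shift_powr_le(2)[OF \<alpha> r(1) ne(2)[OF b]]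
    note mean = circle_mean_shift_powr_le(1)[OF \<alpha> r(1) ne(1)[OF b]] circle_mean_shift_powr_le(1)[OF \<alpha> r(1) ne(2)[OF b]]
    have "circle_mean r (S b) = circle_mean r (\<lambda>z. norm (z + c - b) powr -\<alpha>) + circle_mean r (\<lambda>z. norm (z + c - reflect \<rho> b) powr -\<alpha>)"
      unfolding S_def using r cont by (simp add: circle_mean_add)
    with mean show ?thesis by linarith
  qed
  have cM: "continuous_on (sphere 0 r) M"
    unfolding M_def by (rule circle_mean_kernel_swap(1)) (use r cG in \<open>auto intro!: continuous_intros\<close>)
  have gM: "norm (deriv G (z + c)) \<le> M z" if z: "norm z = r" for z
  proof -
    have "norm (deriv G (z + c)) \<le> circle_mean \<rho> (\<lambda>w. 2 * \<bar>Re (G w)\<bar> * \<rho> / (norm (w - (z + c)))^2)"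
      by (rule holomorphic_deriv_le_circle_mean[OF G(1,2) n1[OF z]])
    also have "\<dots> \<le> M z"
      unfolding M_def
    proof (rule circle_mean_mono)
      fix w :: complex assume w: "norm w = \<rho>"
      have a: "norm (w - z) \<le> 2 * norm (w - (z + c))"
        using norm_diff_shift_ge[OF w z] c by auto
      have "w \<noteq> z" using w z r by auto
      then have p: "norm (w - z) > 0" by simp
      have "(norm (w - z))^2 \<le> (2 * norm (w - (z + c)))^2"
        by (rule power_mono) (use a in auto)
      then have "1 / (norm (w - (z + c)))^2 \<le> 4 / (norm (w - z))^2"
        using p a by (subst frac_le_eq) (auto simp: divide_le_0_iff algebra_simps)
      then have "2 * \<bar>Re (G w)\<bar> * \<rho> * (1 / (norm (w - (z + c)))^2)
         \<le> 2 * \<bar>Re (G w)\<bar> * \<rho> * (4 / (norm (w - z))^2)"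
        using \<rho> by (intro mult_left_mono) auto
      then show "2 * \<bar>Re (G w)\<bar> * \<rho> / (norm (w - (z + c)))^2
         \<le> 8 * \<bar>Re (G w)\<bar> * (\<rho> * 1) / (norm (w - z))^2" by simp
    next
      have "w \<noteq> z + c" "w \<noteq> z" if "norm w = \<rho>" for w using n1[OF z] that z r by auto
      then show "continuous_on (sphere 0 \<rho>) (\<lambda>w. 2 * \<bar>Re (G w)\<bar> * \<rho> / (norm (w - (z + c)))^2)"
         "continuous_on (sphere 0 \<rho>) (\<lambda>w. 8 * \<bar>Re (G w)\<bar> * (\<rho> * 1) / (norm (w - z))^2)"
        using cG by (auto intro!: continuous_intros)
    qed (use \<rho> in auto)
    finally show ?thesis .
  qed
  have pw: "lnplus (norm (deriv u (z + c) / u (z + c)))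
      \<le> (1 + M z + (\<Sum>b\<in>zeros_poles u \<rho>. \<bar>real_of_int (zorder u b)\<bar> * S b z)) / \<alpha>" if z: "norm z = r" for z
  proof -
    define x where "x = z + c"
    have x: "unit_at u x" "norm x < \<rho>" using g[OF z] n1[OF z] by (auto simp: x_def)
    have xne: "x \<noteq> b" "x \<noteq> reflect \<rho> b" if "b \<in> zeros_poles u \<rho>" for b
      using ne[OF that z] by (auto simp: x_def)
    have Bnz: "blaschke \<rho> b x \<noteq> 0" if "b \<in> zeros_poles u \<rho>" for b
      using unit_at_blaschke[OF b\<rho>[OF that], of x] x xne[OF that] by (simp add: unit_at_def)
    \<comment> \<open>\<open>l b\<close> is the logarithmic derivative of the Blaschke factor at
      \<open>x\<close>; its second summand comes from the pole at
      \<open>reflect \<rho> b\<close>.\<close>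
    define l where "l = (\<lambda>b. 1 / (x - b) + cnj b / (of_real (\<rho>^2) - cnj b * x))"
    have dB: "((\<lambda>w. blaschke \<rho> b w powi n) has_field_derivative
        (blaschke \<rho> b x powi n) * (of_int n * l b)) (at x)" if b: "b \<in> zeros_poles u \<rho>" for b n
    proof -
      have d: "of_real (\<rho>^2) - cnj b * x \<noteq> 0" using blaschke_denom[OF b\<rho>[OF b], of x] x by simp
      have "(blaschke \<rho> b has_field_derivative blaschke \<rho> b x * l b) (at x)"
        unfolding blaschke_def[abs_def] l_def using d xne(1)[OF b]
        by (auto intro!: derivative_eq_intros simp: divide_simps) (simp add: algebra_simps)
      then have "((\<lambda>w. blaschke \<rho> b w powi n) has_field_derivative
          of_int n * blaschke \<rho> b x powi (n - 1) * (blaschke \<rho> b x * l b)) (at x)"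
        using Bnz[OF b] by (auto intro!: derivative_eq_intros)
      moreover have "blaschke \<rho> b x powi (n - 1) * blaschke \<rho> b x = blaschke \<rho> b x powi n"
        using Bnz[OF b] by (simp add: power_int_diff)
      ultimately show ?thesis by (simp add: mult_ac)
    qed
    have dP: "((\<lambda>w. \<Prod>b\<in>zeros_poles u \<rho>. blaschke \<rho> b w powi zorder u b) has_field_derivative
       (\<Prod>b\<in>zeros_poles u \<rho>. blaschke \<rho> b x powi zorder u b) * (\<Sum>b\<in>zeros_poles u \<rho>. of_int (zorder u b) * l b)) (at x)"
      using has_field_derivative_prod'[of "zeros_poles u \<rho>" "\<lambda>b w. blaschke \<rho> b w powi zorder u b" x
          "\<lambda>b. (blaschke \<rho> b x powi zorder u b) * (of_int (zorder u b) * l b)"] dB Bnz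
      by (auto simp: fun_eq_iff)
    have dG: "(G has_field_derivative deriv G x) (at x)"
      using holomorphic_derivI[OF G(2)] x by auto
    have "((\<lambda>w. exp (G w) * (\<Prod>b\<in>zeros_poles u \<rho>. blaschke \<rho> b w powi zorder u b)) has_field_derivative
       u x * (deriv G x + (\<Sum>b\<in>zeros_poles u \<rho>. of_int (zorder u b) * l b))) (at x)"
      unfolding G(3)[OF less_imp_le[OF x(2)] x(1)]
      by (rule derivative_eq_intros dG dP refl)+ (simp add: algebra_simps)
    \<comment> \<open>The factorization is available at units only; these fill a neighbourhood of
      \<open>x\<close>, as the comparison of derivatives requires.\<close>
    moreover have "eventually (\<lambda>w. u w = exp (G w) * (\<Prod>b\<in>zeros_poles u \<rho>. blaschke \<rho> b w powi zorder u b)) (nhds x)"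
    proof -
      have "eventually (unit_at u) (nhds x)" using nz_mero_eventually_unit_at[OF u, of x] x(1)
        unfolding eventually_at_filter by (auto elim: eventually_mono)
      moreover have "eventually (\<lambda>w. w \<in> ball 0 \<rho>) (nhds x)"
        by (rule eventually_nhds_in_open) (use x in auto)
      ultimately show ?thesis by eventually_elim (use G(3) in auto)
    qed
    ultimately have "deriv u x = u x * (deriv G x + (\<Sum>b\<in>zeros_poles u \<rho>. of_int (zorder u b) * l b))"
      using deriv_cong_ev[of u _ x x] DERIV_imp_deriv by fastforce
    then have "deriv u x / u x = deriv G x + (\<Sum>b\<in>zeros_poles u \<rho>. of_int (zorder u b) * l b)"
      using x(1) by (simp add: unit_at_def)
    then have "norm (deriv u x / u x) \<le> norm (deriv G x) + (\<Sum>b\<in>zeros_poles u \<rho>. norm (of_int (zorder u b) * l b))"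
      by (simp add: norm_triangle_le sum_norm_le norm_sum)
    also have "\<dots> \<le> norm (deriv G x) + (\<Sum>b\<in>zeros_poles u \<rho>. \<bar>real_of_int (zorder u b)\<bar> * (1 / norm (x - b) + 1 / norm (x - reflect \<rho> b)))"
    proof (intro add_left_mono sum_mono)
      fix b assume b: "b \<in> zeros_poles u \<rho>"
      have "norm (l b) \<le> 1 / norm (x - b) + norm (cnj b / (of_real (\<rho>^2) - cnj b * x))"
        unfolding l_def by (rule norm_triangle_le) (simp add: norm_divide)
      also have "norm (cnj b / (of_real (\<rho>^2) - cnj b * x)) \<le> 1 / norm (x - reflect \<rho> b)"
      proof (cases "b = 0")
        case False
        show ?thesis unfolding blaschke_denom_reflect[OF False] using False by (simp add: norm_divide norm_mult)
      qed simp
      finally show "norm (of_int (zorder u b) * l b)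
         \<le> \<bar>real_of_int (zorder u b)\<bar> * (1 / norm (x - b) + 1 / norm (x - reflect \<rho> b))"
        by (simp add: norm_mult mult_left_mono)
    qed
    finally have Y: "norm (deriv u x / u x) \<le> norm (deriv G x) + (\<Sum>b\<in>zeros_poles u \<rho>. \<bar>real_of_int (zorder u b)\<bar> * (1 / norm (x - b) + 1 / norm (x - reflect \<rho> b)))" .
    \<comment> \<open>Multiplicities are integers, so the fractional power does not increase them
      and the bound stays linear in the count.\<close>
    have int_powr: "\<bar>real_of_int k\<bar> powr \<alpha> \<le> \<bar>real_of_int k\<bar>" for k
    proof (cases "k = 0")
      case False
      then have "1 \<le> \<bar>real_of_int k\<bar>" by linarith
      then show ?thesis using powr_mono[of \<alpha> 1 "\<bar>real_of_int k\<bar>"] \<alpha> by simp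
    qed simp
    have "norm (deriv u x / u x) powr \<alpha>
      \<le> (norm (deriv G x) + (\<Sum>b\<in>zeros_poles u \<rho>. \<bar>real_of_int (zorder u b)\<bar> * (1 / norm (x - b) + 1 / norm (x - reflect \<rho> b)))) powr \<alpha>"
      by (rule powr_mono2) (use Y \<alpha> in auto)
    also have "\<dots> \<le> norm (deriv G x) powr \<alpha> + (\<Sum>b\<in>zeros_poles u \<rho>. \<bar>real_of_int (zorder u b)\<bar> * (1 / norm (x - b) + 1 / norm (x - reflect \<rho> b))) powr \<alpha>"
      by (rule powr_add_le) (use \<alpha> in \<open>auto intro!: sum_nonneg\<close>)
    also have "\<dots> \<le> (1 + M z) + (\<Sum>b\<in>zeros_poles u \<rho>. \<bar>real_of_int (zorder u b)\<bar> * S b z)"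
    proof (rule add_mono)
      \<comment> \<open>Passing to \<open>1 + norm (deriv G x)\<close> makes the base at least
        \<open>1\<close>, so that its power \<open>\<alpha>\<close> is at most the base itself; this
        is the \<open>1\<close> in the final bound.\<close>
      have "norm (deriv G x) powr \<alpha> \<le> (1 + norm (deriv G x)) powr \<alpha>" by (rule powr_mono2) (use \<alpha> in auto)
      also have "\<dots> \<le> (1 + norm (deriv G x)) powr 1" by (rule powr_mono) (use \<alpha> in auto)
      also have "\<dots> \<le> 1 + M z" using gM[OF z] by (simp add: x_def)
      finally show "norm (deriv G x) powr \<alpha> \<le> 1 + M z" .
      have "(\<Sum>b\<in>zeros_poles u \<rho>. \<bar>real_of_int (zorder u b)\<bar> * (1 / norm (x - b) + 1 / norm (x - reflect \<rho> b))) powr \<alpha>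
        \<le> (\<Sum>b\<in>zeros_poles u \<rho>. (\<bar>real_of_int (zorder u b)\<bar> * (1 / norm (x - b) + 1 / norm (x - reflect \<rho> b))) powr \<alpha>)"
        by (rule powr_sum_le) (use \<alpha> in auto)
      also have "\<dots> \<le> (\<Sum>b\<in>zeros_poles u \<rho>. \<bar>real_of_int (zorder u b)\<bar> * S b z)"
      proof (rule sum_mono)
        fix b
        have "(1 / norm (x - b) + 1 / norm (x - reflect \<rho> b)) powr \<alpha> \<le> (1 / norm (x - b)) powr \<alpha> + (1 / norm (x - reflect \<rho> b)) powr \<alpha>"
          by (rule powr_add_le) (use \<alpha> in auto)
        also have "\<dots> = S b z" by (simp add: S_def x_def powr_divide powr_minus_divide)
        finally show "(\<bar>real_of_int (zorder u b)\<bar> * (1 / norm (x - b) + 1 / norm (x - reflect \<rho> b))) powr \<alpha>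
           \<le> \<bar>real_of_int (zorder u b)\<bar> * S b z"
          by (subst powr_mult) (auto intro!: mult_mono int_powr)
      qed
      finally show "(\<Sum>b\<in>zeros_poles u \<rho>. \<bar>real_of_int (zorder u b)\<bar> * (1 / norm (x - b) + 1 / norm (x - reflect \<rho> b))) powr \<alpha>
        \<le> (\<Sum>b\<in>zeros_poles u \<rho>. \<bar>real_of_int (zorder u b)\<bar> * S b z)" .
    qed
    finally have "norm (deriv u x / u x) powr \<alpha> / \<alpha> \<le> ((1 + M z) + (\<Sum>b\<in>zeros_poles u \<rho>. \<bar>real_of_int (zorder u b)\<bar> * S b z)) / \<alpha>"
      using \<alpha> by (intro divide_right_mono) auto
    with lnplus_le_powr[OF \<alpha>(1), of "norm (deriv u x / u x)"] show ?thesis by (simp add: x_def)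
  qed
  have cl: "continuous_on (sphere 0 r) (\<lambda>z. lnplus (norm (deriv u (z + c) / u (z + c))))"
  proof -
    have "(\<lambda>z. deriv u (z + c) / u (z + c)) analytic_on {z}" if "norm z = r" for z
      using g[OF that] by (intro analytic_on_divide analytic_at_shift analytic_deriv) (auto simp: unit_at_def)
    then have "(\<lambda>z. deriv u (z + c) / u (z + c)) analytic_on sphere 0 r"
      by (subst analytic_on_analytic_at) auto
    then have "continuous_on (sphere 0 r) (\<lambda>z. deriv u (z + c) / u (z + c))"
      by (intro holomorphic_on_imp_continuous_on analytic_imp_holomorphic)
    then show ?thesis by (intro continuous_on_lnplus)
  qed
  have "circle_mean r (\<lambda>z. lnplus (norm (deriv u (z + c) / u (z + c))))
     \<le> circle_mean r (\<lambda>z. (1 / \<alpha>) * (1 + M z + (\<Sum>b\<in>zeros_poles u \<rho>. \<bar>real_of_int (zorder u b)\<bar> * S b z)))"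
    by (intro circle_mean_mono cl continuous_on_add continuous_on_sum continuous_on_mult continuous_on_const cM cS)
       (use r pw in auto)
  also have "\<dots> = (1 / \<alpha>) * (1 + circle_mean r M + (\<Sum>b\<in>zeros_poles u \<rho>. \<bar>real_of_int (zorder u b)\<bar> * circle_mean r (S b)))"
    unfolding circle_mean_cmult using r cM cS finite_zeros_poles[OF u]
    by (simp add: circle_mean_add circle_mean_sum_cmult continuous_on_add continuous_on_sum continuous_on_mult)
  also have "\<dots> \<le> (1 / \<alpha>) * (1 + 8 * 1 / (\<rho> - r) * circle_mean \<rho> (\<lambda>z. \<bar>ln (norm (u z))\<bar>)
       + (\<Sum>b\<in>zeros_poles u \<rho>. \<bar>real_of_int (zorder u b)\<bar> * (2 * circle_powr_const \<alpha> * r powr -\<alpha>)))"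
    unfolding M_def using \<alpha>
    by (intro add_mono kernel_mean_le cG ReG sum_mono mult_left_mono mS) auto
  finally show ?thesis by (simp add: zeros_poles_count_def sum_distrib_right)
qed

end

section \<open>Jensen's formula and the characteristic\<close>

text \<open>The integral of \<open>1 / t\<close> from \<open>norm b\<close> to \<open>r\<close>,
  that is, the share of one point in the integrated counting function; the origin gets
  \<open>ln r\<close> as in the usual normalization.\<close>

definition radial_weight :: "real \<Rightarrow> complex \<Rightarrow> real" where
  "radial_weight r b = (if b = 0 then ln r else ln (r / norm b))"

lemma radial_weight_nonneg: "1 \<le> r \<Longrightarrow> norm b < r \<Longrightarrow> 0 \<le> radial_weight r b"
  by (auto simp: radial_weight_def)

definition locally_finite :: "(complex \<Rightarrow> nat) \<Rightarrow> bool" where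
  "locally_finite D \<longleftrightarrow> (\<forall>r. finite {b \<in> ball 0 r. D b \<noteq> 0})"

text \<open>A finite sum in place of the integral of \<open>n(t) / t\<close>, taken over an
  arbitrary divisor so that sums of divisors and comparison divisors are covered;
  \<open>integrated_count_eq\<close> is the link to the integral.\<close>

definition counting :: "(complex \<Rightarrow> nat) \<Rightarrow> real \<Rightarrow> real" where
  "counting D r = (\<Sum>b\<in>{b \<in> ball 0 r. D b \<noteq> 0}. real (D b) * radial_weight r b)"

definition zero_div :: "(complex \<Rightarrow> complex) \<Rightarrow> complex \<Rightarrow> nat" where
  "zero_div u b = nat (zorder u b)"

definition pole_div :: "(complex \<Rightarrow> complex) \<Rightarrow> complex \<Rightarrow> nat" where
  "pole_div u b = nat (- zorder u b)"

lemma counting_superset: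
  assumes "finite A" "A \<subseteq> ball 0 r" "{b \<in> ball 0 r. D b \<noteq> 0} \<subseteq> A"
  shows "counting D r = (\<Sum>b\<in>A. real (D b) * radial_weight r b)"
  unfolding counting_def by (rule sum.mono_neutral_left) (use assms in auto)

lemma locally_finite_add: "locally_finite D \<Longrightarrow> locally_finite D' \<Longrightarrow> locally_finite (\<lambda>b. D b + D' b)"
  unfolding locally_finite_def
proof
  fix r assume "\<forall>r. finite {b \<in> ball 0 r. D b \<noteq> 0}" "\<forall>r. finite {b \<in> ball 0 r. D' b \<noteq> 0}"
  then have "finite ({b \<in> ball 0 r. D b \<noteq> 0} \<union> {b \<in> ball 0 r. D' b \<noteq> 0})" by blast
  then show "finite {b \<in> ball 0 r. D b + D' b \<noteq> 0}" by (rule finite_subset[rotated]) auto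
qed

lemma counting_add:
  assumes "locally_finite D" "locally_finite D'"
  shows "counting (\<lambda>b. D b + D' b) r = counting D r + counting D' r"
proof -
  let ?A = "{b \<in> ball 0 r. D b + D' b \<noteq> 0}"
  have "finite ?A" using locally_finite_add[OF assms] by (simp add: locally_finite_def)
  then show ?thesis
    using counting_superset[of ?A r D] counting_superset[of ?A r D'] counting_superset[of ?A r "\<lambda>b. D b + D' b"]
    by (force simp: sum.distrib distrib_right)
qed

lemma counting_nonneg: "1 \<le> r \<Longrightarrow> 0 \<le> counting D r"
  unfolding counting_def by (intro sum_nonneg mult_nonneg_nonneg radial_weight_nonneg) auto

lemma counting_mono:
  assumes "locally_finite D'" "\<And>b. D b \<le> D' b" "1 \<le> r"
  shows "counting D r \<le> counting D' r"
proof -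
  let ?A = "{b \<in> ball 0 r. D' b \<noteq> 0}"
  have A: "finite ?A" using assms by (simp add: locally_finite_def)
  have z: "D' b = 0 \<Longrightarrow> D b = 0" for b using assms(2)[of b] by simp
  have "counting D r = (\<Sum>b\<in>?A. real (D b) * radial_weight r b)"
    by (rule counting_superset[OF A]) (use z in force)+
  also have "\<dots> \<le> counting D' r" unfolding counting_def
    by (intro sum_mono mult_right_mono radial_weight_nonneg) (use assms in auto)
  finally show ?thesis .
qed

lemma locally_finite_zero_div: "nz_mero u \<Longrightarrow> locally_finite (zero_div u)"
  unfolding locally_finite_def
  by (intro allI finite_subset[OF _ finite_zeros_poles]) (auto simp: zeros_poles_def zero_div_def)

lemma locally_finite_pole_div: "nz_mero u \<Longrightarrow> locally_finite (pole_div u)"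
  unfolding locally_finite_def
  by (intro allI finite_subset[OF _ finite_zeros_poles]) (auto simp: zeros_poles_def pole_div_def)

lemma counting_zero_minus_pole:
  assumes "nz_mero u"
  shows "(\<Sum>b\<in>zeros_poles u r. real_of_int (zorder u b) * radial_weight r b) = counting (zero_div u) r - counting (pole_div u) r"
proof -
  have z: "counting (zero_div u) r = (\<Sum>b\<in>zeros_poles u r. real (zero_div u b) * radial_weight r b)"
    by (rule counting_superset) (use finite_zeros_poles[OF assms] in \<open>auto simp: zeros_poles_def zero_div_def\<close>)
  have p: "counting (pole_div u) r = (\<Sum>b\<in>zeros_poles u r. real (pole_div u b) * radial_weight r b)"
    by (rule counting_superset) (use finite_zeros_poles[OF assms] in \<open>auto simp: zeros_poles_def pole_div_def\<close>)
  have "real_of_int (zorder u b) = real (zero_div u b) - real (pole_div u b)" for b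
    by (auto simp: zero_div_def pole_div_def)
  then show ?thesis unfolding z p by (simp add: left_diff_distrib sum_subtractf)
qed

text \<open>\<open>C\<close> is the logarithm of the modulus of the leading Laurent coefficient at
  \<open>0\<close>, hence independent of \<open>r\<close>. The mean of
  \<open>ln (norm (u z))\<close> is \<open>Re (G 0)\<close> by the mean value property; as
  \<open>u\<close> may have a zero or pole at \<open>0\<close>, this value is identified by a limit
  through punctured neighbourhoods.\<close>

lemma Jensen:
  assumes u: "nz_mero u"
  obtains C where "\<And>r. 0 < r \<Longrightarrow> unit_on_circle u r \<Longrightarrow>
    circle_mean r (\<lambda>z. ln (norm (u z))) = C + counting (zero_div u) r - counting (pole_div u) r"
proof -
  have iso: "isolated_singularity_at u 0" and ne: "not_essential u 0"
    using nz_mero_meromorphic[OF u, of "{0}"] by (auto simp: meromorphic_at_iff)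
  define k where "k = zorder u 0"
  obtain g s where g0: "g 0 \<noteq> 0" and s: "s > 0" "g holomorphic_on cball 0 s"
      "\<And>w. w \<in> cball 0 s - {0} \<Longrightarrow> u w = g w * (w - 0) powi k \<and> g w \<noteq> 0"
    using zorder_exist[OF iso ne nz_mero_frequently[OF u]] unfolding k_def by metis
  have cg: "isCont g 0"
    using s(1,2) by (metis centre_in_ball ball_subset_cball continuous_on_interior holomorphic_on_imp_continuous_on interior_cball)
  have "circle_mean r (\<lambda>z. ln (norm (u z))) = ln (norm (g 0)) + counting (zero_div u) r - counting (pole_div u) r"
    if r: "0 < r" and gr: "unit_on_circle u r" for r
  proof -
    obtain G where G: "continuous_on (cball 0 r) G" "G holomorphic_on ball 0 r"
      "\<And>z. norm z \<le> r \<Longrightarrow> unit_at u z \<Longrightarrow> u z = exp (G z) * (\<Prod>b\<in>zeros_poles u r. blaschke r b z powi zorder u b)"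
      using blaschke_factorization[OF u gr r] by blast
    have cG: "continuous_on (sphere 0 r) G" using G(1) continuous_on_subset by fastforce
    have br: "norm b < r" if "b \<in> zeros_poles u r" for b using that by (simp add: zeros_poles_def)
    have lnu: "ln (norm (u z)) = Re (G z) + (\<Sum>b\<in>zeros_poles u r. real_of_int (zorder u b) * ln (norm (blaschke r b z)))"
      if "norm z \<le> r" "unit_at u z" for z
      by (rule ln_norm_factorization[OF u that(2,1)]) (rule G(3)[OF that])
    have "circle_mean r (\<lambda>z. ln (norm (u z))) = circle_mean r (\<lambda>z. Re (G z))"
      by (rule circle_mean_cong) (use lnu r gr br in \<open>auto simp: unit_on_circle_def norm_blaschke\<close>)
    also have "\<dots> = Re (G 0)"
      using circle_mean_Re[OF cG] circle_mean_holomorphic[OF G(1,2) r] r by simp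
    finally have 1: "circle_mean r (\<lambda>z. ln (norm (u z))) = Re (G 0)" .
    \<comment> \<open>\<open>F\<close> is \<open>ln (norm (g w))\<close> expressed through the
      factorization: the factor for \<open>b = 0\<close> contributes
      \<open>k * (ln (norm w) - ln r)\<close>, where \<open>k * ln (norm w)\<close> cancels against
      the singular part of \<open>u\<close> and \<open>- k * ln r\<close> remains.\<close>
    define F where "F = (\<lambda>w. Re (G w) + (\<Sum>b\<in>zeros_poles u r - {0}. real_of_int (zorder u b) * ln (norm (blaschke r b w))) - real_of_int k * ln r)"
    have ev: "eventually (\<lambda>w. ln (norm (g w)) = F w) (at 0)"
    proof -
      have "eventually (unit_at u) (at 0)" by (rule nz_mero_eventually_unit_at[OF u])
      moreover have "eventually (\<lambda>w. w \<in> ball 0 (min r s) - {0}) (at (0::complex))"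
        by (rule eventually_at_in_open) (use r s in auto)
      ultimately show ?thesis
      proof eventually_elim
        case (elim w)
        have w: "w \<noteq> 0" "norm w \<le> r" "w \<in> cball 0 s - {0}" using elim by auto
        have "ln (norm (u w)) = ln (norm (g w)) + real_of_int k * ln (norm w)"
          using s(3)[OF w(3)] w(1) by (simp add: norm_mult norm_power_int ln_mult powr_real_of_int'[symmetric] ln_powr)
        moreover have "(\<Sum>b\<in>zeros_poles u r. real_of_int (zorder u b) * ln (norm (blaschke r b w)))
           = (\<Sum>b\<in>zeros_poles u r - {0}. real_of_int (zorder u b) * ln (norm (blaschke r b w))) + real_of_int k * (ln (norm w) - ln r)"
        proof -
          have B0: "ln (norm (blaschke r 0 w)) = ln (norm w) - ln r"
            using w r by (simp add: blaschke_def norm_divide norm_mult ln_div ln_mult norm_power power2_eq_square)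
          show ?thesis
          proof (cases "0 \<in> zeros_poles u r")
            case True
            then show ?thesis using finite_zeros_poles[OF u, of r] by (subst sum.remove[of _ 0]) (auto simp: B0 k_def)
          next
            case False
            then have "k = 0" using r by (simp add: zeros_poles_def k_def)
            with False show ?thesis by simp
          qed
        qed
        ultimately show ?case unfolding F_def using lnu[OF w(2) elim(1)] by (simp add: algebra_simps)
      qed
    qed
    have "((\<lambda>w. ln (norm (g w))) \<longlongrightarrow> ln (norm (g 0))) (at 0)"
      using cg g0 by (intro tendsto_intros) (auto simp: isCont_def)
    then have t1: "(F \<longlongrightarrow> ln (norm (g 0))) (at 0)" by (rule Lim_transform_eventually[OF _ ev])
    have cB: "((\<lambda>w. blaschke r b w) \<longlongrightarrow> blaschke r b 0) (at 0)" if "b \<in> zeros_poles u r - {0}" for b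
    proof -
      have "blaschke r b analytic_on {0}" using unit_at_blaschke[OF br, of b 0] that r by (auto simp: unit_at_def)
      then show ?thesis using analytic_at_imp_isCont isCont_def by blast
    qed
    have cG0: "(G \<longlongrightarrow> G 0) (at 0)"
      using G(1) r by (metis continuous_on_interior interior_cball centre_in_ball isCont_def)
    have "(F \<longlongrightarrow> F 0) (at 0)"
      unfolding F_def
      using unit_at_blaschke[OF br, of _ 0] r cB cG0 by (intro tendsto_intros) (auto simp: unit_at_def)
    with t1 have "ln (norm (g 0)) = F 0" using tendsto_unique[of "at (0::complex)"] by simp
    also have "F 0 = Re (G 0) - (\<Sum>b\<in>zeros_poles u r. real_of_int (zorder u b) * radial_weight r b)"
    proof -
      have e: "ln (norm (blaschke r b 0)) = - radial_weight r b" if "b \<in> zeros_poles u r - {0}" for b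
        using that r by (simp add: blaschke_def radial_weight_def norm_divide norm_mult ln_div ln_mult norm_power power2_eq_square)
      have s1: "(\<Sum>b\<in>zeros_poles u r - {0}. real_of_int (zorder u b) * ln (norm (blaschke r b 0)))
        = - (\<Sum>b\<in>zeros_poles u r - {0}. real_of_int (zorder u b) * radial_weight r b)"
        by (simp add: e sum_negf)
      have "(\<Sum>b\<in>zeros_poles u r. real_of_int (zorder u b) * radial_weight r b)
         = (\<Sum>b\<in>zeros_poles u r - {0}. real_of_int (zorder u b) * radial_weight r b) + real_of_int k * ln r"
      proof (cases "0 \<in> zeros_poles u r")
        case True
        then show ?thesis using finite_zeros_poles[OF u, of r] by (subst sum.remove[of _ 0]) (auto simp: radial_weight_def k_def)
      next
        case False
        then have "k = 0" using r by (simp add: zeros_poles_def k_def)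
        with False show ?thesis by simp
      qed
      then show ?thesis unfolding F_def s1 by simp
    qed
    finally show ?thesis using 1 counting_zero_minus_pole[OF u, of r] by simp
  qed
  then show thesis by (rule that)
qed

section \<open>Proximity, characteristic and the first main theorem\<close>

lemma proximity_eq: "proximity u r = circle_mean r (\<lambda>z. lnplus (norm (u z)))"
  by (simp add: proximity_def circle_mean_def)

definition analytic_on_circle :: "(complex \<Rightarrow> complex) \<Rightarrow> real \<Rightarrow> bool" where
  "analytic_on_circle u r \<longleftrightarrow> (\<forall>z\<in>sphere 0 r. u analytic_on {z})"

lemma unit_on_circle_analytic_on_circle: "unit_on_circle u r \<Longrightarrow> analytic_on_circle u r"
  by (simp add: unit_on_circle_def analytic_on_circle_def unit_at_def)

lemma analytic_on_circle_continuous: "analytic_on_circle u r \<Longrightarrow> continuous_on (sphere 0 r) u"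
  unfolding analytic_on_circle_def
  by (intro holomorphic_on_imp_continuous_on analytic_imp_holomorphic, subst analytic_on_analytic_at) auto

lemma analytic_on_circle_lnplus: "analytic_on_circle u r \<Longrightarrow> continuous_on (sphere 0 r) (\<lambda>z. lnplus (norm (u z)))"
  by (intro continuous_on_lnplus analytic_on_circle_continuous)

lemma lnplus_mono: "0 \<le> x \<Longrightarrow> x \<le> y \<Longrightarrow> lnplus x \<le> lnplus y"
  by (auto simp: lnplus_def)

lemma lnplus_mult: "0 \<le> x \<Longrightarrow> 0 \<le> y \<Longrightarrow> lnplus (x * y) \<le> lnplus x + lnplus y"
proof -
  assume "0 \<le> x" "0 \<le> y"
  then have "max (x * y) 1 \<le> max x 1 * max y 1"
    using mult_mono[of x "max x 1" y "max y 1"] mult_mono[of 1 "max x 1" 1 "max y 1"] by auto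
  then have "ln (max (x * y) 1) \<le> ln (max x 1 * max y 1)" by (intro ln_mono) auto
  moreover have "max x 1 \<noteq> 0" "max y 1 \<noteq> 0" by auto
  ultimately show ?thesis by (simp add: lnplus_max ln_mult)
qed

lemma lnplus_add: "0 \<le> x \<Longrightarrow> 0 \<le> y \<Longrightarrow> lnplus (x + y) \<le> lnplus x + lnplus y + ln 2"
proof -
  assume xy: "0 \<le> x" "0 \<le> y"
  have "x + y \<le> 2 * (max x 1 * max y 1)"
  proof -
    have "max x 1 \<le> max x 1 * max y 1" "max y 1 \<le> max x 1 * max y 1"
      using mult_left_mono[of 1 "max y 1" "max x 1"] mult_right_mono[of 1 "max x 1" "max y 1"] by auto
    then show ?thesis by linarith
  qed
  moreover have "1 * 1 \<le> max x 1 * max y 1" by (rule mult_mono) auto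
  ultimately have "ln (max (x + y) 1) \<le> ln (2 * (max x 1 * max y 1))" by (intro ln_mono) auto
  moreover have "max x 1 \<noteq> 0" "max y 1 \<noteq> 0" by auto
  ultimately show ?thesis by (simp add: lnplus_max ln_mult)
qed

lemma lnplus_minus_inverse: "0 < x \<Longrightarrow> lnplus x - lnplus (inverse x) = ln x"
  by (auto simp: lnplus_def ln_inverse inverse_le_1_iff)

lemma lnplus_plus_inverse: "0 < x \<Longrightarrow> lnplus x + lnplus (inverse x) = \<bar>ln x\<bar>"
  by (auto simp: lnplus_def ln_inverse inverse_le_1_iff)

text \<open>The characteristic with its counting part as a finite sum. It agrees with
  \<open>nev_char\<close> on circles all of whose points are units
  (\<open>nev_char_eq\<close>).\<close>

definition T :: "(complex \<Rightarrow> complex) \<Rightarrow> real \<Rightarrow> real" where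
  "T u r = proximity u r + counting (pole_div u) r"

lemma proximity_nonneg: "analytic_on_circle u r \<Longrightarrow> 0 \<le> r \<Longrightarrow> 0 \<le> proximity u r"
  unfolding proximity_eq by (intro circle_mean_nonneg analytic_on_circle_lnplus lnplus_nonneg) auto

lemma proximity_le_T: "1 \<le> r \<Longrightarrow> proximity u r \<le> T u r"
  unfolding T_def using counting_nonneg[of r] by (smt (verit))

lemma counting_pole_le_T: "analytic_on_circle u r \<Longrightarrow> 1 \<le> r \<Longrightarrow> counting (pole_div u) r \<le> T u r"
  unfolding T_def using proximity_nonneg[of u r] by (smt (verit))

lemma T_const: "T (\<lambda>_. c) r = lnplus (norm c) + counting (pole_div (\<lambda>_. c)) r"
  by (simp add: T_def proximity_eq)

lemma T_const_nonzero: "c \<noteq> 0 \<Longrightarrow> T (\<lambda>_. c) r = lnplus (norm c)"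
  by (simp add: T_const counting_def pole_div_def)

lemma proximity_mult:
  assumes "analytic_on_circle u r" "analytic_on_circle v r" "0 \<le> r"
  shows "proximity (\<lambda>z. u z * v z) r \<le> proximity u r + proximity v r"
proof -
  have "analytic_on_circle (\<lambda>z. u z * v z) r" using assms by (auto simp: analytic_on_circle_def intro!: analytic_intros)
  then have "proximity (\<lambda>z. u z * v z) r \<le> circle_mean r (\<lambda>z. lnplus (norm (u z)) + lnplus (norm (v z)))"
    unfolding proximity_eq using assms
    by (intro circle_mean_mono analytic_on_circle_lnplus continuous_on_add) (auto simp: norm_mult lnplus_mult)
  also have "\<dots> = proximity u r + proximity v r"
    unfolding proximity_eq by (intro circle_mean_add analytic_on_circle_lnplus assms)
  finally show ?thesis .
qed

lemma proximity_add:
  assumes "analytic_on_circle u r" "analytic_on_circle v r" "0 \<le> r"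
  shows "proximity (\<lambda>z. u z + v z) r \<le> proximity u r + proximity v r + ln 2"
proof -
  have "analytic_on_circle (\<lambda>z. u z + v z) r" using assms by (auto simp: analytic_on_circle_def intro!: analytic_intros)
  then have "proximity (\<lambda>z. u z + v z) r \<le> circle_mean r (\<lambda>z. lnplus (norm (u z)) + lnplus (norm (v z)) + ln 2)"
    unfolding proximity_eq using assms
    by (intro circle_mean_mono analytic_on_circle_lnplus continuous_on_add continuous_on_const)
       (auto intro!: order_trans[OF lnplus_mono[OF _ norm_triangle_ineq] lnplus_add])
  also have "\<dots> = proximity u r + proximity v r + ln 2"
    unfolding proximity_eq using assms
    by (simp add: circle_mean_add analytic_on_circle_lnplus continuous_on_add)
  finally show ?thesis .
qed

lemma T_mult:
  assumes "nz_mero u" "nz_mero v" "analytic_on_circle u r" "analytic_on_circle v r" "1 \<le> r"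
  shows "T (\<lambda>z. u z * v z) r \<le> T u r + T v r"
proof -
  have "counting (pole_div (\<lambda>z. u z * v z)) r \<le> counting (\<lambda>b. pole_div u b + pole_div v b) r"
    by (intro counting_mono locally_finite_add locally_finite_pole_div assms)
       (auto simp: pole_div_def zorder_nz_mero_times[OF assms(1,2)])
  then show ?thesis
    using proximity_mult[of u r v] assms counting_add[OF locally_finite_pole_div locally_finite_pole_div, of u v r]
    by (simp add: T_def)
qed

lemma T_add:
  assumes "nz_mero u" "nz_mero v" "nz_mero (\<lambda>z. u z + v z)" "analytic_on_circle u r" "analytic_on_circle v r" "1 \<le> r"
  shows "T (\<lambda>z. u z + v z) r \<le> T u r + T v r + ln 2"
proof -
  have "zorder (\<lambda>z. u z + v z) b \<ge> min (zorder u b) (zorder v b)" for b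
    by (intro zorder_add_ge nz_mero_meromorphic nz_mero_frequently assms) (auto intro: assms nz_mero_frequently)
  then have "pole_div (\<lambda>z. u z + v z) b \<le> pole_div u b + pole_div v b" for b
    unfolding pole_div_def by (smt (verit) nat_le_iff nat_add_distrib of_nat_add nat_mono zero_le int_nat_eq of_nat_0_le_iff of_nat_le_iff)
  then have "counting (pole_div (\<lambda>z. u z + v z)) r \<le> counting (\<lambda>b. pole_div u b + pole_div v b) r"
    by (intro counting_mono locally_finite_add locally_finite_pole_div assms)
  then show ?thesis
    using proximity_add[of u r v] assms counting_add[OF locally_finite_pole_div locally_finite_pole_div, of u v r]
    by (simp add: T_def)
qed

lemma unit_on_circle_inverse: "unit_on_circle u r \<Longrightarrow> unit_on_circle (\<lambda>z. inverse (u z)) r"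
  by (auto simp: unit_on_circle_def intro: unit_at_inverse)

lemma pole_div_inverse: "nz_mero u \<Longrightarrow> pole_div (\<lambda>z. inverse (u z)) = zero_div u"
  by (auto simp: pole_div_def zero_div_def zorder_nz_mero_inverse)

text \<open>Jensen's formula with \<open>ln\<close> split into \<open>lnplus\<close> of
  \<open>u\<close> and of \<open>1/u\<close>; the zeros of \<open>u\<close> are the poles of
  \<open>1/u\<close>. Values other than \<open>0\<close> are reached by combining this with
  \<open>T_diff_const\<close>.\<close>

lemma first_main_theorem:
  assumes u: "nz_mero u"
  obtains C where "\<And>r. 0 < r \<Longrightarrow> unit_on_circle u r \<Longrightarrow> T (\<lambda>z. inverse (u z)) r = T u r + C"
proof -
  obtain C where C: "\<And>r. 0 < r \<Longrightarrow> unit_on_circle u r \<Longrightarrow>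
    circle_mean r (\<lambda>z. ln (norm (u z))) = C + counting (zero_div u) r - counting (pole_div u) r"
    using Jensen[OF u] by blast
  have "T (\<lambda>z. inverse (u z)) r = T u r + (-C)" if r: "0 < r" "unit_on_circle u r" for r
  proof -
    have "circle_mean r (\<lambda>z. lnplus (norm (u z)) - lnplus (norm (inverse (u z)))) = circle_mean r (\<lambda>z. ln (norm (u z)))"
      by (rule circle_mean_cong) (use r in \<open>auto simp: unit_on_circle_def unit_at_def norm_inverse lnplus_minus_inverse\<close>)
    moreover have "circle_mean r (\<lambda>z. lnplus (norm (u z)) - lnplus (norm (inverse (u z)))) = proximity u r - proximity (\<lambda>z. inverse (u z)) r"
      unfolding proximity_eq using r by (intro circle_mean_diff analytic_on_circle_lnplus unit_on_circle_analytic_on_circle unit_on_circle_inverse) auto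
    ultimately show ?thesis
      using C[OF r] by (simp add: T_def pole_div_inverse[OF u])
  qed
  then show thesis by (rule that)
qed

lemma mean_abs_ln_eq:
  assumes "unit_on_circle u r" "0 \<le> r"
  shows "circle_mean r (\<lambda>z. \<bar>ln (norm (u z))\<bar>) = proximity u r + proximity (\<lambda>z. inverse (u z)) r"
proof -
  have "circle_mean r (\<lambda>z. \<bar>ln (norm (u z))\<bar>) = circle_mean r (\<lambda>z. lnplus (norm (u z)) + lnplus (norm (inverse (u z))))"
    by (rule circle_mean_cong) (use assms in \<open>auto simp: unit_on_circle_def unit_at_def norm_inverse lnplus_plus_inverse\<close>)
  also have "\<dots> = proximity u r + proximity (\<lambda>z. inverse (u z)) r"
    unfolding proximity_eq using assms by (intro circle_mean_add analytic_on_circle_lnplus unit_on_circle_analytic_on_circle unit_on_circle_inverse) auto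
  finally show ?thesis .
qed

text \<open>A zero or pole inside radius \<open>r\<close> carries weight at least
  \<open>ln (R / r) \<ge> (R - r) / R\<close> at radius \<open>R\<close>.\<close>

lemma zeros_poles_count_le:
  assumes u: "nz_mero u" and r: "1 \<le> r" "r < R"
  shows "zeros_poles_count u r * ((R - r) / R) \<le> counting (zero_div u) R + counting (pole_div u) R"
proof -
  have z: "counting (zero_div u) R = (\<Sum>b\<in>zeros_poles u R. real (zero_div u b) * radial_weight R b)"
    by (rule counting_superset) (use finite_zeros_poles[OF u] in \<open>auto simp: zeros_poles_def zero_div_def\<close>)
  have p: "counting (pole_div u) R = (\<Sum>b\<in>zeros_poles u R. real (pole_div u b) * radial_weight R b)"
    by (rule counting_superset) (use finite_zeros_poles[OF u] in \<open>auto simp: zeros_poles_def pole_div_def\<close>)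
  have e: "\<bar>real_of_int (zorder u b)\<bar> = real (zero_div u b) + real (pole_div u b)" for b
    by (auto simp: zero_div_def pole_div_def)
  have "- ln (R / r) = ln (r / R)" using r by (simp add: ln_div)
  also have "\<dots> \<le> r / R - 1" using r by (intro ln_le_minus_one) auto
  finally have l: "(R - r) / R \<le> ln (R / r)" using r by (simp add: diff_divide_distrib)
  have "zeros_poles_count u r * ((R - r) / R) = (\<Sum>b\<in>zeros_poles u r. \<bar>real_of_int (zorder u b)\<bar> * ((R - r) / R))"
    unfolding zeros_poles_count_def by (rule sum_distrib_right)
  also have "\<dots> \<le> (\<Sum>b\<in>zeros_poles u r. \<bar>real_of_int (zorder u b)\<bar> * radial_weight R b)"
  proof (intro sum_mono mult_left_mono)
    fix b assume b: "b \<in> zeros_poles u r"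
    have "ln (R / r) \<le> radial_weight R b"
    proof (cases "b = 0")
      case True
      then show ?thesis using r by (simp add: radial_weight_def ln_div)
    next
      case False
      have "R / r \<le> R / norm b" using b False r by (intro divide_left_mono) (auto simp: zeros_poles_def)
      then show ?thesis using r False by (auto simp: radial_weight_def intro!: ln_mono)
    qed
    with l show "(R - r) / R \<le> radial_weight R b" by linarith
  qed auto
  also have "\<dots> \<le> (\<Sum>b\<in>zeros_poles u R. \<bar>real_of_int (zorder u b)\<bar> * radial_weight R b)"
    using r by (intro sum_mono2 finite_zeros_poles u) (auto simp: zeros_poles_def intro!: mult_nonneg_nonneg radial_weight_nonneg)
  also have "\<dots> = counting (zero_div u) R + counting (pole_div u) R"
    unfolding z p e by (simp add: distrib_right sum.distrib)
  finally show ?thesis .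
qed

text \<open>Both quantities involve \<open>u\<close> and \<open>1/u\<close>, whose characteristics
  differ by a constant; hence the factor \<open>2\<close>.\<close>

lemma characteristic_bounds:
  assumes u: "nz_mero u"
  obtains C where "C \<ge> 0"
    "\<And>r. 1 \<le> r \<Longrightarrow> unit_on_circle u r \<Longrightarrow> circle_mean r (\<lambda>z. \<bar>ln (norm (u z))\<bar>) \<le> 2 * T u r + C"
    "\<And>r R. 1 \<le> r \<Longrightarrow> r < R \<Longrightarrow> unit_on_circle u R \<Longrightarrow> zeros_poles_count u r \<le> (2 * T u R + C) * (R / (R - r))"
proof -
  obtain C where C: "\<And>r. 0 < r \<Longrightarrow> unit_on_circle u r \<Longrightarrow> T (\<lambda>z. inverse (u z)) r = T u r + C"
    using first_main_theorem[OF u] by blast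
  show thesis
  proof (rule that[of "\<bar>C\<bar>"])
    fix r :: real assume r: "1 \<le> r" "unit_on_circle u r"
    then show "circle_mean r (\<lambda>z. \<bar>ln (norm (u z))\<bar>) \<le> 2 * T u r + \<bar>C\<bar>"
      using proximity_le_T[of r u] proximity_le_T[of r "\<lambda>z. inverse (u z)"] C[of r]
      by (subst mean_abs_ln_eq) auto
  next
    fix r R :: real assume r: "1 \<le> r" "r < R" "unit_on_circle u R"
    have "zeros_poles_count u r * ((R - r) / R) \<le> counting (pole_div (\<lambda>z. inverse (u z))) R + counting (pole_div u) R"
      using zeros_poles_count_le[OF u r(1,2)] by (simp add: pole_div_inverse[OF u])
    also have "\<dots> \<le> 2 * T u R + \<bar>C\<bar>"
      using counting_pole_le_T[OF unit_on_circle_analytic_on_circle[OF r(3)]] counting_pole_le_T[OF unit_on_circle_analytic_on_circle[OF unit_on_circle_inverse[OF r(3)]]] C[of R] r by auto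
    finally show "zeros_poles_count u r \<le> (2 * T u R + \<bar>C\<bar>) * (R / (R - r))"
      using r by (simp add: field_simps)
  qed auto
qed

section \<open>Agreement with the given Nevanlinna characteristic\<close>

lemma pole_mult_eq: "nz_mero f \<Longrightarrow> pole_mult f = pole_div f"
proof
  fix z assume f: "nz_mero f"
  show "pole_mult f z = pole_div f z"
    using zorder_neg_imp_is_pole[OF nz_mero_meromorphic[OF f] nz_mero_eventually[OF f], of z]
    by (cases "zorder f z < 0") (auto simp: pole_mult_def pole_div_def)
qed

lemma is_pole_iff_zorder: "nz_mero f \<Longrightarrow> is_pole f z \<longleftrightarrow> zorder f z < 0"
  using zorder_neg_imp_is_pole[OF nz_mero_meromorphic nz_mero_eventually, of f z]
    isolated_pole_imp_neg_zorder[OF meromorphic_on_isolated_singularity[OF nz_mero_meromorphic], of f z] by blast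

lemma integrated_count_eq:
  assumes f: "nz_mero f" and r: "0 < r" "unit_on_circle f r"
  shows "integrated_count f r = counting (pole_div f) r"
proof -
  define P where "P = {b \<in> ball 0 r. pole_div f b \<noteq> 0}"
  have fin: "finite P" using locally_finite_pole_div[OF f] by (simp add: locally_finite_def P_def)
  have pos: "pole_div f b \<noteq> 0 \<longleftrightarrow> is_pole f b" for b
    by (auto simp: is_pole_iff_zorder[OF f] pole_div_def)
  \<comment> \<open>Without poles on the circle, the closed disc of \<open>pole_count\<close> and
    the open disc of \<open>counting\<close> contain the same poles at radius
    \<open>r\<close>.\<close>
  have onc: "norm b \<noteq> r" if "is_pole f b" for b
    using r(2) that is_pole_iff_zorder[OF f, of b] unit_at_zorder[of f b] by (auto simp: unit_on_circle_def)
  have count: "pole_count f t = (\<Sum>b\<in>P. if norm b \<le> t then real (pole_div f b) else 0)" if "t \<le> r" for t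
  proof -
    have "{z. norm z \<le> t \<and> is_pole f z} = {b \<in> P. norm b \<le> t}"
    proof -
      have "norm z < r" if "norm z \<le> t" "is_pole f z" for z
        using onc[OF that(2)] that(1) \<open>t \<le> r\<close> by linarith
      then show ?thesis unfolding P_def pos by auto
    qed
    then show ?thesis using fin
      by (simp add: pole_count_def pole_mult_eq[OF f] sum.inter_filter[symmetric])
  qed
  have c0: "pole_count f 0 = (\<Sum>b\<in>P. if b = 0 then real (pole_div f b) else 0)"
    using count[of 0] r by simp
  have eq: "(pole_count f t - pole_count f 0) / t
      = (\<Sum>b\<in>P - {0}. if t \<in> {norm b..r} then real (pole_div f b) * (1 / t) else 0)" if "t \<in> {0..r}" for t
  proof -
    have "(pole_count f t - pole_count f 0) / t
      = (\<Sum>b\<in>P. ((if norm b \<le> t then real (pole_div f b) else 0) - (if b = 0 then real (pole_div f b) else 0)) / t)"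
      unfolding count[OF atLeastAtMost_iff[THEN iffD1, OF that, THEN conjunct2]] c0
      by (simp add: sum_subtractf[symmetric] sum_divide_distrib)
    also have "\<dots> = (\<Sum>b\<in>P - {0}. if t \<in> {norm b..r} then real (pole_div f b) * (1 / t) else 0)"
      by (rule sum.mono_neutral_cong_right) (use fin that in auto)
    finally show ?thesis .
  qed
  have one: "((\<lambda>t. if t \<in> {norm b..r} then real (pole_div f b) * (1 / t) else 0) has_integral
      real (pole_div f b) * radial_weight r b) {0..r}" if b: "b \<in> P - {0}" for b
  proof -
    have b': "0 < norm b" "norm b < r" using b by (auto simp: P_def)
    have "((\<lambda>t. 1 / t) has_integral (ln r - ln (norm b))) {norm b..r}"
    proof (rule fundamental_theorem_of_calculus)
      fix x assume "x \<in> {norm b..r}"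
      then have "0 < x" using b'(1) by (meson atLeastAtMost_iff less_le_trans)
      then have "(ln has_real_derivative 1 / x) (at x within {norm b..r})"
        using b' by (auto intro!: derivative_eq_intros)
      then show "(ln has_vector_derivative 1 / x) (at x within {norm b..r})"
        by (simp add: has_real_derivative_iff_has_vector_derivative)
    qed (use b' in auto)
    from has_integral_mult_right[OF this, of "real (pole_div f b)"]
    have "((\<lambda>t. real (pole_div f b) * (1 / t)) has_integral real (pole_div f b) * radial_weight r b) {norm b..r}"
      using b b' by (simp add: radial_weight_def ln_div)
    then show ?thesis
      by (subst has_integral_restrict) (use b' in auto)
  qed
  have "((\<lambda>t. (pole_count f t - pole_count f 0) / t) has_integral (\<Sum>b\<in>P - {0}. real (pole_div f b) * radial_weight r b)) {0..r}"
    by (rule has_integral_eq[OF _ has_integral_sum[OF _ one]]) (use eq fin in auto)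
  then have "integrated_count f r = (\<Sum>b\<in>P - {0}. real (pole_div f b) * radial_weight r b)
      + (\<Sum>b\<in>P. if b = 0 then real (pole_div f b) else 0) * ln r"
    unfolding integrated_count_def by (simp add: integral_unique c0)
  also have "\<dots> = counting (pole_div f) r"
  proof (cases "0 \<in> P")
    case True
    then show ?thesis unfolding counting_def P_def[symmetric]
      using sum.remove[OF fin True, of "\<lambda>b. real (pole_div f b) * radial_weight r b"] fin
      by (simp add: radial_weight_def[of r 0])
  next
    case False
    then show ?thesis unfolding counting_def P_def[symmetric] using fin by simp
  qed
  finally show ?thesis .
qed

lemma nev_char_eq: "nz_mero f \<Longrightarrow> 0 < r \<Longrightarrow> unit_on_circle f r \<Longrightarrow> nev_char f r = T f r"
  by (simp add: nev_char_def T_def integrated_count_eq)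

section \<open>Radii of subexponential growth\<close>

text \<open>A quantity that doubles every four indices is of size \<open>2 ^ m\<close> at index
  \<open>N + 4 * m\<close>, and so outgrows \<open>exp\<close> of a power \<open>q < 1\<close> of
  the index.\<close>

lemma exponential_beats_subexponential:
  fixes q C D N :: real
  assumes "0 < q" "q < 1" "0 < D"
  shows "eventually (\<lambda>m::nat. max C (exp ((2 * (N + 4 * real m)) powr q)) < 2 ^ m * D) sequentially"
proof (rule eventually_conj[THEN eventually_mono])
  show "eventually (\<lambda>m::nat. C < 2 ^ m * D) sequentially"
    using assms by real_asymp
  show "eventually (\<lambda>m::nat. exp ((2 * (N + 4 * real m)) powr q) < 2 ^ m * D) sequentially"
    using assms by real_asymp
qed auto

text \<open>For radii of size \<open>k powr p\<close> the gap has size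
  \<open>k powr (p - 1)\<close>, and the last expression has size
  \<open>k powr (1 - p * \<alpha>)\<close>. The midpoint \<open>\<alpha>\<close> of
  \<open>1 / p\<close> and \<open>1\<close> satisfies both \<open>p * \<alpha> > 1\<close> and
  \<open>\<alpha> < 1\<close>; the latter keeps the kernels on circles integrable.\<close>

lemma growth_sequence_aux:
  fixes p s :: real
  assumes "1 < p" "0 < s" "p * s < 1"
  defines "\<alpha> \<equiv> (1 + 1 / p) / 2"
  shows "0 < \<alpha>" "\<alpha> < 1"
    and "filterlim (\<lambda>k::nat. real (k + 1) powr p - (real k powr p + 1)) at_top sequentially"
    and "(\<lambda>k::nat. (real (k + 2) powr p + 1) / (real (k + 2) powr p - (real (k + 1) powr p + 1)) * (real k powr p) powr -\<alpha>) \<longlonglongrightarrow> 0"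
proof -
  have pa: "p * \<alpha> > 1" using assms by (simp add: \<alpha>_def field_simps)
  show "0 < \<alpha>" "\<alpha> < 1" using assms by (auto simp: \<alpha>_def field_simps)
  show "filterlim (\<lambda>k::nat. real (k + 1) powr p - (real k powr p + 1)) at_top sequentially"
    using assms(1) by real_asymp
  have "(\<lambda>k::nat. (real (k + 2) powr p + 1) / (real (k + 2) powr p - (real (k + 1) powr p + 1)) * (real k powr (-p*\<alpha>))) \<longlonglongrightarrow> 0"
    using assms(1) pa by real_asymp
  then show "(\<lambda>k::nat. (real (k + 2) powr p + 1) / (real (k + 2) powr p - (real (k + 1) powr p + 1)) * (real k powr p) powr -\<alpha>) \<longlonglongrightarrow> 0"
    by (simp add: powr_powr)
qed

text \<open>\<open>x n 0\<close> is the \<open>n\<close>-th base radius, \<open>x n 1\<close>,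
  \<open>x n 2\<close>, ... are the radii that follow it, and \<open>\<tau> n\<close> is the growth
  against which smallness is measured. \<open>gap\<close> disposes of the first term in
  \<open>mean_ln_shift_ratio_le\<close> and \<open>ratio\<close> of the second, where counting zeros
  up to \<open>x n (i + 1)\<close> costs the quotient formed with
  \<open>x n (i + 2)\<close>.\<close>

locale nev_seq =
  fixes x :: "nat \<Rightarrow> nat \<Rightarrow> real" and \<tau> :: "nat \<Rightarrow> real" and \<alpha> :: real
  assumes \<alpha>: "0 < \<alpha>" "\<alpha> < 1"
    and x_ge_1: "\<And>n i. 1 \<le> x n i"
    and gap: "\<And>i. filterlim (\<lambda>n. x n (i + 1) - x n i) at_top sequentially"
    and ratio: "\<And>i. (\<lambda>n. x n (i + 2) / (x n (i + 2) - x n (i + 1)) * x n i powr -\<alpha>) \<longlonglongrightarrow> 0"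
    and \<tau>_top: "filterlim \<tau> at_top sequentially"

text \<open>The base index of the sequence is a record of \<open>t\<close>, so that \<open>t\<close> need not be known to be monotone. The radii
  grow like \<open>k\<^sup>p\<close> with \<open>1 < p < 1/s\<close>: then doubling within four steps cannot happen forever, while the gaps
  between consecutive radii still tend to infinity.\<close>

lemma growth_sequence:
  fixes t :: "real \<Rightarrow> real" and B :: "real set" and s R0 :: real
  assumes B: "countable B" and s: "0 < s" "s < 1"
    and growth: "\<And>r. r \<ge> R0 \<Longrightarrow> r \<notin> B \<Longrightarrow> t r \<le> exp (r powr s)"
    and unb: "\<And>M. \<exists>R. \<forall>r\<ge>R. r \<notin> B \<longrightarrow> M \<le> t r"
  obtains x \<alpha> where "nev_seq x (\<lambda>n. t (x n 0)) \<alpha>" "\<And>n i. x n i \<notin> B"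
    "\<And>n i. i \<le> 4 \<Longrightarrow> t (x n i) \<le> 2 * t (x n 0)"
proof -
  define p where "p = (1 + 1 / s) / 2"
  \<comment> \<open>Along radii of size \<open>k powr p\<close> the growth bound becomes
    \<open>exp ((2 * k) powr q)\<close>, with \<open>q\<close> strictly below
    \<open>1\<close>.\<close>
  define q where "q = p * s"
  define \<alpha> where "\<alpha> = (1 + 1 / p) / 2"
  have "q = (1 + s) / 2" using s by (simp add: p_def q_def field_simps)
  then have p: "1 < p" and q: "0 < q" "q < 1" using s by (auto simp: p_def field_simps)
  note aux = growth_sequence_aux[OF p s(1) q(2)[unfolded q_def], folded \<alpha>_def]
  have "\<exists>v. real k powr p < v \<and> v < real k powr p + 1 \<and> v \<notin> B" for k
  proof -
    have "uncountable ({real k powr p <..< real k powr p + 1} - B)"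
      by (rule uncountable_minus_countable[OF _ B]) (simp add: uncountable_open_interval)
    then have "{real k powr p <..< real k powr p + 1} - B \<noteq> {}" using countable_empty by metis
    then show ?thesis by auto
  qed
  then obtain y where y: "\<And>k. real k powr p < y k" "\<And>k. y k < real k powr p + 1" "\<And>k. y k \<notin> B"
    by metis
  have powp: "filterlim (\<lambda>k::nat. real k powr p) at_top sequentially" using p by real_asymp
  have ytop: "filterlim y at_top sequentially"
    by (rule filterlim_at_top_mono[OF powp]) (use y(1) less_imp_le in \<open>auto intro!: always_eventually\<close>)
  define Tk where "Tk = (\<lambda>k. t (y k))"
  define A where "A = (\<lambda>k. Max (Tk ` {..k}))"
  have A_ge: "Tk j \<le> A k" if "j \<le> k" for j k using that by (auto simp: A_def intro!: Max_ge)
  have A_in: "\<exists>j\<le>k. Tk j = A k" for k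
  proof -
    have "A k \<in> Tk ` {..k}" unfolding A_def by (rule Max_in) auto
    then show ?thesis by auto
  qed
  have A_mono: "A j \<le> A k" if "j \<le> k" for j k
    using A_in[of j] A_ge[of _ k] that by (metis le_trans)
  have large: "\<exists>K. \<forall>k\<ge>K. M \<le> Tk k" for M
  proof -
    obtain R where R: "\<And>r. r \<ge> R \<Longrightarrow> r \<notin> B \<Longrightarrow> M \<le> t r" using unb[of M] by blast
    have "eventually (\<lambda>k. y k \<ge> R) sequentially" using ytop by (auto simp: filterlim_at_top)
    then show ?thesis using R y(3) by (auto simp: eventually_sequentially Tk_def)
  qed
  obtain C where C: "\<And>k. Tk k \<le> max C (exp ((2 * real k) powr q))"
  proof -
    have "eventually (\<lambda>k. y k \<ge> R0 \<and> k \<ge> 1) sequentially"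
      using ytop by (auto simp: filterlim_at_top intro: eventually_conj eventually_ge_at_top)
    then obtain K where K: "\<And>k. k \<ge> K \<Longrightarrow> y k \<ge> R0 \<and> k \<ge> 1" by (auto simp: eventually_sequentially)
    have "Tk k \<le> max (A K) (exp ((2 * real k) powr q))" for k
    proof (cases "k \<le> K")
      case True then show ?thesis using A_ge by (auto simp: le_max_iff_disj)
    next
      case False
      then have k: "y k \<ge> R0" "real k \<ge> 1" using K[of k] by auto
      have "real k powr p \<ge> 1" using k(2) p by (simp add: ge_one_powr_ge_zero)
      moreover have "2 powr 1 \<le> (2::real) powr p" using p by (intro powr_mono) auto
      then have "2 * real k powr p \<le> 2 powr p * real k powr p" by (intro mult_right_mono) auto
      ultimately have "y k \<le> (2 * real k) powr p" using y(2)[of k] by (simp add: powr_mult)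
      moreover have "0 \<le> y k" using y(1)[of k] powr_ge_zero[of "real k" p] by linarith
      ultimately have "y k powr s \<le> ((2 * real k) powr p) powr s" using s by (intro powr_mono2) auto
      then have "y k powr s \<le> (2 * real k) powr q" by (simp add: powr_powr q_def)
      with growth[OF k(1) y(3)] show ?thesis by (auto simp: Tk_def le_max_iff_disj intro: order_trans)
    qed
    then show thesis by (rule that)
  qed
  have A_le: "A k \<le> max C (exp ((2 * real k) powr q))" for k
  proof -
    obtain j where j: "j \<le> k" "Tk j = A k" using A_in by blast
    have "(2 * real j) powr q \<le> (2 * real k) powr q" using j q by (intro powr_mono2) auto
    then have "exp ((2 * real j) powr q) \<le> exp ((2 * real k) powr q)" by simp
    then show ?thesis using C[of j] j(2) by linarith
  qed
  have subexponential: "\<exists>k\<ge>N. A (k + 4) \<le> 2 * A k" for N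
  proof (rule ccontr)
    assume "\<not> ?thesis"
    then have fast: "\<And>k. k \<ge> N \<Longrightarrow> A (k + 4) > 2 * A k" by force
    obtain K where K: "\<And>k. k \<ge> K \<Longrightarrow> 1 \<le> Tk k" using large by blast
    define N' where "N' = max N K"
    have AN: "A N' > 0" using K[of N'] A_ge[of N' N'] by (auto simp: N'_def)
    have it: "2 ^ m * A N' \<le> A (N' + 4 * m)" for m
    proof (induction m)
      case (Suc m)
      have "2 ^ Suc m * A N' \<le> 2 * A (N' + 4 * m)" using Suc by simp
      also have "\<dots> \<le> A (N' + 4 * m + 4)" using fast[of "N' + 4 * m"]
        by (simp add: N'_def trans_le_add1)
      finally show ?case by (simp add: add_ac)
    qed simp
    have "eventually (\<lambda>m::nat. max C (exp ((2 * (real N' + 4 * real m)) powr q)) < 2 ^ m * A N') sequentially"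
      by (rule exponential_beats_subexponential[OF q AN])
    then obtain m where "max C (exp ((2 * (real N' + 4 * real m)) powr q)) < 2 ^ m * A N'"
      by (auto simp: eventually_sequentially)
    moreover have "A (N' + 4 * m) \<le> max C (exp ((2 * (real N' + 4 * real m)) powr q))"
      using A_le[of "N' + 4 * m"] by simp
    ultimately show False using it[of m] by linarith
  qed
  have "\<exists>j. n < j \<and> real n \<le> Tk j \<and> (\<forall>i\<le>4. Tk (j + i) \<le> 2 * Tk j)" for n
  proof -
    \<comment> \<open>Asking for more than \<open>A n\<close> forces the record index
      \<open>j\<close> beyond \<open>n\<close>. As \<open>j \<le> k\<close> attains
      \<open>A k\<close>, all indices up to \<open>j + 4\<close> stay below
      \<open>A (k + 4) \<le> 2 * Tk j\<close>.\<close>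
    obtain K where K: "\<And>k. k \<ge> K \<Longrightarrow> max (A n + 1) (real n) \<le> Tk k" using large by blast
    obtain k where k: "k \<ge> K" "A (k + 4) \<le> 2 * A k" using subexponential by blast
    obtain j where j: "j \<le> k" "Tk j = A k" using A_in by blast
    have big: "max (A n + 1) (real n) \<le> Tk j" using K[OF k(1)] A_ge[of k k] j by simp
    have "n < j" using big A_ge[of j n] by (cases "j \<le> n") auto
    moreover have "Tk (j + i) \<le> 2 * Tk j" if "i \<le> 4" for i
      using A_ge[of "j + i" "k + 4"] that j k by simp
    ultimately show ?thesis using big by auto
  qed
  then have "\<exists>j. \<forall>n. n < j n \<and> real n \<le> Tk (j n) \<and> (\<forall>i\<le>4. Tk (j n + i) \<le> 2 * Tk (j n))"
    by (intro choice allI)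
  then obtain j where j: "\<And>n. n < j n" "\<And>n. real n \<le> Tk (j n)" "\<And>n i. i \<le> 4 \<Longrightarrow> Tk (j n + i) \<le> 2 * Tk (j n)"
    by blast
  have jt: "filterlim (\<lambda>n. j n + i) sequentially sequentially" for i
    by (rule filterlim_at_top_mono[OF filterlim_ident])
       (use j(1) in \<open>auto intro!: always_eventually simp: less_imp_le trans_le_add1\<close>)
  define x where "x = (\<lambda>n i. y (j n + i))"
  show thesis
  proof (rule that[of x \<alpha>], unfold_locales)
    show "0 < \<alpha>" "\<alpha> < 1" by (fact aux)+
    show "x n i \<notin> B" for n i by (simp add: x_def y)
    show "1 \<le> x n i" for n i
    proof -
      have "1 \<le> real (j n + i)" using j(1)[of n] by simp
      then have "1 \<le> real (j n + i) powr p" using p by (simp add: ge_one_powr_ge_zero)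
      then show ?thesis using y(1)[of "j n + i"] by (simp add: x_def)
    qed
    have gap: "filterlim (\<lambda>k. y (k + 1) - y k) at_top sequentially"
    proof (rule filterlim_at_top_mono[OF aux(3)], intro always_eventually allI)
      show "real (k + 1) powr p - (real k powr p + 1) \<le> y (k + 1) - y k" for k
        using y(1)[of "k + 1"] y(2)[of k] by linarith
    qed
    show "filterlim (\<lambda>n. x n (i + 1) - x n i) at_top sequentially" for i
      using filterlim_compose[OF gap jt[of i]] by (simp add: x_def)
    have ratio: "(\<lambda>k. y (k + 2) / (y (k + 2) - y (k + 1)) * y k powr -\<alpha>) \<longlonglongrightarrow> 0"
    proof (rule tendsto_sandwich[OF _ _ tendsto_const aux(4)])
      have "eventually (\<lambda>k::nat. real (k + 1) powr p - (real k powr p + 1) \<ge> 1) sequentially"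
        using aux(3) unfolding filterlim_at_top by blast
      then have "eventually (\<lambda>k::nat. real (k + 2) powr p - (real (k + 1) powr p + 1) \<ge> 1) sequentially"
        using eventually_sequentially_Suc[of "\<lambda>k. real (k + 1) powr p - (real k powr p + 1) \<ge> 1"] by simp
      moreover have "eventually (\<lambda>k::nat. k \<ge> 1) sequentially" by (rule eventually_ge_at_top)
      ultimately have "eventually (\<lambda>k. 0 \<le> y (k + 2) / (y (k + 2) - y (k + 1)) * y k powr -\<alpha> \<and>
          y (k + 2) / (y (k + 2) - y (k + 1)) * y k powr -\<alpha> \<le>
          (real (k + 2) powr p + 1) / (real (k + 2) powr p - (real (k + 1) powr p + 1)) * (real k powr p) powr -\<alpha>) sequentially"
      proof eventually_elim
        case (elim k)
        have d: "real (k + 2) powr p - (real (k + 1) powr p + 1) \<le> y (k + 2) - y (k + 1)"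
          using y(1)[of "k + 2"] y(2)[of "k + 1"] by linarith
        have y2: "0 \<le> y (k + 2)" using y(1)[of "k + 2"] powr_ge_zero[of "real (k + 2)" p] by linarith
        have k: "0 < real k powr p" using elim by simp
        have "y (k + 2) / (y (k + 2) - y (k + 1)) \<le> (real (k + 2) powr p + 1) / (real (k + 2) powr p - (real (k + 1) powr p + 1))"
          by (rule frac_le) (use y(2)[of "k + 2"] d elim y2 in auto)
        moreover have "y k powr -\<alpha> \<le> (real k powr p) powr -\<alpha>"
          by (rule powr_mono2') (use aux k y(1)[of k] in auto)
        ultimately show ?case
          using d elim y2 by (intro conjI mult_mono mult_nonneg_nonneg divide_nonneg_nonneg) auto
      qed
      then show "eventually (\<lambda>k. 0 \<le> y (k + 2) / (y (k + 2) - y (k + 1)) * y k powr -\<alpha>) sequentially"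
        "eventually (\<lambda>k. y (k + 2) / (y (k + 2) - y (k + 1)) * y k powr -\<alpha> \<le>
          (real (k + 2) powr p + 1) / (real (k + 2) powr p - (real (k + 1) powr p + 1)) * (real k powr p) powr -\<alpha>) sequentially"
        by (auto elim: eventually_mono)
    qed
    show "(\<lambda>n. x n (i + 2) / (x n (i + 2) - x n (i + 1)) * x n i powr -\<alpha>) \<longlonglongrightarrow> 0" for i
      using filterlim_compose[OF ratio jt[of i]] by (simp add: x_def)
    show "t (x n i) \<le> 2 * t (x n 0)" if "i \<le> 4" for n i
      using j(3)[OF that, of n] by (simp add: x_def Tk_def)
    show "filterlim (\<lambda>n. t (x n 0)) at_top sequentially"
      by (rule filterlim_at_top_mono[OF filterlim_real_sequentially])
         (use j(2) in \<open>auto simp: x_def Tk_def intro!: always_eventually\<close>)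
  qed
qed

section \<open>Calculus of small functions along the radii\<close>

context nev_seq
begin

text \<open>With only units on the circles of the sequence, the proximity functions in use are means
  of continuous functions and no radius has to be discarded later.\<close>

definition admissible :: "(complex \<Rightarrow> complex) \<Rightarrow> bool" where
  "admissible u \<longleftrightarrow> nz_mero u \<and> (\<forall>n i. unit_on_circle u (x n i))"

text \<open>\<open>M\<close> is the last index after the base radius at which the bound is known. An
  estimate for shifts or for logarithmic derivatives spends two indices: one for the outer circle,
  one for counting zeros and poles inside it. Starting from four suffices, since \<open>f\<close>
  passes through a shift quotient and then a logarithmic derivative.\<close>

definition controlled :: "nat \<Rightarrow> (complex \<Rightarrow> complex) \<Rightarrow> bool" where
  "controlled M u \<longleftrightarrow> admissible u \<and> (\<exists>C\<ge>0. eventually (\<lambda>n. \<forall>i\<le>M. T u (x n i) \<le> C * (1 + \<tau> n)) sequentially)"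

text \<open>A one-sided \<open>o(\<tau>)\<close>: every estimate below is an upper bound.\<close>

definition small :: "(nat \<Rightarrow> real) \<Rightarrow> bool" where
  "small h \<longleftrightarrow> (\<forall>\<epsilon>>0. eventually (\<lambda>n. h n \<le> \<epsilon> * \<tau> n) sequentially)"

definition smallT :: "(complex \<Rightarrow> complex) \<Rightarrow> bool" where
  "smallT u \<longleftrightarrow> admissible u \<and> small (\<lambda>n. T u (x n 0))"

lemma \<tau>_ge: "eventually (\<lambda>n. K \<le> \<tau> n) sequentially"
  using \<tau>_top by (auto simp: filterlim_at_top)

lemma small_const: "small (\<lambda>_. c)"
  unfolding small_def
proof safe
  fix \<epsilon> :: real assume "\<epsilon> > 0"
  then show "eventually (\<lambda>n. c \<le> \<epsilon> * \<tau> n) sequentially"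
    using \<tau>_ge[of "c / \<epsilon>"] by (auto elim!: eventually_mono simp: field_simps)
qed

lemma small_add: "small g \<Longrightarrow> small h \<Longrightarrow> small (\<lambda>n. g n + h n)"
  unfolding small_def
proof safe
  fix \<epsilon> :: real assume "\<epsilon> > 0" "\<forall>\<epsilon>>0. eventually (\<lambda>n. g n \<le> \<epsilon> * \<tau> n) sequentially"
    "\<forall>\<epsilon>>0. eventually (\<lambda>n. h n \<le> \<epsilon> * \<tau> n) sequentially"
  then have "eventually (\<lambda>n. g n \<le> (\<epsilon>/2) * \<tau> n) sequentially" "eventually (\<lambda>n. h n \<le> (\<epsilon>/2) * \<tau> n) sequentially"
    by (metis half_gt_zero)+
  then show "eventually (\<lambda>n. g n + h n \<le> \<epsilon> * \<tau> n) sequentially"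
    by eventually_elim simp
qed

lemma small_mono: "small h \<Longrightarrow> eventually (\<lambda>n. g n \<le> h n) sequentially \<Longrightarrow> small g"
  unfolding small_def
proof safe
  fix \<epsilon> :: real assume h: "\<forall>\<epsilon>>0. eventually (\<lambda>n. h n \<le> \<epsilon> * \<tau> n) sequentially" "\<epsilon> > 0"
    and g: "eventually (\<lambda>n. g n \<le> h n) sequentially"
  from h have "eventually (\<lambda>n. h n \<le> \<epsilon> * \<tau> n) sequentially" by blast
  with g show "eventually (\<lambda>n. g n \<le> \<epsilon> * \<tau> n) sequentially" by eventually_elim simp
qed

lemma small_tendsto:
  assumes "e \<longlonglongrightarrow> 0" shows "small (\<lambda>n. e n * (1 + \<tau> n))"
  unfolding small_def
proof safe
  fix \<epsilon> :: real assume "\<epsilon> > 0"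
  then have "eventually (\<lambda>n. e n < \<epsilon> / 2) sequentially" using order_tendstoD(2)[OF assms, of "\<epsilon>/2"] by simp
  then show "eventually (\<lambda>n. e n * (1 + \<tau> n) \<le> \<epsilon> * \<tau> n) sequentially"
    using \<tau>_ge[of 1]
  proof eventually_elim
    case (elim n)
    have "e n * (1 + \<tau> n) \<le> (\<epsilon> / 2) * (1 + \<tau> n)" using elim by (intro mult_right_mono) auto
    also have "\<dots> \<le> (\<epsilon> / 2) * (2 * \<tau> n)" using elim \<open>\<epsilon> > 0\<close> by (intro mult_left_mono) auto
    finally show ?case by simp
  qed
qed

lemma okD: "admissible u \<Longrightarrow> nz_mero u" "admissible u \<Longrightarrow> unit_on_circle u (x n i)" "admissible u \<Longrightarrow> analytic_on_circle u (x n i)"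
  by (auto simp: admissible_def intro: unit_on_circle_analytic_on_circle)

lemma x_pos: "0 < x n i" "0 \<le> x n i"
  using x_ge_1[of n i] by linarith+

lemma admissible_mult: "admissible u \<Longrightarrow> admissible v \<Longrightarrow> admissible (\<lambda>z. u z * v z)"
  by (auto simp: admissible_def unit_on_circle_def intro: nz_mero_times unit_at_times)

lemma admissible_inverse: "admissible u \<Longrightarrow> admissible (\<lambda>z. inverse (u z))"
  by (auto simp: admissible_def unit_on_circle_def intro: nz_mero_inverse unit_at_inverse)

lemma admissible_divide: "admissible u \<Longrightarrow> admissible v \<Longrightarrow> admissible (\<lambda>z. u z / v z)"
  using admissible_mult[OF _ admissible_inverse] by (simp add: divide_inverse)

lemma admissible_const: "c \<noteq> 0 \<Longrightarrow> admissible (\<lambda>_. c)"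
  by (auto simp: admissible_def unit_on_circle_def unit_at_def nz_mero_const)

lemma ctrlD: "controlled M u \<Longrightarrow> admissible u"
  by (simp add: controlled_def)

lemma smallTD: "smallT u \<Longrightarrow> admissible u"
  by (simp add: smallT_def)

lemma ctrlI:
  assumes "admissible u" "eventually (\<lambda>n. \<forall>i\<le>M. T u (x n i) \<le> C * (1 + \<tau> n)) sequentially"
  shows "controlled M u"
  unfolding controlled_def
proof (intro conjI exI[of _ "\<bar>C\<bar>"])
  show "eventually (\<lambda>n. \<forall>i\<le>M. T u (x n i) \<le> \<bar>C\<bar> * (1 + \<tau> n)) sequentially"
    using assms(2) \<tau>_ge[of 0]
  proof eventually_elim
    case (elim n)
    have "C * (1 + \<tau> n) \<le> \<bar>C\<bar> * (1 + \<tau> n)" using elim by (intro mult_right_mono) auto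
    with elim(1) show ?case by (meson order_trans)
  qed
qed (use assms in auto)

lemma controlled_weaken: "controlled M u \<Longrightarrow> M' \<le> M \<Longrightarrow> controlled M' u"
  by (auto simp: controlled_def elim!: eventually_mono)

lemma controlled_le_sum:
  assumes "controlled M u" "controlled M v" "admissible w" "\<And>n i. T w (x n i) \<le> T u (x n i) + T v (x n i) + K"
  shows "controlled M w"
proof -
  obtain C where "eventually (\<lambda>n. \<forall>i\<le>M. T u (x n i) \<le> C * (1 + \<tau> n)) sequentially"
    using assms(1) by (auto simp: controlled_def)
  moreover obtain D where "eventually (\<lambda>n. \<forall>i\<le>M. T v (x n i) \<le> D * (1 + \<tau> n)) sequentially"
    using assms(2) by (auto simp: controlled_def)
  ultimately have "eventually (\<lambda>n. \<forall>i\<le>M. T w (x n i) \<le> (C + D + \<bar>K\<bar>) * (1 + \<tau> n)) sequentially"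
    using \<tau>_ge[of 0]
  proof eventually_elim
    case (elim n)
    show ?case
    proof safe
      fix i assume "i \<le> M"
      moreover have "\<bar>K\<bar> * 1 \<le> \<bar>K\<bar> * (1 + \<tau> n)" using elim by (intro mult_left_mono) auto
      ultimately show "T w (x n i) \<le> (C + D + \<bar>K\<bar>) * (1 + \<tau> n)"
        using elim(1,2) assms(4)[of n i] unfolding distrib_right
        by (smt (verit, ccfv_SIG) mult.right_neutral)
    qed
  qed
  then show ?thesis using assms(3) ctrlI by blast
qed

lemma controlled_const: "c \<noteq> 0 \<Longrightarrow> controlled M (\<lambda>_. c)"
proof (rule ctrlI[of _ _ "lnplus (norm c)"])
  assume c: "c \<noteq> 0"
  show "eventually (\<lambda>n. \<forall>i\<le>M. T (\<lambda>_. c) (x n i) \<le> lnplus (norm c) * (1 + \<tau> n)) sequentially"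
    using \<tau>_ge[of 0]
  proof eventually_elim
    case (elim n)
    have "lnplus (norm c) * 1 \<le> lnplus (norm c) * (1 + \<tau> n)"
      using elim by (intro mult_left_mono lnplus_nonneg) auto
    then show ?case using c by (simp add: T_const_nonzero)
  qed
qed (rule admissible_const)

lemma controlled_mult: "controlled M u \<Longrightarrow> controlled M v \<Longrightarrow> controlled M (\<lambda>z. u z * v z)"
  by (rule controlled_le_sum[of M u v _ 0]) (auto intro!: admissible_mult T_mult simp: ctrlD okD x_ge_1)

lemma controlled_add: "controlled M u \<Longrightarrow> controlled M v \<Longrightarrow> admissible (\<lambda>z. u z + v z) \<Longrightarrow> controlled M (\<lambda>z. u z + v z)"
  by (rule controlled_le_sum[of M u v _ "ln 2"]) (auto intro!: T_add simp: ctrlD okD x_ge_1)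

lemma controlled_add_const: "controlled M u \<Longrightarrow> c \<noteq> 0 \<Longrightarrow> admissible (\<lambda>z. u z + c) \<Longrightarrow> controlled M (\<lambda>z. u z + c)"
  by (rule controlled_add[of M u "\<lambda>_. c"]) (auto intro: controlled_const)

lemma controlled_inverse: "controlled M u \<Longrightarrow> controlled M (\<lambda>z. inverse (u z))"
proof -
  assume u: "controlled M u"
  obtain C where C: "\<And>r. 0 < r \<Longrightarrow> unit_on_circle u r \<Longrightarrow> T (\<lambda>z. inverse (u z)) r = T u r + C"
    using first_main_theorem[OF okD(1)[OF ctrlD[OF u]]] by blast
  show ?thesis
    by (rule controlled_le_sum[OF u controlled_const[of 1], where K = C])
       (use C[OF x_pos(1) okD(2)[OF ctrlD[OF u]]] in
         \<open>auto intro!: admissible_inverse simp: ctrlD[OF u] T_const_nonzero lnplus_nonneg\<close>)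
qed

lemma controlled_divide: "controlled M u \<Longrightarrow> controlled M v \<Longrightarrow> controlled M (\<lambda>z. u z / v z)"
  using controlled_mult[OF _ controlled_inverse] by (simp add: divide_inverse)

lemma smallT_le_sum:
  assumes "smallT u" "smallT v" "admissible w" "\<And>n. T w (x n 0) \<le> T u (x n 0) + T v (x n 0) + K"
  shows "smallT w"
  unfolding smallT_def
proof
  have "small (\<lambda>n. T u (x n 0) + T v (x n 0) + K)"
    using assms(1,2) by (intro small_add small_const) (auto simp: smallT_def)
  then show "small (\<lambda>n. T w (x n 0))" by (rule small_mono) (use assms(4) in auto)
qed fact

lemma smallT_const: "c \<noteq> 0 \<Longrightarrow> smallT (\<lambda>_. c)"
  by (simp add: smallT_def admissible_const T_const_nonzero small_const)

lemma smallT_mult: "smallT u \<Longrightarrow> smallT v \<Longrightarrow> smallT (\<lambda>z. u z * v z)"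
  by (rule smallT_le_sum[of u v _ 0]) (auto intro!: admissible_mult T_mult simp: smallTD okD x_ge_1)

lemma smallT_add: "smallT u \<Longrightarrow> smallT v \<Longrightarrow> admissible (\<lambda>z. u z + v z) \<Longrightarrow> smallT (\<lambda>z. u z + v z)"
  by (rule smallT_le_sum[of u v _ "ln 2"]) (auto intro!: T_add simp: smallTD okD x_ge_1)

lemma smallT_add_const: "smallT u \<Longrightarrow> c \<noteq> 0 \<Longrightarrow> admissible (\<lambda>z. u z + c) \<Longrightarrow> smallT (\<lambda>z. u z + c)"
  by (rule smallT_add[of u "\<lambda>_. c"]) (auto intro: smallT_const)

lemma smallT_inverse: "smallT u \<Longrightarrow> smallT (\<lambda>z. inverse (u z))"
proof -
  assume u: "smallT u"
  obtain C where C: "\<And>r. 0 < r \<Longrightarrow> unit_on_circle u r \<Longrightarrow> T (\<lambda>z. inverse (u z)) r = T u r + C"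
    using first_main_theorem[OF okD(1)[OF smallTD[OF u]]] by blast
  show ?thesis
    by (rule smallT_le_sum[OF u smallT_const[of 1], where K = C])
       (use C[OF x_pos(1) okD(2)[OF smallTD[OF u]]] in
         \<open>auto intro!: admissible_inverse simp: smallTD[OF u] T_const_nonzero lnplus_nonneg\<close>)
qed

lemma smallT_divide: "smallT u \<Longrightarrow> smallT v \<Longrightarrow> smallT (\<lambda>z. u z / v z)"
  using smallT_mult[OF _ smallT_inverse] by (simp add: divide_inverse)

lemma small_counting_zero_div: "smallT u \<Longrightarrow> small (\<lambda>n. counting (zero_div u) (x n 0))"
proof -
  assume u: "smallT u"
  have "small (\<lambda>n. T (\<lambda>z. inverse (u z)) (x n 0))" using smallT_inverse[OF u] by (simp add: smallT_def)
  then show ?thesis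
    by (rule small_mono)
       (use counting_pole_le_T[OF okD(3)[OF admissible_inverse[OF smallTD[OF u]]] x_ge_1]
         in \<open>auto simp: pole_div_inverse[OF okD(1)[OF smallTD[OF u]]]\<close>)
qed

text \<open>\<open>x n (i + 1)\<close> serves as outer circle for estimates at \<open>x n i\<close>,
  and the characteristic at \<open>x n (i + 2)\<close> bounds the number of zeros and poles inside
  it.\<close>

lemma controlled_growth_bounds:
  assumes u: "controlled M u" and i: "i + 2 \<le> M"
  obtains K where "K \<ge> 0"
    "eventually (\<lambda>n. circle_mean (x n (i + 1)) (\<lambda>z. \<bar>ln (norm (u z))\<bar>) \<le> K * (1 + \<tau> n)
       \<and> zeros_poles_count u (x n (i + 1)) \<le> K * (1 + \<tau> n) * (x n (i + 2) / (x n (i + 2) - x n (i + 1)))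
       \<and> x n i + 1 < x n (i + 1)) sequentially"
proof -
  obtain C where C: "C \<ge> 0"
    "\<And>r. 1 \<le> r \<Longrightarrow> unit_on_circle u r \<Longrightarrow> circle_mean r (\<lambda>z. \<bar>ln (norm (u z))\<bar>) \<le> 2 * T u r + C"
    "\<And>r R. 1 \<le> r \<Longrightarrow> r < R \<Longrightarrow> unit_on_circle u R \<Longrightarrow> zeros_poles_count u r \<le> (2 * T u R + C) * (R / (R - r))"
    using characteristic_bounds[OF okD(1)[OF ctrlD[OF u]]] by blast
  obtain D where D: "D \<ge> 0" "eventually (\<lambda>n. \<forall>i\<le>M. T u (x n i) \<le> D * (1 + \<tau> n)) sequentially"
    using u by (auto simp: controlled_def)
  have "eventually (\<lambda>n. x n (i + 1) - x n i > 1) sequentially" "eventually (\<lambda>n. x n (i + 1 + 1) - x n (i + 1) > 1) sequentially"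
    using gap[of i] gap[of "i + 1"] by (auto simp: filterlim_at_top_dense)
  then show thesis
  proof (intro that[of "2 * D + C"])
    show "eventually (\<lambda>n. circle_mean (x n (i + 1)) (\<lambda>z. \<bar>ln (norm (u z))\<bar>) \<le> (2 * D + C) * (1 + \<tau> n)
       \<and> zeros_poles_count u (x n (i + 1)) \<le> (2 * D + C) * (1 + \<tau> n) * (x n (i + 2) / (x n (i + 2) - x n (i + 1)))
       \<and> x n i + 1 < x n (i + 1)) sequentially"
      if gaps: "eventually (\<lambda>n. x n (i + 1) - x n i > 1) sequentially" "eventually (\<lambda>n. x n (i + 1 + 1) - x n (i + 1) > 1) sequentially"
      using D(2) gaps \<tau>_ge[of 0]
    proof eventually_elim
      case (elim n)
      have "C * 1 \<le> C * (1 + \<tau> n)" using C(1) elim by (intro mult_left_mono) auto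
      then have t: "2 * T u (x n j) + C \<le> (2 * D + C) * (1 + \<tau> n)" if "j \<le> M" for j
      proof -
        have "T u (x n j) \<le> D * (1 + \<tau> n)" using elim(1) that by blast
        with \<open>C * 1 \<le> C * (1 + \<tau> n)\<close> show ?thesis unfolding distrib_right mult.assoc by linarith
      qed
      have "circle_mean (x n (i + 1)) (\<lambda>z. \<bar>ln (norm (u z))\<bar>) \<le> 2 * T u (x n (i + 1)) + C"
        by (rule C(2)) (auto simp: x_ge_1 okD(2)[OF ctrlD[OF u]])
      moreover have "zeros_poles_count u (x n (i + 1)) \<le> (2 * T u (x n (i + 2)) + C) * (x n (i + 2) / (x n (i + 2) - x n (i + 1)))"
        by (rule C(3)) (use elim(3) in \<open>auto simp: x_ge_1 okD(2)[OF ctrlD[OF u]] eval_nat_numeral\<close>)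
      moreover have "\<dots> \<le> (2 * D + C) * (1 + \<tau> n) * (x n (i + 2) / (x n (i + 2) - x n (i + 1)))"
        by (intro mult_right_mono t) (use i elim(3) x_pos(2)[of n "i + 2"] in \<open>auto simp: eval_nat_numeral\<close>)
      ultimately show ?case using t[of "i + 1"] i elim(2) by linarith
    qed
  qed (use C D in auto)
qed

text \<open>\<open>e\<close> collects the two losses of \<open>mean_ln_shift_ratio_le\<close>, the
  inverse gap and the ratio, which tend to \<open>0\<close> by the choice of the radii. The factor
  \<open>1 + \<tau> n\<close> dominates the characteristic at the neighbouring radii up to a
  constant.\<close>

lemma mean_ln_shift_ratio_small:
  assumes u: "controlled M u" and i: "i + 2 \<le> M" and c: "admissible (\<lambda>z. u (z + c1))" "admissible (\<lambda>z. u (z + c2))"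
  obtains e where "e \<longlonglongrightarrow> 0"
    "eventually (\<lambda>n. circle_mean (x n i) (\<lambda>z. \<bar>ln (norm (u (z + c1))) - ln (norm (u (z + c2)))\<bar>) \<le> e n * (1 + \<tau> n)) sequentially"
proof -
  obtain K where K: "K \<ge> 0"
    "eventually (\<lambda>n. circle_mean (x n (i + 1)) (\<lambda>z. \<bar>ln (norm (u z))\<bar>) \<le> K * (1 + \<tau> n)
       \<and> zeros_poles_count u (x n (i + 1)) \<le> K * (1 + \<tau> n) * (x n (i + 2) / (x n (i + 2) - x n (i + 1)))
       \<and> x n i + 1 < x n (i + 1)) sequentially"
    using controlled_growth_bounds[OF u i] by blast
  define L where "L = norm (c1 - c2) powr \<alpha> / \<alpha> * (4 * circle_powr_const \<alpha>)"
  have L: "L \<ge> 0" using \<alpha> circle_powr_const_nonneg[of \<alpha>] by (simp add: L_def)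
  define e where "e = (\<lambda>n. 8 * norm (c1 - c2) * K * inverse (x n (i + 1) - x n i)
     + K * L * (x n (i + 2) / (x n (i + 2) - x n (i + 1)) * x n i powr -\<alpha>))"
  have "e \<longlonglongrightarrow> 8 * norm (c1 - c2) * K * 0 + K * L * 0"
    unfolding e_def
    by (intro tendsto_add tendsto_mult_left ratio tendsto_inverse_0_at_top gap)
  then have "e \<longlonglongrightarrow> 0" by simp
  moreover have "eventually (\<lambda>n. x n (i + 1) - x n i \<ge> 2 * norm c1 + 2 * norm c2) sequentially"
    using gap[of i] by (auto simp: filterlim_at_top)
  with K(2) have "eventually (\<lambda>n. circle_mean (x n i) (\<lambda>z. \<bar>ln (norm (u (z + c1))) - ln (norm (u (z + c2)))\<bar>) \<le> e n * (1 + \<tau> n)) sequentially"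
  proof eventually_elim
    case (elim n)
    have gpc: "unit_at u (z + c)" if "admissible (\<lambda>z. u (z + c))" "norm z = x n i" for z c :: complex
    proof -
      have "unit_at (\<lambda>z. u (z + c)) z" using okD(2)[OF that(1), of n i] that(2) by (simp add: unit_on_circle_def)
      from unit_at_shift[of "\<lambda>z. u (z + c)" "z + c" "-c"] this show ?thesis by simp
    qed
    have "circle_mean (x n i) (\<lambda>z. \<bar>ln (norm (u (z + c1))) - ln (norm (u (z + c2)))\<bar>)
     \<le> 8 * norm (c1 - c2) / (x n (i + 1) - x n i) * circle_mean (x n (i + 1)) (\<lambda>z. \<bar>ln (norm (u z))\<bar>)
      + zeros_poles_count u (x n (i + 1)) * (norm (c1 - c2) powr \<alpha> / \<alpha> * (4 * circle_powr_const \<alpha> * x n i powr -\<alpha>))"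
    proof (rule mean_ln_shift_ratio_le)
      show "2 * norm c1 \<le> x n (i + 1) - x n i" "2 * norm c2 \<le> x n (i + 1) - x n i"
        using elim(2) norm_ge_zero[of c1] norm_ge_zero[of c2] by linarith+
    qed (use elim(1) u c \<alpha> x_pos gpc in \<open>auto simp: okD ctrlD\<close>)
    also have "\<dots> \<le> 8 * norm (c1 - c2) / (x n (i + 1) - x n i) * (K * (1 + \<tau> n))
       + (K * (1 + \<tau> n) * (x n (i + 2) / (x n (i + 2) - x n (i + 1)))) * (L * x n i powr -\<alpha>)"
    proof (intro add_mono mult_left_mono)
      show "zeros_poles_count u (x n (i + 1)) * (norm (c1 - c2) powr \<alpha> / \<alpha> * (4 * circle_powr_const \<alpha> * x n i powr -\<alpha>))
         \<le> K * (1 + \<tau> n) * (x n (i + 2) / (x n (i + 2) - x n (i + 1))) * (L * x n i powr -\<alpha>)"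
      proof -
        have "norm (c1 - c2) powr \<alpha> / \<alpha> * (4 * circle_powr_const \<alpha> * x n i powr -\<alpha>) = L * x n i powr -\<alpha>"
          by (simp add: L_def)
        then show ?thesis using conjunct1[OF conjunct2[OF elim(1)]] L
          by (simp only:) (intro mult_right_mono mult_nonneg_nonneg, auto)
      qed
    qed (use elim(1) in auto)
    also have "\<dots> = e n * (1 + \<tau> n)" by (simp add: e_def algebra_simps divide_inverse)
    finally show ?case .
  qed
  ultimately show thesis by (rule that)
qed

lemma proximity_ratio_le:
  assumes "admissible u" "admissible v"
  shows "proximity (\<lambda>z. u z / v z) (x n i) \<le> circle_mean (x n i) (\<lambda>z. \<bar>ln (norm (u z)) - ln (norm (v z))\<bar>)"
  unfolding proximity_eq
proof (rule circle_mean_mono)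
  show "continuous_on (sphere 0 (x n i)) (\<lambda>z. lnplus (norm (u z / v z)))"
    by (rule analytic_on_circle_lnplus) (use okD(3)[OF admissible_divide[OF assms]] in simp)
  show "continuous_on (sphere 0 (x n i)) (\<lambda>z. \<bar>ln (norm (u z)) - ln (norm (v z))\<bar>)"
    by (intro continuous_on_rabs continuous_on_diff unit_on_circle_continuous_ln okD assms)
  fix z :: complex assume "norm z = x n i"
  then have "u z \<noteq> 0" "v z \<noteq> 0" using okD(2)[OF assms(1), of n i] okD(2)[OF assms(2), of n i]
    by (auto simp: unit_on_circle_def unit_at_def)
  then show "lnplus (norm (u z / v z)) \<le> \<bar>ln (norm (u z)) - ln (norm (v z))\<bar>"
    by (simp add: lnplus_def norm_divide ln_div)
qed (rule x_pos)

text \<open>The first part is smallness at the base radius. The second keeps a cruder bound at later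
  radii, so that a shift quotient is itself controlled and can be fed into the estimate for
  logarithmic derivatives.\<close>

lemma proximity_shift_ratio:
  assumes u: "controlled M u" and c: "admissible (\<lambda>z. u (z + c1))" "admissible (\<lambda>z. u (z + c2))"
  shows "M \<ge> 2 \<Longrightarrow> small (\<lambda>n. proximity (\<lambda>z. u (z + c1) / u (z + c2)) (x n 0))"
    and "i + 2 \<le> M \<Longrightarrow> eventually (\<lambda>n. proximity (\<lambda>z. u (z + c1) / u (z + c2)) (x n i) \<le> 1 * (1 + \<tau> n)) sequentially"
proof -
  assume "M \<ge> 2"
  then obtain e where e: "e \<longlonglongrightarrow> 0"
    "eventually (\<lambda>n. circle_mean (x n 0) (\<lambda>z. \<bar>ln (norm (u (z + c1))) - ln (norm (u (z + c2)))\<bar>) \<le> e n * (1 + \<tau> n)) sequentially"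
    using mean_ln_shift_ratio_small[OF u _ c, of 0] by auto
  show "small (\<lambda>n. proximity (\<lambda>z. u (z + c1) / u (z + c2)) (x n 0))"
    by (rule small_mono[OF small_tendsto[OF e(1)]])
       (use e(2) in \<open>auto elim!: eventually_mono intro: order_trans[OF proximity_ratio_le[OF c]]\<close>)
next
  assume i: "i + 2 \<le> M"
  obtain e where e: "e \<longlonglongrightarrow> 0"
    "eventually (\<lambda>n. circle_mean (x n i) (\<lambda>z. \<bar>ln (norm (u (z + c1))) - ln (norm (u (z + c2)))\<bar>) \<le> e n * (1 + \<tau> n)) sequentially"
    using mean_ln_shift_ratio_small[OF u i c] by auto
  have "eventually (\<lambda>n. e n < 1) sequentially" using order_tendstoD(2)[OF e(1), of 1] by simp
  with e(2) show "eventually (\<lambda>n. proximity (\<lambda>z. u (z + c1) / u (z + c2)) (x n i) \<le> 1 * (1 + \<tau> n)) sequentially"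
    using \<tau>_ge[of 0]
  proof eventually_elim
    case (elim n)
    have "e n * (1 + \<tau> n) \<le> 1 * (1 + \<tau> n)" using elim by (intro mult_right_mono) auto
    with elim(1) proximity_ratio_le[OF c, of n i] show ?case by linarith
  qed
qed

lemma proximity_log_deriv_small:
  assumes u: "controlled 2 u"
  shows "small (\<lambda>n. proximity (\<lambda>z. deriv u z / u z) (x n 0))"
proof -
  obtain K where K: "K \<ge> 0"
    "eventually (\<lambda>n. circle_mean (x n (0 + 1)) (\<lambda>z. \<bar>ln (norm (u z))\<bar>) \<le> K * (1 + \<tau> n)
       \<and> zeros_poles_count u (x n (0 + 1)) \<le> K * (1 + \<tau> n) * (x n (0 + 2) / (x n (0 + 2) - x n (0 + 1)))
       \<and> x n 0 + 1 < x n (0 + 1)) sequentially"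
    using controlled_growth_bounds[OF u, of 0] by auto
  define L where "L = 2 * circle_powr_const \<alpha>"
  have L: "L \<ge> 0" using \<alpha> circle_powr_const_nonneg[of \<alpha>] by (simp add: L_def)
  define e where "e = (\<lambda>n. 8 * K / \<alpha> * inverse (x n (0 + 1) - x n 0)
     + K * L / \<alpha> * (x n (0 + 2) / (x n (0 + 2) - x n (0 + 1)) * x n 0 powr -\<alpha>))"
  have "e \<longlonglongrightarrow> 8 * K / \<alpha> * 0 + K * L / \<alpha> * 0"
    unfolding e_def
    by (intro tendsto_add tendsto_mult_left ratio tendsto_inverse_0_at_top gap)
  then have e: "e \<longlonglongrightarrow> 0" by simp
  \<comment> \<open>\<open>1 / \<alpha>\<close> stems from the additive \<open>1\<close> in
    \<open>mean_lnplus_log_deriv_le\<close>; a constant is small because \<open>\<tau>\<close> tends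
    to infinity.\<close>
  have "small (\<lambda>n. 1 / \<alpha> + e n * (1 + \<tau> n))" by (intro small_add small_const small_tendsto e)
  then show ?thesis
  proof (rule small_mono)
    show "eventually (\<lambda>n. proximity (\<lambda>z. deriv u z / u z) (x n 0) \<le> 1 / \<alpha> + e n * (1 + \<tau> n)) sequentially"
      using K(2)
    proof eventually_elim
      case (elim n)
      have "proximity (\<lambda>z. deriv u z / u z) (x n 0) \<le>
        (1 + 8 / (x n (0 + 1) - x n 0) * circle_mean (x n (0 + 1)) (\<lambda>z. \<bar>ln (norm (u z))\<bar>)
          + zeros_poles_count u (x n (0 + 1)) * (2 * circle_powr_const \<alpha> * x n 0 powr -\<alpha>)) / \<alpha>"
        unfolding proximity_eq
        using mean_lnplus_log_deriv_le[of u "x n (0 + 1)" "x n 0" \<alpha> 0] elim \<alpha> x_pos[of n 0]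
          okD(1)[OF ctrlD[OF u]] okD(2)[OF ctrlD[OF u], of n 1] okD(2)[OF ctrlD[OF u], of n 0]
        by (simp add: unit_on_circle_def)
      also have "\<dots> \<le> (1 + 8 / (x n (0 + 1) - x n 0) * (K * (1 + \<tau> n))
          + (K * (1 + \<tau> n) * (x n (0 + 2) / (x n (0 + 2) - x n (0 + 1)))) * (L * x n 0 powr -\<alpha>)) / \<alpha>"
        unfolding L_def[symmetric] using elim L \<alpha>
        by (intro divide_right_mono add_mono mult_left_mono mult_right_mono) auto
      also have "\<dots> = 1 / \<alpha> + e n * (1 + \<tau> n)"
        using \<alpha> by (simp add: e_def divide_inverse algebra_simps)
      finally show ?case .
    qed
  qed
qed

end

section \<open>Functions of hyper order less than one\<close>

text \<open>Equality as meromorphic functions: punctured neighbourhoods ignore the values that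
  quotients and derivatives take at their singularities.\<close>

definition mero_eq :: "(complex \<Rightarrow> complex) \<Rightarrow> (complex \<Rightarrow> complex) \<Rightarrow> bool" where
  "mero_eq u v \<longleftrightarrow> (\<forall>z. eventually (\<lambda>w. u w = v w) (at z))"

lemma mero_eq_sym: "mero_eq u v \<Longrightarrow> mero_eq v u"
  by (auto simp: mero_eq_def eq_commute)

text \<open>Identities between quotients are checked only at units of an auxiliary product
  \<open>v\<close> that contains the critical denominators; all other points are isolated.\<close>

lemma mero_eqI_nz_mero:
  assumes "nz_mero v" "\<And>w. unit_at v w \<Longrightarrow> f w = g w" shows "mero_eq f g"
  unfolding mero_eq_def
proof
  fix z show "eventually (\<lambda>w. f w = g w) (at z)"
    using nz_mero_eventually_unit_at[OF assms(1), of z] by eventually_elim (rule assms(2))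
qed

lemma nz_mero_mero_eq: "nz_mero u \<Longrightarrow> mero_eq u v \<Longrightarrow> nz_mero v"
proof -
  assume u: "nz_mero u" and e: "mero_eq u v"
  have "v meromorphic_on UNIV"
    using meromorphic_on_cong[of UNIV u v UNIV] e nz_mero_meromorphic[OF u, of UNIV] by (auto simp: mero_eq_def)
  moreover have "eventually (\<lambda>w. v w \<noteq> 0) (at z)" for z
    using nz_mero_eventually[OF u, of z] e[unfolded mero_eq_def, rule_format, of z] by eventually_elim simp
  ultimately show ?thesis by (simp add: nz_mero_def)
qed

lemma zorder_mero_eq: "mero_eq u v \<Longrightarrow> zorder u z = zorder v z"
  by (intro zorder_cong) (auto simp: mero_eq_def)

lemma analytic_eq_at:
  assumes "eventually (\<lambda>w. u w = v w) (at z)" "u analytic_on {z}" "v analytic_on {z}"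
  shows "u z = v z"
proof -
  have "(u \<longlongrightarrow> u z) (at z)" "(v \<longlongrightarrow> v z) (at z)"
    using assms(2,3) analytic_at_imp_isCont isCont_def by blast+
  moreover have "(u \<longlongrightarrow> v z) (at z)"
    using Lim_transform_eventually[OF \<open>(v \<longlongrightarrow> v z) (at z)\<close>] assms(1) by (simp add: eq_commute)
  ultimately show ?thesis using tendsto_unique[of "at z"] by simp
qed

lemma T_mero_eq:
  assumes "mero_eq u v" "analytic_on_circle u r" "analytic_on_circle v r" "0 \<le> r"
  shows "T u r = T v r"
proof -
  have "pole_div u = pole_div v" using zorder_mero_eq[OF assms(1)] by (auto simp: pole_div_def)
  moreover have "proximity u r = proximity v r"
    unfolding proximity_eq
    by (rule circle_mean_cong)
       (use assms analytic_eq_at[of u v] in \<open>auto simp: mero_eq_def analytic_on_circle_def\<close>)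
  ultimately show ?thesis by (simp add: T_def)
qed

definition nonconst :: "(complex \<Rightarrow> complex) \<Rightarrow> bool" where
  "nonconst u \<longleftrightarrow> (\<forall>k. \<not> mero_eq u (\<lambda>_. k))"

lemma nz_mero_diff_const:
  assumes "u meromorphic_on UNIV" "\<not> mero_eq u (\<lambda>_. k)"
  shows "nz_mero (\<lambda>z. u z - k)"
proof -
  have "(\<lambda>z. u z - k) meromorphic_on UNIV" by (intro meromorphic_intros assms)
  from nz_mero_dichotomy[OF this] assms(2) show ?thesis by (auto simp: mero_eq_def)
qed

lemma mero_eq_const_shift: "mero_eq u (\<lambda>_. k) \<Longrightarrow> mero_eq (\<lambda>z. u (z + c)) (\<lambda>_. k)"
  unfolding mero_eq_def
proof
  fix z assume "\<forall>z. eventually (\<lambda>w. u w = k) (at z)"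
  then have "eventually (\<lambda>w. u w = k) (at (z + c))" by blast
  moreover have "filterlim (\<lambda>w. w + c) (at (z + c)) (at z)"
    by (rule filterlim_atI) (auto intro!: tendsto_intros simp: eventually_at_filter)
  ultimately show "eventually (\<lambda>w. u (w + c) = k) (at z)"
    by (rule eventually_compose_filterlim)
qed

section \<open>Exceptional radii and the choice of the sequence\<close>

definition bad_radii :: "(complex \<Rightarrow> complex) \<Rightarrow> real set" where
  "bad_radii u = norm ` {z. \<not> unit_at u z}"

lemma countable_bad_radii: "nz_mero u \<Longrightarrow> countable (bad_radii u)"
proof -
  assume "nz_mero u"
  then have "{z. \<not> unit_at u z} sparse_in UNIV" by (rule nz_mero_sparse)
  then have "countable {z. \<not> unit_at u z}" using sparse_imp_countable[OF open_UNIV, of "{z. \<not> unit_at u z}"] by simp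
  then show ?thesis by (simp add: bad_radii_def)
qed

lemma unit_on_circle_notin_bad_radii: "r \<notin> bad_radii u \<Longrightarrow> unit_on_circle u r"
  by (auto simp: bad_radii_def unit_on_circle_def image_iff)

lemma zorder_diff_const_neg:
  assumes "nz_mero u" "zorder u z < 0" shows "zorder (\<lambda>w. u w - k) z = zorder u z"
proof (cases "k = 0")
  case False
  have "zorder (\<lambda>w. u w + - k) z = zorder u z"
    by (rule zorder_add1) (use assms False nz_mero_const[of "-k"] in \<open>auto intro: nz_mero_meromorphic nz_mero_frequently\<close>)
  then show ?thesis by simp
qed simp

lemma zorder_diff_const_nonneg:
  assumes "nz_mero u" "nz_mero (\<lambda>w. u w - k)" "0 \<le> zorder u z" shows "0 \<le> zorder (\<lambda>w. u w - k) z"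
proof (cases "k = 0")
  case False
  have "0 \<le> zorder (\<lambda>w. u w + - k) z"
    by (rule zorder_add_ge)
       (use assms False nz_mero_const[of "-k"] nz_mero_frequently[OF assms(2), of z] in \<open>auto intro: nz_mero_meromorphic nz_mero_frequently\<close>)
  then show ?thesis by simp
qed (use assms in simp)

lemma exists_unit_at: "nz_mero u \<Longrightarrow> \<exists>z. unit_at u z"
  using nz_mero_eventually_unit_at[of u 0] eventually_happens'[of "at (0::complex)"] by auto

lemma T_diff_const:
  assumes "nz_mero u" "nz_mero (\<lambda>z. u z - k)" "analytic_on_circle u r" "1 \<le> r"
  shows "T (\<lambda>z. u z - k) r \<le> T u r + (lnplus (norm k) + ln 2)"
proof (cases "k = 0")
  case False
  have "T (\<lambda>z. u z + - k) r \<le> T u r + T (\<lambda>_. - k) r + ln 2"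
    by (rule T_add) (use assms False in \<open>auto simp: analytic_on_circle_def nz_mero_const\<close>)
  then show ?thesis using False by (simp add: T_const_nonzero)
qed (simp add: lnplus_nonneg)

text \<open>A single zero of \<open>u - u z0\<close>, the one at \<open>z0\<close>, already
  contributes about \<open>ln r\<close> to the counting function, and the first main theorem
  transfers this to \<open>T u\<close>.\<close>

lemma T_unbounded:
  assumes u: "nz_mero u" "nonconst u"
  obtains B where "countable B" "\<And>M. \<exists>R. \<forall>r\<ge>R. r \<notin> B \<longrightarrow> M \<le> T u r"
proof -
  obtain z0 where z0: "unit_at u z0" using exists_unit_at[OF u(1)] by blast
  define a where "a = u z0"
  define v where "v = (\<lambda>z. u z - a)"
  have v: "nz_mero v" unfolding v_def
    using u nz_mero_diff_const nz_mero_meromorphic by (auto simp: nonconst_def)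
  have "v analytic_on {z0}" using z0 unfolding v_def unit_at_def by (intro analytic_intros) auto
  then have zo: "zorder v z0 > 0"
    using zorder_pos_iff'[of v z0] nz_mero_frequently[OF v] by (simp add: v_def a_def)
  obtain C where C: "\<And>r. 0 < r \<Longrightarrow> unit_on_circle v r \<Longrightarrow> T (\<lambda>z. inverse (v z)) r = T v r + C"
    using first_main_theorem[OF v] by blast
  define K where "K = lnplus (norm a) + ln 2 + C"
  \<comment> \<open>The denominator \<open>1 + norm z0\<close> also covers \<open>z0 = 0\<close>,
    where the radial weight is \<open>ln r\<close>.\<close>
  have lower: "ln (r / (1 + norm z0)) - K \<le> T u r" if r: "r \<ge> 1 + norm z0" "r \<notin> bad_radii u \<union> bad_radii v" for r
  proof -
    have g: "unit_on_circle u r" "unit_on_circle v r" using r unit_on_circle_notin_bad_radii by auto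
    have r1: "1 \<le> r" using r(1) norm_ge_zero[of z0] by linarith
    define D where "D = (\<lambda>b. if b = z0 then 1 else 0 :: nat)"
    have set: "{b \<in> ball 0 r. D b \<noteq> 0} = {z0}" using r(1) by (auto simp: D_def)
    have "radial_weight r z0 = counting D r" unfolding counting_def set by (simp add: D_def)
    also have "\<dots> \<le> counting (zero_div v) r"
      by (rule counting_mono[OF locally_finite_zero_div[OF v] _ r1]) (use zo in \<open>auto simp: D_def zero_div_def\<close>)
    also have "\<dots> \<le> T (\<lambda>z. inverse (v z)) r"
      using counting_pole_le_T[OF unit_on_circle_analytic_on_circle[OF unit_on_circle_inverse[OF g(2)]] r1] by (simp add: pole_div_inverse[OF v])
    also have "\<dots> = T v r + C" using C[of r] g r1 by simp
    also have "\<dots> \<le> T u r + K"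
      using T_diff_const[OF u(1) v[unfolded v_def] unit_on_circle_analytic_on_circle[OF g(1)] r1] by (simp add: v_def K_def)
    finally have 1: "radial_weight r z0 - K \<le> T u r" by simp
    have "r / (1 + norm z0) \<le> r / 1" by (rule divide_left_mono) (use r1 in \<open>auto simp: add_pos_nonneg\<close>)
    moreover have "r / (1 + norm z0) \<le> r / norm z0" if "z0 \<noteq> 0"
      by (rule divide_left_mono) (use r1 that in \<open>auto simp: add_pos_nonneg\<close>)
    moreover have "0 < r / (1 + norm z0)" using r1 by (auto simp: add_pos_nonneg)
    ultimately have "ln (r / (1 + norm z0)) \<le> radial_weight r z0"
      by (auto simp: radial_weight_def intro!: ln_mono)
    with 1 show ?thesis by linarith
  qed
  show thesis
  proof (rule that[of "bad_radii u \<union> bad_radii v"])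
    show "countable (bad_radii u \<union> bad_radii v)" using countable_bad_radii u v by auto
    fix M
    define R where "R = (1 + norm z0) * max 1 (exp (M + K))"
    have p: "0 < 1 + norm z0" by (simp add: add_pos_nonneg)
    show "\<exists>R. \<forall>r\<ge>R. r \<notin> bad_radii u \<union> bad_radii v \<longrightarrow> M \<le> T u r"
    proof (intro exI[of _ R] allI impI)
      fix r assume r: "r \<ge> R" "r \<notin> bad_radii u \<union> bad_radii v"
      have "max 1 (exp (M + K)) \<le> r / (1 + norm z0)" 
        unfolding pos_le_divide_eq[OF p] using r(1) by (simp only: R_def mult.commute)
      then have q: "1 \<le> r / (1 + norm z0)" "exp (M + K) \<le> r / (1 + norm z0)"
        by (simp_all only: max.bounded_iff)
      have "M + K \<le> ln (r / (1 + norm z0))" using q(2) by (subst ln_ge_iff) (use q(1) in linarith)+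
      moreover have "r \<ge> 1 + norm z0" using q(1) p by (simp add: field_simps)
      ultimately show "M \<le> T u r" using lower[of r] r(2) by linarith
    qed
  qed
qed

text \<open>The countable exceptional set \<open>B\<close> of radii absorbs circles through zeros or poles, on which
  proximity functions need not be integrals of continuous functions.\<close>

definition subexponential :: "(complex \<Rightarrow> complex) \<Rightarrow> bool" where
  "subexponential u \<longleftrightarrow> (\<exists>s R0 B. 0 < s \<and> s < 1 \<and> countable B \<and> (\<forall>r\<ge>R0. r \<notin> B \<longrightarrow> T u r \<le> exp (r powr s)))"

text \<open>The radii must avoid the singular circles of every function that occurs later, so these
  functions are announced in the countable set \<open>L\<close>. The premise
  \<open>nz_mero v\<close> allows functions to be announced before it is known whether they vanish
  identically.\<close>

lemma nev_seq_exists: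
  assumes u: "nz_mero u" "nonconst u" "subexponential u" and L: "countable L"
  obtains x \<tau> \<alpha> where "nev_seq x \<tau> \<alpha>" "\<tau> = (\<lambda>n. T u (x n 0))" "nev_seq.controlled x \<tau> 4 u"
    "\<And>v. v \<in> L \<Longrightarrow> nz_mero v \<Longrightarrow> nev_seq.admissible x v"
proof -
  obtain B1 where B1: "countable B1" "\<And>M. \<exists>R. \<forall>r\<ge>R. r \<notin> B1 \<longrightarrow> M \<le> T u r"
    using T_unbounded[OF u(1,2)] by blast
  obtain s R0 B2 where B2: "0 < s" "s < 1" "countable B2" "\<And>r. r \<ge> R0 \<Longrightarrow> r \<notin> B2 \<Longrightarrow> T u r \<le> exp (r powr s)"
    using u(3) by (auto simp: subexponential_def)
  define B where "B = B1 \<union> B2 \<union> bad_radii u \<union> (\<Union>v\<in>{v\<in>L. nz_mero v}. bad_radii v)"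
  have cB: "countable B" unfolding B_def using B1(1) B2(3) u(1) L
    by (auto intro!: countable_Un countable_UN countable_bad_radii countable_Collect)
  have g1: "T u r \<le> exp (r powr s)" if "R0 \<le> r" "r \<notin> B" for r using B2(4) that by (auto simp: B_def)
  have g2: "\<exists>R. \<forall>r\<ge>R. r \<notin> B \<longrightarrow> M \<le> T u r" for M using B1(2)[of M] by (auto simp: B_def)
  obtain x \<alpha> where x: "nev_seq x (\<lambda>n. T u (x n 0)) \<alpha>" "\<And>n i. x n i \<notin> B"
    "\<And>n i. i \<le> 4 \<Longrightarrow> T u (x n i) \<le> 2 * T u (x n 0)"
    using growth_sequence[OF cB B2(1,2) g1 g2] by blast
  interpret nev_seq x "\<lambda>n. T u (x n 0)" \<alpha> by (rule x(1))
  have admissible: "admissible v" if "nz_mero v" "bad_radii v \<subseteq> B" for v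
  proof -
    have "x n i \<notin> bad_radii v" for n i using that(2) x(2) by blast
    then show ?thesis using that(1) unit_on_circle_notin_bad_radii by (auto simp: admissible_def)
  qed
  show thesis
  proof (rule that[OF nev_seq_axioms refl])
    show "controlled 4 u"
    proof (rule ctrlI[of _ _ 2])
      show "admissible u" by (rule admissible) (use u in \<open>auto simp: B_def\<close>)
      show "eventually (\<lambda>n. \<forall>i\<le>4. T u (x n i) \<le> 2 * (1 + T u (x n 0))) sequentially"
        using x(3) by (intro always_eventually) (smt (verit))
    qed
    show "admissible v" if "v \<in> L" "nz_mero v" for v
      by (rule admissible) (use that in \<open>auto simp: B_def\<close>)
  qed
qed

section \<open>Small shift quotients and logarithmic derivatives\<close>

context nev_seq
begin

lemma smallT_diff_const: "smallT u \<Longrightarrow> admissible (\<lambda>z. u z - k) \<Longrightarrow> smallT (\<lambda>z. u z - k)"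
  using smallT_add_const[of u "-k"] by (cases "k = 0") auto

lemma controlled_diff_const: "controlled M u \<Longrightarrow> admissible (\<lambda>z. u z - k) \<Longrightarrow> controlled M (\<lambda>z. u z - k)"
  using controlled_add_const[of M u "-k"] by (cases "k = 0") auto

lemma smallT_diff: "smallT u \<Longrightarrow> smallT v \<Longrightarrow> admissible (\<lambda>z. u z - v z) \<Longrightarrow> smallT (\<lambda>z. u z - v z)"
  using smallT_add[of u "\<lambda>z. -1 * v z"] smallT_mult[OF smallT_const[of "-1"], of v] by simp

lemma T_mero_eq_admissible: "admissible u \<Longrightarrow> admissible v \<Longrightarrow> mero_eq u v \<Longrightarrow> T v (x n i) = T u (x n i)"
  using T_mero_eq[of u v] by (simp add: okD x_pos)

lemma controlled_mero_eq: "controlled M u \<Longrightarrow> admissible v \<Longrightarrow> mero_eq u v \<Longrightarrow> controlled M v"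
  unfolding controlled_def using T_mero_eq_admissible[of u v] by simp

lemma smallT_mero_eq: "smallT u \<Longrightarrow> admissible v \<Longrightarrow> mero_eq u v \<Longrightarrow> smallT v"
  unfolding smallT_def using T_mero_eq_admissible[of u v] by simp

lemma T_entire:
  assumes "\<And>z. 0 \<le> zorder u z" shows "T u r = proximity u r"
proof -
  have "pole_div u b = 0" for b using assms[of b] by (simp add: pole_div_def)
  then show ?thesis by (simp add: T_def counting_def)
qed

text \<open>Without poles the characteristic is the proximity function alone, so the shift estimate
  bounds all of \<open>T\<close>. Two of the four radii are spent on it.\<close>

lemma shift_ratio_entire:
  assumes u: "controlled 4 u" and c: "admissible (\<lambda>z. u (z + c1))" "admissible (\<lambda>z. u (z + c2))"
    and z: "\<And>z. 0 \<le> zorder (\<lambda>z. u (z + c1) / u (z + c2)) z"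
  shows "controlled 2 (\<lambda>z. u (z + c1) / u (z + c2))" "smallT (\<lambda>z. u (z + c1) / u (z + c2))"
proof -
  have admissible: "admissible (\<lambda>z. u (z + c1) / u (z + c2))" by (rule admissible_divide[OF c])
  show "smallT (\<lambda>z. u (z + c1) / u (z + c2))"
    unfolding smallT_def T_entire[of "\<lambda>z. u (z + c1) / u (z + c2)", OF z]
    using admissible proximity_shift_ratio(1)[OF u c] by simp
  have "eventually (\<lambda>n. \<forall>i\<in>{..2}. T (\<lambda>z. u (z + c1) / u (z + c2)) (x n i) \<le> 1 * (1 + \<tau> n)) sequentially"
    unfolding T_entire[of "\<lambda>z. u (z + c1) / u (z + c2)", OF z]
    by (intro eventually_ball_finite ballI proximity_shift_ratio(2)[OF u c]) auto
  then show "controlled 2 (\<lambda>z. u (z + c1) / u (z + c2))"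
    by (intro ctrlI[OF admissible, of _ 1]) (simp add: Ball_def)
qed

lemma not_small_\<tau>:
  assumes "small h" "eventually (\<lambda>n. 2 * \<tau> n \<le> h n + K) sequentially" shows False
proof -
  have "eventually (\<lambda>n. h n \<le> 1 * \<tau> n) sequentially"
    using assms(1) unfolding small_def by (rule allE[of _ 1]) simp
  with assms(2) \<tau>_ge[of "K + 1"] have "eventually (\<lambda>n. False) sequentially"
    by eventually_elim simp
  then show False by simp
qed

lemma not_smallT_\<tau>: "smallT u \<Longrightarrow> (\<And>n. \<tau> n = T u (x n 0)) \<Longrightarrow> False"
proof -
  assume "smallT u" and eq: "\<And>n. \<tau> n = T u (x n 0)"
  then have "small (\<lambda>n. T u (x n 0))" by (simp add: smallT_def)
  moreover have "(\<lambda>n. T u (x n 0)) = \<tau>" by (rule ext) (rule eq[symmetric])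
  ultimately have "small \<tau>" by (simp only:)
  then show False using not_small_\<tau>[OF small_add, of \<tau> \<tau> 0] by simp
qed

lemma smallT_const_mero_eq: "admissible u \<Longrightarrow> mero_eq u (\<lambda>_. k) \<Longrightarrow> smallT u"
proof -
  assume u: "admissible u" "mero_eq u (\<lambda>_. k)"
  have "k \<noteq> 0"
  proof
    assume "k = 0"
    then have "eventually (\<lambda>w. u w = 0) (at 0)" "eventually (\<lambda>w. u w \<noteq> 0) (at 0)"
      using u nz_mero_eventually[OF okD(1)[OF u(1)], of 0] by (auto simp: mero_eq_def)
    then have "eventually (\<lambda>w. False) (at (0::complex))" by eventually_elim simp
    then show False by simp
  qed
  then show ?thesis using smallT_mero_eq[OF smallT_const[of k] u(1) mero_eq_sym[OF u(2)]] by simp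
qed

text \<open>By the first main theorem a small function has few zeros, and so do finitely many
  together; multiplicities on the right only help.\<close>

lemma small_counting_dominated:
  assumes "finite S" "\<And>v. v \<in> S \<Longrightarrow> smallT v" "\<And>b. D b \<le> (\<Sum>v\<in>S. zero_div v b)"
  shows "small (\<lambda>n. counting D (x n 0))"
proof -
  have *: "locally_finite (\<lambda>b. \<Sum>v\<in>S. zero_div v b) \<and> small (\<lambda>n. counting (\<lambda>b. \<Sum>v\<in>S. zero_div v b) (x n 0))"
    using assms(1,2)
  proof (induction S rule: finite_induct)
    case empty
    then show ?case by (simp add: locally_finite_def counting_def small_const)
  next
    case (insert v S)
    have v: "locally_finite (zero_div v)" "small (\<lambda>n. counting (zero_div v) (x n 0))"
      using insert by (auto intro: locally_finite_zero_div okD smallTD small_counting_zero_div)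
    have S: "locally_finite (\<lambda>b. \<Sum>v\<in>S. zero_div v b)" "small (\<lambda>n. counting (\<lambda>b. \<Sum>v\<in>S. zero_div v b) (x n 0))"
      using insert by auto
    show ?case
      using insert(1,2) locally_finite_add[OF v(1) S(1)] small_add[OF v(2) S(2)] by (simp add: counting_add[OF v(1) S(1)])
  qed
  have "counting D (x n 0) \<le> counting (\<lambda>b. \<Sum>v\<in>S. zero_div v b) (x n 0)" for n
    by (rule counting_mono) (use * assms(3) x_ge_1 in auto)
  with * show ?thesis by (auto intro: small_mono always_eventually)
qed

text \<open>A logarithmic derivative has simple poles, located at the zeros and poles of
  \<open>u\<close>. Whatever the order of \<open>u\<close> there, one zero of a member of
  \<open>S\<close> pays for the pole, so it is enough to know where the zeros and poles of
  \<open>u\<close> lie.\<close>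

lemma smallT_log_deriv:
  assumes u: "controlled 2 u" "admissible (deriv u)" and S: "finite S" "\<And>v. v \<in> S \<Longrightarrow> smallT v"
    and z: "\<And>b. zorder u b \<noteq> 0 \<Longrightarrow> \<exists>v\<in>S. 0 < zorder v b"
  shows "smallT (\<lambda>z. deriv u z / u z)"
proof -
  have uok: "admissible u" by (rule ctrlD[OF u(1)])
  have admissible: "admissible (\<lambda>z. deriv u z / u z)" by (intro admissible_divide u uok)
  note mu = okD(1)[OF uok] and md = okD(1)[OF u(2)]
  have iso: "isolated_singularity_at u b" "not_essential u b" for b
    using nz_mero_meromorphic[OF mu, of "{b}"] by (auto simp: meromorphic_at_iff)
  have "pole_div (\<lambda>z. deriv u z / u z) b \<le> (\<Sum>v\<in>S. zero_div v b)" for b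
  proof (cases "zorder u b = 0")
    case True
    then have "\<not> is_pole u b" using is_pole_iff_zorder[OF mu, of b] by simp
    then have "\<not> is_pole (deriv u) b" using is_pole_deriv_iff[OF nz_mero_meromorphic[OF mu]] by simp
    then have "0 \<le> zorder (deriv u) b" using is_pole_iff_zorder[OF md, of b] by simp
    then show ?thesis using True by (simp add: pole_div_def zorder_nz_mero_divide[OF md mu])
  next
    case False
    then have "zorder (deriv u) b = zorder u b - 1"
      by (intro zorder_deriv_minus_1 iso nz_mero_frequently[OF mu])
    then have 1: "pole_div (\<lambda>z. deriv u z / u z) b = 1"
      by (simp add: pole_div_def zorder_nz_mero_divide[OF md mu])
    obtain v where v: "v \<in> S" "0 < zorder v b" using z[OF False] by blast
    have "1 \<le> zero_div v b" using v(2) by (simp add: zero_div_def)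
    also have "\<dots> \<le> (\<Sum>v\<in>S. zero_div v b)" using v(1) S(1) by (intro member_le_sum) auto
    finally show ?thesis using 1 by simp
  qed
  then have "small (\<lambda>n. counting (pole_div (\<lambda>z. deriv u z / u z)) (x n 0))"
    by (intro small_counting_dominated[where D = "pole_div (\<lambda>z. deriv u z / u z)", OF S])
  then show ?thesis
    unfolding smallT_def T_def using admissible proximity_log_deriv_small[OF u(1)] by (auto intro: small_add)
qed

end

text \<open>A derivative that vanishes near every point makes \<open>u\<close> constant on a disc
  around a unit; the identity theorem, through \<open>nz_mero_diff_const\<close>, spreads this over
  the plane.\<close>

lemma deriv_dichotomy:
  assumes "nz_mero u" shows "nz_mero (deriv u) \<or> (\<exists>k. mero_eq u (\<lambda>_. k))"
proof (rule disjCI)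
  assume nc: "\<not> (\<exists>k. mero_eq u (\<lambda>_. k))"
  have mer: "deriv u meromorphic_on UNIV" by (intro meromorphic_intros nz_mero_meromorphic assms)
  show "nz_mero (deriv u)"
  proof (rule ccontr)
    assume "\<not> nz_mero (deriv u)"
    then have z: "eventually (\<lambda>w. deriv u w = 0) (at z)" for z using nz_mero_dichotomy[OF mer] by blast
    obtain z0 where z0: "unit_at u z0" using exists_unit_at[OF assms] by blast
    have an: "u analytic_on {z0}" using z0 by (simp add: unit_at_def)
    obtain r1 where r1: "r1 > 0" "u holomorphic_on ball z0 r1"
      using an unfolding analytic_on_def by blast
    obtain r2 where r2: "r2 > 0" "\<And>w. w \<noteq> z0 \<Longrightarrow> dist w z0 < r2 \<Longrightarrow> deriv u w = 0"
      using z[of z0] unfolding eventually_at by blast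
    define r where "r = min r1 r2"
    have r: "r > 0" "u holomorphic_on ball z0 r"
      using r1 r2 holomorphic_on_subset[OF r1(2), of "ball z0 r"] by (auto simp: r_def subset_ball)
    have d0: "deriv u z0 = 0"
      using analytic_eq_at[of "deriv u" "\<lambda>_. 0" z0] z analytic_deriv[OF an] by simp
    have "(u has_field_derivative 0) (at w within ball z0 r)" if "w \<in> ball z0 r" for w
    proof -
      have "deriv u w = 0" using d0 r2(2)[of w] that by (cases "w = z0") (auto simp: r_def dist_commute)
      then show ?thesis using holomorphic_derivI[OF r(2) open_ball that] by (simp add: has_field_derivative_at_within)
    qed
    then obtain k where k: "\<And>w. w \<in> ball z0 r \<Longrightarrow> u w = k"
      using has_field_derivative_zero_constant[of "ball z0 r" u] by auto
    have "eventually (\<lambda>w. w \<in> ball z0 r - {z0}) (at z0)" by (rule eventually_at_in_open) (use r in auto)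
    then have ev: "eventually (\<lambda>w. u w - k = 0) (at z0)" by eventually_elim (use k in auto)
    have "nz_mero (\<lambda>w. u w - k)" using nz_mero_diff_const[OF nz_mero_meromorphic[OF assms]] nc by blast
    from nz_mero_eventually[OF this, of z0] ev have "eventually (\<lambda>w. False) (at z0)" by eventually_elim simp
    then show False by simp
  qed
qed

lemma zero_free_inverse_shift_const:
  assumes u: "nz_mero u" "subexponential u" "\<And>z. zorder u z = 0" and inv: "mero_eq (\<lambda>w. u w * u (w + c)) (\<lambda>_. 1)"
  shows "\<exists>k. mero_eq u (\<lambda>_. k)"
proof (rule ccontr)
  assume "\<not> ?thesis"
  then have nc: "nonconst u" by (simp add: nonconst_def)
  obtain x \<tau> \<alpha> where x: "nev_seq x \<tau> \<alpha>" "\<tau> = (\<lambda>n. T u (x n 0))" "nev_seq.controlled x \<tau> 4 u"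
    "\<And>v. v \<in> {\<lambda>z. u (z + c)} \<Longrightarrow> nz_mero v \<Longrightarrow> nev_seq.admissible x v"
    using nev_seq_exists[OF u(1) nc u(2), of "{\<lambda>z. u (z + c)}"] by auto
  interpret nev_seq x \<tau> \<alpha> by (rule x(1))
  have okc: "admissible (\<lambda>z. u (z + c))" by (rule x(4)) (auto intro: nz_mero_shift u)
  have oku: "admissible u" using ctrlD[OF x(3)] .
  have s: "small (\<lambda>n. proximity (\<lambda>z. u (z + c) / u (z + 0)) (x n 0))"
    by (rule proximity_shift_ratio(1)[OF x(3)]) (use okc oku in auto)
  obtain C where C: "\<And>r. 0 < r \<Longrightarrow> unit_on_circle u r \<Longrightarrow> T (\<lambda>z. inverse (u z)) r = T u r + C"
    using first_main_theorem[OF u(1)] by blast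
  \<comment> \<open>The quotient is \<open>1 / u^2\<close> on the circle, which doubles
    \<open>lnplus\<close>; as \<open>1/u\<close> has no poles, the mean is twice its full
    characteristic, hence \<open>2 * \<tau> n\<close> up to a constant.\<close>
  have "2 * \<tau> n \<le> proximity (\<lambda>z. u (z + c) / u (z + 0)) (x n 0) + (-2 * C)" for n
  proof -
    have "proximity (\<lambda>z. u (z + c) / u (z + 0)) (x n 0) = circle_mean (x n 0) (\<lambda>z. 2 * lnplus (norm (inverse (u z))))"
      unfolding proximity_eq
    proof (rule circle_mean_cong)
      fix z :: complex assume z: "norm z = x n 0"
      have g: "unit_at u z" "unit_at (\<lambda>z. u (z + c)) z"
        using okD(2)[OF oku, of n 0] okD(2)[OF okc, of n 0] z by (auto simp: unit_on_circle_def)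
      have "u z * u (z + c) = 1"
        by (rule analytic_eq_at[of "\<lambda>w. u w * u (w + c)" "\<lambda>_. 1" z])
           (use inv g in \<open>auto simp: mero_eq_def unit_at_def intro!: analytic_intros\<close>)
      then have "u (z + c) / u (z + 0) = inverse (u z) * inverse (u z)"
        using g(1) by (auto simp: unit_at_def field_simps)
      then have e: "norm (u (z + c) / u (z + 0)) = norm (inverse (u z)) * norm (inverse (u z))"
        by (simp only: norm_mult)
      have "lnplus (y * y) = 2 * lnplus y" if "y > 0" for y
        using that mult_le_one[of y y] mult_le_cancel_left1[of y y] less_1_mult[of y y]
        by (auto simp: lnplus_def ln_mult)
      from this[of "norm (inverse (u z))"] show "lnplus (norm (u (z + c) / u (z + 0))) = 2 * lnplus (norm (inverse (u z)))"
        unfolding e using g(1) by (simp add: unit_at_def)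
    qed (rule x_pos)
    also have "\<dots> = 2 * T (\<lambda>z. inverse (u z)) (x n 0)"
    proof -
      have "0 \<le> zorder (\<lambda>z. inverse (u z)) z" for z using zorder_nz_mero_inverse[OF u(1), of z] u(3)[of z] by simp
      then show ?thesis by (simp only: T_entire circle_mean_cmult proximity_eq)
    qed
    finally show ?thesis using C[OF x_pos(1) okD(2)[OF oku], of n 0] by (simp add: x(2))
  qed
  then show False using not_small_\<tau>[OF s, of "-2 * C"] by auto
qed

text \<open>Raising the exponent from \<open>s\<close> to \<open>(1 + s) / 2\<close> absorbs all
  constants and the dilation by \<open>5\<close>, which stems from the outer radius in
  \<open>subexponential_shift_ratio\<close>.\<close>

lemma subexponential_bound_mult:
  fixes s C K :: real
  assumes "0 < s" "s < 1" "0 \<le> K"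
  shows "eventually (\<lambda>r. (2 * exp ((5 * r) powr s) + C) * K \<le> exp (r powr ((1 + s) / 2))) at_top"
  using assms by real_asymp

lemma subexponential_le:
  assumes "subexponential u" "countable B" "0 \<le> K" "\<And>r. r \<ge> 1 \<Longrightarrow> r \<notin> B \<Longrightarrow> T v r \<le> (2 * T u r + C) * K"
  shows "subexponential v"
proof -
  obtain s R0 B2 where B2: "0 < s" "s < 1" "countable B2" "\<And>r. r \<ge> R0 \<Longrightarrow> r \<notin> B2 \<Longrightarrow> T u r \<le> exp (r powr s)"
    using assms(1) by (auto simp: subexponential_def)
  obtain R1 where R1: "\<And>r. r \<ge> R1 \<Longrightarrow> (2 * exp ((5 * r) powr s) + C) * K \<le> exp (r powr ((1 + s) / 2))"
    using subexponential_bound_mult[OF B2(1,2) assms(3), of C] by (auto simp: eventually_at_top_linorder)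
  show ?thesis unfolding subexponential_def
  proof (intro exI conjI allI impI)
    show "0 < (1 + s) / 2" "(1 + s) / 2 < 1" "countable (B \<union> B2)" using B2 assms(2) by auto
    fix r assume r: "r \<ge> max 1 (max R0 R1)" "r \<notin> B \<union> B2"
    have "T v r \<le> (2 * T u r + C) * K" using assms(4)[of r] r by auto
    also have "\<dots> \<le> (2 * exp ((5 * r) powr s) + C) * K"
    proof (intro mult_right_mono add_right_mono mult_left_mono)
      have "T u r \<le> exp (r powr s)" using B2(4)[of r] r by auto
      also have "\<dots> \<le> exp ((5 * r) powr s)" using r B2(1) by (auto intro!: powr_mono2)
      finally show "T u r \<le> exp ((5 * r) powr s)" .
    qed (use assms in auto)
    also have "\<dots> \<le> exp (r powr ((1 + s) / 2))" using R1[of r] r by auto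
    finally show "T v r \<le> exp (r powr ((1 + s) / 2))" .
  qed
qed

lemma exists_notin_countable:
  fixes a b :: real assumes "countable B" "a < b" obtains v where "a < v" "v < b" "v \<notin> B"
proof -
  have "uncountable ({a<..<b} - B)"
    by (rule uncountable_minus_countable[OF _ assms(1)]) (simp add: uncountable_open_interval assms)
  then have "{a<..<b} - B \<noteq> {}" using countable_empty by metis
  then obtain v where "v \<in> {a<..<b} - B" by blast
  then show thesis using that[of v] by auto
qed

text \<open>The degenerate case applies \<open>zero_free_inverse_shift_const\<close> to the
  quotient, along radii adapted to the quotient itself, so its growth must be bounded off a
  countable set of radii and not just along the sequence of \<open>f\<close>. As only growth is at
  stake, comparable radii and the fixed exponent \<open>1/2\<close> are good enough.\<close>

lemma subexponential_shift_ratio: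
  assumes f: "nz_mero f" "subexponential f" and z: "\<And>z. 0 \<le> zorder (\<lambda>z. f (z + c) / f z) z"
  shows "subexponential (\<lambda>z. f (z + c) / f z)"
proof -
  obtain s R0 B2 where B2: "0 < s" "s < 1" "countable B2" "\<And>r. r \<ge> R0 \<Longrightarrow> r \<notin> B2 \<Longrightarrow> T f r \<le> exp (r powr s)"
    using f(2) by (auto simp: subexponential_def)
  obtain C where C: "C \<ge> 0"
    "\<And>r. 1 \<le> r \<Longrightarrow> unit_on_circle f r \<Longrightarrow> circle_mean r (\<lambda>z. \<bar>ln (norm (f z))\<bar>) \<le> 2 * T f r + C"
    "\<And>r R. 1 \<le> r \<Longrightarrow> r < R \<Longrightarrow> unit_on_circle f R \<Longrightarrow> zeros_poles_count f r \<le> (2 * T f R + C) * (R / (R - r))"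
    using characteristic_bounds[OF f(1)] by blast
  define L where "L = norm c powr (1/2) / (1/2) * (4 * circle_powr_const (1/2))"
  have L: "L \<ge> 0" using circle_powr_const_nonneg[of "1/2"] by (simp add: L_def)
  define K where "K = 8 * norm c + 5 * L"
  have K: "K \<ge> 0" using L by (simp add: K_def)
  obtain R1 where R1: "\<And>r. r \<ge> R1 \<Longrightarrow> (2 * exp ((5 * r) powr s) + C) * K \<le> exp (r powr ((1 + s) / 2))"
    using subexponential_bound_mult[OF B2(1,2) K, of C] by (auto simp: eventually_at_top_linorder)
  define B where "B = B2 \<union> bad_radii f \<union> bad_radii (\<lambda>z. f (z + c))"
  have cB: "countable B" using B2 f nz_mero_shift[OF f(1)] by (auto simp: B_def countable_bad_radii)
  have "T (\<lambda>z. f (z + c) / f z) r \<le> exp (r powr ((1 + s) / 2))"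
    if r: "r \<ge> max (2 * norm c + 1) (max R0 R1)" "r \<notin> B" for r
  proof -
    have r1: "r \<ge> 1" "2 * norm c \<le> r" using r(1) norm_ge_zero[of c] by linarith+
    \<comment> \<open>The gaps between \<open>r\<close>, \<open>\<rho>\<close> and \<open>R\<close>
      exceed \<open>r\<close>, which gives \<open>1 / (\<rho> - r) \<le> 1\<close> and
      \<open>R / (R - \<rho>) \<le> 5\<close>.\<close>
    obtain \<rho> where \<rho>: "2 * r < \<rho>" "\<rho> < 3 * r" "\<rho> \<notin> B" using exists_notin_countable[OF cB, of "2 * r" "3 * r"] r1 by auto
    obtain R where R: "4 * r < R" "R < 5 * r" "R \<notin> B" using exists_notin_countable[OF cB, of "4 * r" "5 * r"] r1 by auto
    have g: "unit_on_circle f \<rho>" "unit_on_circle f R" "unit_on_circle f r" "unit_on_circle (\<lambda>z. f (z + c)) r"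
      using \<rho> R r unit_on_circle_notin_bad_radii by (auto simp: B_def)
    define E where "E = 2 * exp ((5 * r) powr s) + C"
    have E0: "E \<ge> 0" using C(1) by (simp add: E_def)
    have TE: "2 * T f v + C \<le> E" if "r \<le> v" "v \<le> 5 * r" "v \<notin> B" for v
    proof -
      have "T f v \<le> exp (v powr s)" using B2(4)[of v] that r by (auto simp: B_def)
      also have "\<dots> \<le> exp ((5 * r) powr s)" using that r1 B2(1) by (auto intro!: powr_mono2)
      finally show ?thesis by (simp add: E_def)
    qed
    have m: "circle_mean \<rho> (\<lambda>z. \<bar>ln (norm (f z))\<bar>) \<le> E"
      using C(2)[of \<rho>] TE[of \<rho>] g \<rho> r1 by auto
    have n: "zeros_poles_count f \<rho> \<le> E * 5"
    proof -
      have "zeros_poles_count f \<rho> \<le> (2 * T f R + C) * (R / (R - \<rho>))" using C(3)[of \<rho> R] g \<rho> R r1 by auto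
      also have "\<dots> \<le> E * (R / (R - \<rho>))" using TE[of R] R \<rho> r1 by (intro mult_right_mono) auto
      also have "\<dots> \<le> E * 5" using R \<rho> r1 E0 by (intro mult_left_mono) (auto simp: field_simps)
      finally show ?thesis .
    qed
    have gpc: "unit_at f (z + c)" if "norm z = r" for z
    proof -
      have "unit_at (\<lambda>z. f (z + c)) z" using g(4) that by (simp add: unit_on_circle_def)
      from unit_at_shift[of "\<lambda>z. f (z + c)" "z + c" "-c"] this show ?thesis by simp
    qed
    have pole0: "pole_div (\<lambda>z. f (z + c) / f z) b = 0" for b using z[of b] by (simp add: pole_div_def)
    have "T (\<lambda>z. f (z + c) / f z) r = proximity (\<lambda>z. f (z + c) / f z) r"
      by (simp add: T_def counting_def pole0)
    also have "\<dots> \<le> circle_mean r (\<lambda>z. \<bar>ln (norm (f (z + c))) - ln (norm (f (z + 0)))\<bar>)"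
      unfolding proximity_eq
    proof (rule circle_mean_mono)
      show "continuous_on (sphere 0 r) (\<lambda>z. lnplus (norm (f (z + c) / f z)))"
        by (rule analytic_on_circle_lnplus[OF unit_on_circle_analytic_on_circle]) (use g(3,4) in \<open>auto simp: unit_on_circle_def intro: unit_at_divide\<close>)
      show "continuous_on (sphere 0 r) (\<lambda>z. \<bar>ln (norm (f (z + c))) - ln (norm (f (z + 0)))\<bar>)"
        using g(3,4) by (intro continuous_on_rabs continuous_on_diff unit_on_circle_continuous_ln) auto
      fix z :: complex assume "norm z = r"
      then have "f z \<noteq> 0" "f (z + c) \<noteq> 0" using g(3,4) by (auto simp: unit_on_circle_def unit_at_def)
      then show "lnplus (norm (f (z + c) / f z)) \<le> \<bar>ln (norm (f (z + c))) - ln (norm (f (z + 0)))\<bar>"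
        by (simp add: lnplus_def norm_divide ln_div)
    qed (use r1 in auto)
    also have "\<dots> \<le> 8 * norm (c - 0) / (\<rho> - r) * circle_mean \<rho> (\<lambda>z. \<bar>ln (norm (f z))\<bar>)
      + zeros_poles_count f \<rho> * (norm (c - 0) powr (1/2) / (1/2) * (4 * circle_powr_const (1/2) * r powr -(1/2)))"
      by (rule mean_ln_shift_ratio_le) (use f(1) g \<rho> r1 gpc in \<open>auto simp: unit_on_circle_def\<close>)
    also have "\<dots> \<le> (8 * norm c) * E + (E * 5) * L"
    proof (rule add_mono)
      have "8 * norm c / (\<rho> - r) \<le> 8 * norm c / 1" using \<rho> r1 by (intro divide_left_mono) auto
      then show "8 * norm (c - 0) / (\<rho> - r) * circle_mean \<rho> (\<lambda>z. \<bar>ln (norm (f z))\<bar>) \<le> (8 * norm c) * E"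
        using m E0 mean_abs_ln_nonneg[of f \<rho> r "1/2"] f(1) g(1) \<rho> r1 by (intro mult_mono) auto
      have "r powr -(1/2) \<le> 1" using r1 by (simp add: powr_minus inverse_le_1_iff ge_one_powr_ge_zero)
      then have "L * r powr -(1/2) \<le> L * 1" using L by (intro mult_left_mono)
      then show "zeros_poles_count f \<rho> * (norm (c - 0) powr (1/2) / (1/2) * (4 * circle_powr_const (1/2) * r powr -(1/2))) \<le> (E * 5) * L"
      proof -
        have "norm (c - 0) powr (1/2) / (1/2) * (4 * circle_powr_const (1/2) * r powr -(1/2)) = L * r powr -(1/2)"
          by (simp add: L_def)
        then show ?thesis
          using n E0 L zeros_poles_count_nonneg[of f \<rho>] \<open>L * r powr -(1/2) \<le> L * 1\<close> by (simp only:) (intro mult_mono, auto)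
      qed
    qed
    also have "\<dots> = E * K" by (simp add: K_def algebra_simps)
    also have "\<dots> \<le> exp (r powr ((1 + s) / 2))" using R1[of r] r by (auto simp: E_def)
    finally show ?thesis .
  qed
  then show ?thesis unfolding subexponential_def using B2(1,2) cB
    by (intro exI[of _ "(1 + s) / 2"] exI[of _ "max (2 * norm c + 1) (max R0 R1)"] exI[of _ B]) auto
qed

lemma subexponential_hyper_order:
  assumes f: "nz_mero f" and ho: "hyper_order f < 1"
  shows "subexponential f"
proof -
  obtain s' where s': "hyper_order f < ereal s'" "ereal s' < 1" using ereal_dense2[OF ho] by blast
  \<comment> \<open>The number \<open>s'\<close> above the hyper order may be negative, whereas
    \<open>subexponential\<close> asks for a positive exponent.\<close>
  define s where "s = max s' (1/2)"
  have s: "0 < s" "s < 1" using s'(2) by (auto simp: s_def one_ereal_def)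
  have "eventually (\<lambda>r. ereal (ln (ln (nev_char f r)) / ln r) < ereal s') at_top"
    using s'(1) unfolding hyper_order_def by (rule Limsup_lessD)
  then obtain R where R: "\<And>r. r \<ge> R \<Longrightarrow> ln (ln (nev_char f r)) / ln r < s'"
    by (auto simp: eventually_at_top_linorder)
  have "T f r \<le> exp (r powr s)" if r: "r \<ge> max R 2" "r \<notin> bad_radii f" for r
  \<comment> \<open>For small \<open>T f r\<close> the iterated logarithm is not meaningful, and the
    bound is immediate from \<open>r powr s \<ge> 1\<close>.\<close>
  proof (cases "T f r \<le> exp 1")
    case True
    have "1 \<le> r powr s" using r s by (simp add: ge_one_powr_ge_zero)
    then have "exp 1 \<le> exp (r powr s)" by simp
    with True show ?thesis by linarith
  next
    case False
    have nc: "nev_char f r = T f r" using nev_char_eq[OF f] unit_on_circle_notin_bad_radii r by auto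
    have T0: "0 < T f r" using False exp_gt_zero[of "1::real"] by linarith
    have "exp 1 < T f r" using False by simp
    then have "ln (exp 1) < ln (T f r)" using T0 by (intro ln_less_cancel_iff[THEN iffD2]) auto
    then have l: "1 < ln (T f r)" by simp
    have lr: "0 < ln r" using r by simp
    have "ln (ln (T f r)) / ln r < s" using R[of r] r nc by (auto simp: s_def)
    then have "ln (ln (T f r)) < s * ln r" using lr by (simp add: divide_less_eq)
    then have "exp (ln (ln (T f r))) < exp (s * ln r)" by simp
    then have "ln (T f r) < r powr s" using l r by (simp add: powr_def)
    then have "exp (ln (T f r)) < exp (r powr s)" by simp
    then show ?thesis using T0 by simp
  qed
  then show ?thesis unfolding subexponential_def using s countable_bad_radii[OF f] by blast
qed

section \<open>Zeros, poles and 1-points of a shift quotient\<close>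

lemma nz_mero_not_const: "nonconst u \<Longrightarrow> u meromorphic_on UNIV \<Longrightarrow> nz_mero (\<lambda>z. u z - k)"
  by (auto simp: nonconst_def intro: nz_mero_diff_const)

lemma nonconst_shift: "nonconst u \<Longrightarrow> nonconst (\<lambda>z. u (z + c))"
proof -
  assume u: "nonconst u"
  show ?thesis unfolding nonconst_def
  proof safe
    fix k assume "mero_eq (\<lambda>z. u (z + c)) (\<lambda>_. k)"
    from mero_eq_const_shift[OF this, of "-c"] have "mero_eq u (\<lambda>_. k)" by simp
    with u show False by (simp add: nonconst_def)
  qed
qed

text \<open>Subtracting a constant does not change the order at a pole. Elsewhere the orders of the
  differences are nonnegative, so under the last two hypotheses both are \<open>0\<close>.\<close>

lemma zorder_diff_const_eq:
  assumes "nz_mero u" "nz_mero v" "nz_mero (\<lambda>w. u w - k)" "nz_mero (\<lambda>w. v w - l)" "zorder u b = zorder v b"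
    and "zorder (\<lambda>w. u w - k) b \<le> 0" "zorder (\<lambda>w. v w - l) b \<le> 0"
  shows "zorder (\<lambda>w. u w - k) b = zorder (\<lambda>w. v w - l) b"
proof (cases "zorder u b < 0")
  case True
  then show ?thesis using zorder_diff_const_neg[of u b k] zorder_diff_const_neg[of v b l] assms by simp
next
  case False
  then show ?thesis
    using zorder_diff_const_nonneg[of u k b] zorder_diff_const_nonneg[of v l b] assms by simp
qed

text \<open>The product in the last hypothesis telescopes to \<open>f(z + 2 c) / f(z)\<close>, so
  this is the case in which \<open>f\<close> has period \<open>2 * c\<close>.\<close>

lemma shift_quotient_periodic_case:
  assumes f: "nz_mero f" "nonconst f" "subexponential f"
    and ge: "\<And>z. zorder f z \<le> zorder f (z + c)"
    and one: "\<And>z. 0 < zorder (\<lambda>w. f w - 1) z \<Longrightarrow> 0 < zorder (\<lambda>w. f (w + c) / f w - k) z"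
    and H1: "\<not> mero_eq (\<lambda>z. f (z + c) / f z) (\<lambda>_. 1)" and Hk: "\<not> mero_eq (\<lambda>z. f (z + c) / f z) (\<lambda>_. k)"
    and HH: "mero_eq (\<lambda>z. (f (z + c) / f z) * (f (z + c + c) / f (z + c))) (\<lambda>_. 1)"
  shows False
proof -
  define H where "H = (\<lambda>z. f (z + c) / f z)"
  have mH: "nz_mero H" unfolding H_def by (intro nz_mero_divide nz_mero_shift f)
  have zH: "zorder H z = zorder f (z + c) - zorder f z" for z
    unfolding H_def using zorder_nz_mero_divide[OF nz_mero_shift[OF f(1)] f(1)] by (simp add: zorder_translate)
  have Hnn: "0 \<le> zorder H z" for z using ge[of z] by (simp add: zH)
  have HH': "mero_eq (\<lambda>w. H w * H (w + c)) (\<lambda>_. 1)" using HH by (simp add: H_def)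
  \<comment> \<open>The orders of \<open>H\<close> at \<open>z\<close> and at \<open>z + c\<close>
    are nonnegative and add up to the order of the constant \<open>1\<close>.\<close>
  have zH0: "zorder H z = 0" for z
  proof -
    have "zorder H z + zorder H (z + c) = zorder (\<lambda>w. H w * H (w + c)) z"
      using zorder_nz_mero_times[OF mH nz_mero_shift[OF mH]] by (simp add: zorder_translate)
    also have "\<dots> = 0" using zorder_mero_eq[OF HH'] by simp
    finally show ?thesis using Hnn[of z] Hnn[of "z + c"] by linarith
  qed
  have sH: "subexponential H" unfolding H_def by (rule subexponential_shift_ratio[OF f(1,3)]) (use Hnn in \<open>simp add: H_def\<close>)
  obtain h where h: "mero_eq H (\<lambda>_. h)"
    using zero_free_inverse_shift_const[OF mH sH zH0 HH'] by blast
  have "h = -1"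
  proof -
    have "eventually (\<lambda>w. H w = h) (at 0)" "eventually (\<lambda>w. H (w + c) = h) (at 0)"
      "eventually (\<lambda>w. H w * H (w + c) = 1) (at 0)"
      using h mero_eq_const_shift[OF h, of c] HH' by (auto simp: mero_eq_def)
    then have "eventually (\<lambda>w. h * h = 1) (at (0::complex))" by eventually_elim simp
    then have "h * h = 1" by simp
    then have "h = 1 \<or> h = -1" by (metis mult_cancel_right1 square_eq_1_iff)
    then show ?thesis using h H1 by (auto simp: H_def)
  qed
  with h have hm: "mero_eq H (\<lambda>_. -1)" by simp
  have km: "k \<noteq> -1" using hm Hk by (auto simp: H_def)
  have mk: "nz_mero (\<lambda>w. f w - l)" for l by (rule nz_mero_not_const[OF f(2) nz_mero_meromorphic[OF f(1)]])
  note m1 = mk[of 1] and mm1 = mk[of "-1"]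
  \<comment> \<open>A 1-point of \<open>f\<close> would be a zero of \<open>H - k\<close>, which
    equals the nonzero constant \<open>-1 - k\<close>.\<close>
  have no1: "zorder (\<lambda>w. f w - 1) z \<le> 0" for z
  proof (rule ccontr)
    assume "\<not> ?thesis"
    then have "0 < zorder (\<lambda>w. H w - k) z" using one[of z] by (simp add: H_def)
    moreover have "mero_eq (\<lambda>w. H w - k) (\<lambda>_. -1 - k)" using hm by (simp add: mero_eq_def)
    then have "zorder (\<lambda>w. H w - k) z = zorder (\<lambda>_. -1 - k) z" by (rule zorder_mero_eq)
    moreover have "-1 - k \<noteq> 0" using km by (metis add.inverse_inverse diff_eq_eq add_0)
    ultimately show False by simp
  qed
  have neg: "mero_eq (\<lambda>w. f (w + c)) (\<lambda>w. - f w)"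
    unfolding mero_eq_def
  proof
    fix z
    have "eventually (\<lambda>w. H w = -1) (at z)" "eventually (\<lambda>w. f w \<noteq> 0) (at z)"
      using hm nz_mero_eventually[OF f(1)] by (auto simp: mero_eq_def)
    then show "eventually (\<lambda>w. f (w + c) = - f w) (at z)" by eventually_elim (auto simp: H_def field_simps)
  qed
  have nom1: "zorder (\<lambda>w. f w - (-1)) z \<le> 0" for z
  proof -
    have "mero_eq (\<lambda>w. f w - (-1)) (\<lambda>w. - 1 * (f (w + c) - 1))"
      unfolding mero_eq_def
    proof
      fix z show "eventually (\<lambda>w. f w - (-1) = - 1 * (f (w + c) - 1)) (at z)"
        using neg[unfolded mero_eq_def, rule_format, of z] by eventually_elim simp
    qed
    then have "zorder (\<lambda>w. f w - (-1)) z = zorder (\<lambda>w. - 1 * (f (w + c) - 1)) z" by (rule zorder_mero_eq)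
    also have "\<dots> = zorder (\<lambda>w. f (w + c) - 1) z" by (rule zorder_cmult) simp
    also have "\<dots> = zorder (\<lambda>w. f w - 1) (z + c)" by (rule zorder_translate)
    finally show ?thesis using no1 by simp
  qed
  \<comment> \<open>\<open>f(z + c) = - f(z)\<close> exchanges \<open>f - 1\<close> and
    \<open>f + 1\<close> up to sign, so that \<open>\<phi>(z + c) = 1 / \<phi>(z)\<close>. Numerator
    and denominator have no zeros and the same poles, so \<open>\<phi>\<close> has neither.\<close>
  define \<phi> where "\<phi> = (\<lambda>z. (f z - 1) / (f z - (-1)))"
  have m\<phi>: "nz_mero \<phi>" unfolding \<phi>_def by (intro nz_mero_divide m1 mm1)
  have z\<phi>: "zorder \<phi> z = 0" for z
    unfolding \<phi>_def using zorder_nz_mero_divide[OF m1 mm1, of z]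
      zorder_diff_const_eq[OF f(1) f(1) m1 mm1 refl no1 nom1, of z] by simp
  have inv\<phi>: "mero_eq (\<lambda>w. \<phi> w * \<phi> (w + c)) (\<lambda>_. 1)"
    unfolding mero_eq_def
  proof
    fix z
    have "eventually (\<lambda>w. f (w + c) = - f w) (at z)" "eventually (\<lambda>w. f w - 1 \<noteq> 0) (at z)" "eventually (\<lambda>w. f w - (-1) \<noteq> 0) (at z)"
      using neg nz_mero_eventually[OF m1] nz_mero_eventually[OF mm1] by (auto simp: mero_eq_def)
    then show "eventually (\<lambda>w. \<phi> w * \<phi> (w + c) = 1) (at z)"
    proof eventually_elim
      case (elim w)
      have "- f w - 1 = - (f w - (-1))" "- f w - (-1) = - (f w - 1)" by auto
      then show ?case using elim by (simp only: \<phi>_def) (simp add: divide_simps, simp add: algebra_simps)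
    qed
  qed
  obtain C1 where C1: "\<And>r. 0 < r \<Longrightarrow> unit_on_circle (\<lambda>w. f w - (-1)) r \<Longrightarrow> T (\<lambda>z. inverse (f z - (-1))) r = T (\<lambda>w. f w - (-1)) r + C1"
    using first_main_theorem[OF mm1] by blast
  have "subexponential \<phi>"
  proof (rule subexponential_le[OF f(3)])
    show "countable (bad_radii f \<union> bad_radii (\<lambda>w. f w - (-1)))" using countable_bad_radii f m1 mm1 by blast
    fix r :: real assume r: "1 \<le> r" "r \<notin> bad_radii f \<union> bad_radii (\<lambda>w. f w - (-1))"
    have g: "unit_on_circle f r" "unit_on_circle (\<lambda>w. f w - (-1)) r" using r unit_on_circle_notin_bad_radii by auto
    have r1: "analytic_on_circle (\<lambda>w. f w - 1) r" using unit_on_circle_analytic_on_circle[OF g(1)] by (auto simp: analytic_on_circle_def intro!: analytic_intros)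
    have "T \<phi> r = T (\<lambda>z. (f z - 1) * inverse (f z - (-1))) r" by (simp only: \<phi>_def divide_inverse)
    also have "\<dots> \<le> T (\<lambda>w. f w - 1) r + T (\<lambda>z. inverse (f z - (-1))) r"
      by (rule T_mult) (use m1 nz_mero_inverse[OF mm1] r1 unit_on_circle_analytic_on_circle[OF unit_on_circle_inverse[OF g(2)]] r in auto)
    also have "\<dots> \<le> (T f r + (lnplus (norm (1::complex)) + ln 2)) + (T f r + (lnplus (norm (-1::complex)) + ln 2) + C1)"
      using T_diff_const[OF f(1) m1 unit_on_circle_analytic_on_circle[OF g(1)] r(1)] T_diff_const[OF f(1) mm1 unit_on_circle_analytic_on_circle[OF g(1)] r(1)] C1[OF _ g(2)] r
      by simp
    finally show "T \<phi> r \<le> (2 * T f r + (lnplus (norm (1::complex)) + ln 2 + (lnplus (norm (-1::complex)) + ln 2) + C1)) * 1" by simp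
  qed simp
  then obtain \<kappa> where \<kappa>: "mero_eq \<phi> (\<lambda>_. \<kappa>)"
    using zero_free_inverse_shift_const[OF m\<phi> _ z\<phi> inv\<phi>] by blast
  \<comment> \<open>\<open>\<kappa> = 1\<close> would give \<open>f - 1 = f + 1\<close>; hence the
    Moebius map can be inverted and \<open>f\<close> is constant.\<close>
  have "mero_eq f (\<lambda>_. (1 + \<kappa>) / (1 - \<kappa>))"
    unfolding mero_eq_def
  proof
    fix z
    have "eventually (\<lambda>w. \<phi> w = \<kappa>) (at z)" "eventually (\<lambda>w. f w - (-1) \<noteq> 0) (at z)"
      using \<kappa> nz_mero_eventually[OF mm1] by (auto simp: mero_eq_def)
    then show "eventually (\<lambda>w. f w = (1 + \<kappa>) / (1 - \<kappa>)) (at z)"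
    proof eventually_elim
      case (elim w)
      then have e: "f w - 1 = \<kappa> * (f w + 1)" by (simp add: \<phi>_def field_simps)
      then have "\<kappa> \<noteq> 1" by auto
      with e show ?case by (simp add: field_simps)
    qed
  qed
  then show False using f(2) by (simp add: nonconst_def)
qed

lemma shift_quotient_main_case:
  assumes f: "nz_mero f" "nonconst f" "subexponential f"
    and ge: "\<And>z. zorder f z \<le> zorder f (z + c)"
    and one: "\<And>z. 0 < zorder (\<lambda>w. f w - 1) z \<Longrightarrow> 0 < zorder (\<lambda>w. f (w + c) / f w - k) z"
    and H1: "\<not> mero_eq (\<lambda>z. f (z + c) / f z) (\<lambda>_. 1)" and Hk: "\<not> mero_eq (\<lambda>z. f (z + c) / f z) (\<lambda>_. k)"
    and HH: "\<not> mero_eq (\<lambda>z. (f (z + c) / f z) * (f (z + c + c) / f (z + c))) (\<lambda>_. 1)"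
  shows False
proof -
  define F where "F = (\<lambda>(j::nat) z. f (z + of_nat j * c))"
  define H where "H = (\<lambda>(j::nat) z. F (Suc j) z / F j z)"
  have F0: "F 0 = f" by (simp add: F_def)
  have Fs: "F (Suc j) = (\<lambda>z. F j (z + c))" for j by (simp add: F_def algebra_simps)
  have Hs: "H (Suc j) = (\<lambda>z. H j (z + c))" for j by (simp add: H_def Fs)
  have H0: "H 0 = (\<lambda>z. f (z + c) / f z)" by (simp add: H_def Fs F0)
  have mF: "nz_mero (F j)" for j unfolding F_def by (intro nz_mero_shift f)
  have ncF: "nonconst (F j)" for j unfolding F_def by (intro nonconst_shift f)
  have mF1: "nz_mero (\<lambda>z. F j z - 1)" for j by (rule nz_mero_not_const[OF ncF nz_mero_meromorphic[OF mF]])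
  have mH: "nz_mero (H j)" for j unfolding H_def by (intro nz_mero_divide mF)
  have zF: "zorder (F (Suc j)) z = zorder (F j) z + zorder (H j) z" for j z
    unfolding H_def using zorder_nz_mero_divide[OF mF mF] by simp
  have Hnn: "0 \<le> zorder (H j) z" for j z
  proof -
    have "zorder (H j) z = zorder f (z + of_nat j * c + c) - zorder f (z + of_nat j * c)"
      unfolding H_def using zorder_nz_mero_divide[OF mF mF, of "Suc j" j z]
      by (simp add: F_def zorder_translate algebra_simps)
    with ge[of "z + of_nat j * c"] show ?thesis by simp
  qed
  have sh: "\<not> mero_eq (H j) (\<lambda>_. l)" if "\<not> mero_eq (H 0) (\<lambda>_. l)" for j l
  proof (induction j)
    case (Suc j)
    then show ?case using mero_eq_const_shift[of "H (Suc j)" l "-c"] by (auto simp: Hs)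
  qed (use that in simp)
  have mHl: "nz_mero (\<lambda>z. H j z - l)" if "\<not> mero_eq (H 0) (\<lambda>_. l)" for j l
    by (rule nz_mero_diff_const[OF nz_mero_meromorphic[OF mH] sh[OF that]])
  have mH1: "nz_mero (\<lambda>z. H j z - 1)" and mHk: "nz_mero (\<lambda>z. H j z - k)" for j
    by (rule mHl; use H1 Hk in \<open>simp add: H0\<close>)+
  have onej: "0 < zorder (\<lambda>w. H j w - k) z" if "0 < zorder (\<lambda>w. F j w - 1) z" for j z
    using that
  proof (induction j arbitrary: z)
    case 0 then show ?case using one[of z] by (simp add: F0 H0)
  next
    case (Suc j)
    have "zorder (\<lambda>w. F j (w + c) - 1) z = zorder (\<lambda>w. F j w - 1) (z + c)"
      "zorder (\<lambda>w. H j (w + c) - k) z = zorder (\<lambda>w. H j w - k) (z + c)"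
      by (rule zorder_translate)+
    with Suc show ?case by (simp add: Fs Hs)
  qed
  have m_1: "nz_mero (\<lambda>_. -1)" by (rule nz_mero_const) simp
  define P where "P = (\<lambda>z. H 0 z * H 1 z - 1)"
  have mP: "nz_mero P" unfolding P_def
  proof (rule nz_mero_diff_const)
    show "(\<lambda>z. H 0 z * H 1 z) meromorphic_on UNIV" by (intro meromorphic_intros nz_mero_meromorphic mH)
    show "\<not> mero_eq (\<lambda>z. H 0 z * H 1 z) (\<lambda>_. 1)" using HH by (simp add: H0 Hs)
  qed
  \<comment> \<open>\<open>\<phi>\<close> is the cross ratio of \<open>f\<close> and \<open>1, 1/H, 1/(H H\<^sub>c)\<close>: apart from zeros of the coefficients, its zeros, poles and 1-points
    are 1-points of \<open>f, f\<^sub>c, f\<^sub>2\<^sub>c\<close>, hence lie over \<open>k\<close>-points of \<open>H\<close> and its shifts.\<close>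
  define \<phi> where "\<phi> = (\<lambda>z. (H 0 z * (H 1 z - 1)) * (F 0 z - 1) / (P z * (F 1 z - 1)))"
  define \<phi>1 where "\<phi>1 = (\<lambda>z. \<phi> z - 1)"
  \<comment> \<open>\<open>\<phi> - 1\<close> as a quotient of products, from which zeros and poles
    can be read off. The factor \<open>F 2 - 1\<close> appears because
    \<open>F 2 = H 0 * H 1 * f\<close> and \<open>\<phi>\<close> takes the value \<open>1\<close> at
    the third small function.\<close>
  define \<psi> where "\<psi> = (\<lambda>z. (-1 * (H 0 z - 1)) * (F 2 z - 1) / (P z * (F 1 z - 1)))"
  have m\<phi>: "nz_mero \<phi>" unfolding \<phi>_def by (intro nz_mero_divide nz_mero_times mH mH1 mF1 mP)
  have m\<psi>: "nz_mero \<psi>" unfolding \<psi>_def by (intro nz_mero_divide nz_mero_times nz_mero_const mH1 mF1 mP) simp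
  \<comment> \<open>Product of everything that must not vanish in the algebra below; identities
    proved at its units hold as identities of meromorphic functions.\<close>
  define all where "all = (\<lambda>z. F 0 z * F 1 z * F 2 z * (F 0 z - 1) * (F 1 z - 1) * (F 2 z - 1) * (H 0 z - 1) * (H 1 z - 1) * P z)"
  have mall: "nz_mero all" unfolding all_def by (intro nz_mero_times mF mF1 mH1 mP)
  have nz: "F 0 w \<noteq> 0 \<and> F 1 w \<noteq> 0 \<and> F 2 w \<noteq> 0 \<and> F 0 w - 1 \<noteq> 0 \<and> F 1 w - 1 \<noteq> 0 \<and> F 2 w - 1 \<noteq> 0
     \<and> H 0 w - 1 \<noteq> 0 \<and> H 1 w - 1 \<noteq> 0 \<and> P w \<noteq> 0" if "unit_at all w" for w
    using that by (simp add: unit_at_def all_def)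
  have F1H: "F 1 w = H 0 w * F 0 w" "F 2 w = H 1 w * F 1 w" if "unit_at all w" for w
    using nz[OF that] by (auto simp: H_def numeral_2_eq_2)
  have e\<psi>: "mero_eq \<psi> \<phi>1"
  proof (rule mero_eqI_nz_mero[OF mall])
    fix w assume w: "unit_at all w"
    have "\<phi>1 w = ((H 0 w * (H 1 w - 1)) * (F 0 w - 1) - P w * (F 1 w - 1)) / (P w * (F 1 w - 1))"
      using nz[OF w] by (simp add: \<phi>1_def \<phi>_def diff_divide_distrib)
    also have "(H 0 w * (H 1 w - 1)) * (F 0 w - 1) - P w * (F 1 w - 1) = (-1 * (H 0 w - 1)) * (F 2 w - 1)"
      unfolding P_def F1H(2)[OF w] F1H(1)[OF w] by (simp add: algebra_simps)
    finally show "\<psi> w = \<phi>1 w" by (simp add: \<psi>_def)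
  qed
  have m\<phi>1: "nz_mero \<phi>1" by (rule nz_mero_mero_eq[OF m\<psi> e\<psi>])
  define A where "A = (\<lambda>z. deriv \<phi> z / \<phi> z)"
  define B where "B = (\<lambda>z. deriv \<phi>1 z / \<phi>1 z)"
  \<comment> \<open>Clearing denominators in the definition of \<open>\<phi>\<close> gives
    \<open>\<phi> * P * (H 0 * f - 1) = H 0 * (H 1 - 1) * (f - 1)\<close>. Solved for
    \<open>f\<close> this is \<open>f = N / Q\<close>.\<close>
  define N where "N = (\<lambda>z. \<phi> z * P z - H 0 z * (H 1 z - 1))"
  define Q where "Q = (\<lambda>z. \<phi> z * P z * H 0 z - H 0 z * (H 1 z - 1))"
  define BA where "BA = (\<lambda>z. B z - A z)"
  \<comment> \<open>The functions are announced before the radii are chosen, including derivatives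
    and differences whose nonvanishing is only settled later.\<close>
  define L where "L = range F \<union> range (\<lambda>j z. F j z - 1) \<union> range (\<lambda>j z. H j z - 1) \<union> range (\<lambda>j z. H j z - k)
      \<union> {P, \<phi>1, deriv \<phi>, deriv \<phi>1, BA, N, Q}"
  have cL: "countable L" unfolding L_def by (intro countable_Un countable_image) auto
  obtain x \<tau> \<alpha> where x: "nev_seq x \<tau> \<alpha>" "\<tau> = (\<lambda>n. T f (x n 0))" "nev_seq.controlled x \<tau> 4 f"
    "\<And>v. v \<in> L \<Longrightarrow> nz_mero v \<Longrightarrow> nev_seq.admissible x v"
    using nev_seq_exists[OF f cL] by blast
  interpret nev_seq x \<tau> \<alpha> by (rule x(1))
  have okL: "admissible v" if "v \<in> L" "nz_mero v" for v using x(4) that .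
  have okF: "admissible (F j)" and okF1: "admissible (\<lambda>z. F j z - 1)" and okH1: "admissible (\<lambda>z. H j z - 1)"
    and okHk: "admissible (\<lambda>z. H j z - k)" for j
    by (rule okL; use mF mF1 mH1 mHk in \<open>auto simp: L_def\<close>)+
  have okH: "admissible (H j)" for j unfolding H_def by (intro admissible_divide okF)
  have okP: "admissible P" and admissible\<phi>1: "admissible \<phi>1" by (rule okL; use mP m\<phi>1 in \<open>auto simp: L_def\<close>)+
  have admissible\<phi>: "admissible \<phi>" unfolding \<phi>_def by (intro admissible_divide admissible_mult okH okH1 okF1 okP)
  have cH: "controlled 2 (H j)" and sH: "smallT (H j)" for j
    unfolding H_def F_def
    by (rule shift_ratio_entire[OF x(3)]; use okF[of j] okF[of "Suc j"] Hnn[of j] in \<open>simp add: F_def H_def\<close>)+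
  have cf: "controlled 2 f" by (rule controlled_weaken[OF x(3)]) simp
  \<comment> \<open>\<open>F 1 = H 0 * f\<close>, so the growth of the shift follows from that of
    the quotient.\<close>
  have cF1: "controlled 2 (F 1)"
  proof (rule controlled_mero_eq[OF controlled_mult[OF cH[of 0] cf] okF])
    show "mero_eq (\<lambda>z. H 0 z * f z) (F 1)" by (rule mero_eqI_nz_mero[OF mall]) (use F1H(1) F0 in auto)
  qed
  have sP: "smallT P" unfolding P_def by (rule smallT_diff_const[OF smallT_mult[OF sH sH]]) (use okP in \<open>simp add: P_def\<close>)
  have cP: "controlled 2 P" unfolding P_def by (rule controlled_diff_const[OF controlled_mult[OF cH cH]]) (use okP in \<open>simp add: P_def\<close>)
  have sH1: "smallT (\<lambda>z. H j z - 1)" and sHk: "smallT (\<lambda>z. H j z - k)" for j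
    by (intro smallT_diff_const sH okH1 okHk)+
  have c\<phi>: "controlled 2 \<phi>" unfolding \<phi>_def
    by (intro controlled_divide controlled_mult controlled_diff_const cH cP okH1 okF1 cF1) (use cf F0 in simp)
  have c\<phi>1: "controlled 2 \<phi>1" unfolding \<phi>1_def by (rule controlled_diff_const[OF c\<phi>]) (use admissible\<phi>1 in \<open>simp add: \<phi>1_def\<close>)
  have z1: "zorder (\<lambda>w. F j w - 1) b \<le> 0" if "zorder (\<lambda>w. H j w - k) b \<le> 0" for j b
    using onej[of j b] that by linarith
  \<comment> \<open>Where none of the listed functions vanishes, \<open>H 0\<close> has order
    \<open>0\<close>, so \<open>F 0\<close> and \<open>F 1\<close> have the same order. Neither
    takes the value \<open>1\<close> there, so \<open>F 0 - 1\<close> and \<open>F 1 - 1\<close>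
    have equal orders, which cancel in \<open>\<phi>\<close>; in particular common poles leave no
    trace.\<close>
  have zero\<phi>: "\<exists>v\<in>{H 0, (\<lambda>z. H 1 z - 1), P, (\<lambda>z. H 0 z - k), (\<lambda>z. H 1 z - k)}. 0 < zorder v b" if "zorder \<phi> b \<noteq> 0" for b
  proof (rule ccontr)
    assume "\<not> ?thesis"
    then have le: "zorder (H 0) b \<le> 0" "zorder (\<lambda>z. H 1 z - 1) b \<le> 0" "zorder P b \<le> 0"
      "zorder (\<lambda>z. H 0 z - k) b \<le> 0" "zorder (\<lambda>z. H 1 z - k) b \<le> 0" by auto
    have nn: "0 \<le> zorder (\<lambda>z. H 1 z - 1) b" by (rule zorder_diff_const_nonneg[OF mH mH1 Hnn])
    have nnP: "0 \<le> zorder P b" unfolding P_def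
      by (rule zorder_diff_const_nonneg[OF nz_mero_times[OF mH mH] mP[unfolded P_def]])
         (use zorder_nz_mero_times[OF mH mH, of 0 1 b] Hnn[of 0 b] Hnn[of 1 b] in simp)
    have "zorder (\<lambda>w. F 0 w - 1) b = zorder (\<lambda>w. F 1 w - 1) b"
      by (rule zorder_diff_const_eq[OF mF mF mF1 mF1 _ z1 z1])
         (use le zF[of 0 b] Hnn[of 0 b] in auto)
    then have "zorder \<phi> b = 0" unfolding \<phi>_def
      using le nn nnP Hnn[of 0 b]
      by (simp add: zorder_nz_mero_divide zorder_nz_mero_times nz_mero_times mH mH1 mF1 mP)
    with that show False by simp
  qed
  \<comment> \<open>The same cancellation in the form \<open>\<psi>\<close>, with \<open>H 1\<close>
    linking the orders of \<open>F 1\<close> and \<open>F 2\<close>.\<close>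
  have zero\<phi>1: "\<exists>v\<in>{H 1, (\<lambda>z. H 0 z - 1), P, (\<lambda>z. H 1 z - k), (\<lambda>z. H 2 z - k)}. 0 < zorder v b" if "zorder \<phi>1 b \<noteq> 0" for b
  proof (rule ccontr)
    assume "\<not> ?thesis"
    then have le: "zorder (H 1) b \<le> 0" "zorder (\<lambda>z. H 0 z - 1) b \<le> 0" "zorder P b \<le> 0"
      "zorder (\<lambda>z. H 1 z - k) b \<le> 0" "zorder (\<lambda>z. H 2 z - k) b \<le> 0" by auto
    have nn: "0 \<le> zorder (\<lambda>z. H 0 z - 1) b" by (rule zorder_diff_const_nonneg[OF mH mH1 Hnn])
    have nnP: "0 \<le> zorder P b" unfolding P_def
      by (rule zorder_diff_const_nonneg[OF nz_mero_times[OF mH mH] mP[unfolded P_def]])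
         (use zorder_nz_mero_times[OF mH mH, of 0 1 b] Hnn[of 0 b] Hnn[of 1 b] in simp)
    have "zorder (\<lambda>w. F 2 w - 1) b = zorder (\<lambda>w. F 1 w - 1) b"
      by (rule zorder_diff_const_eq[OF mF mF mF1 mF1 _ z1 z1])
         (use le zF[of 1 b] Hnn[of 1 b] in \<open>auto simp: numeral_2_eq_2\<close>)
    then have "zorder \<psi> b = 0"
      unfolding \<psi>_def
        zorder_nz_mero_divide[OF nz_mero_times[OF nz_mero_times[OF m_1 mH1] mF1] nz_mero_times[OF mP mF1]]
        zorder_nz_mero_times[OF nz_mero_times[OF m_1 mH1] mF1] zorder_nz_mero_times[OF mP mF1] zorder_nz_mero_times[OF m_1 mH1]
      using le nn nnP by simp
    with that zorder_mero_eq[OF e\<psi>, of b] show False by simp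
  qed
  have s\<phi>: "smallT \<phi>"
  \<comment> \<open>If \<open>\<phi>\<close> is constant the logarithmic derivatives vanish and
    cannot be divided, but a constant is small anyway.\<close>
  proof (cases "nz_mero (deriv \<phi>)")
    case False
    then obtain l where "mero_eq \<phi> (\<lambda>_. l)" using deriv_dichotomy[OF m\<phi>] by blast
    then show ?thesis by (rule smallT_const_mero_eq[OF admissible\<phi>])
  next
    case True
    have okd: "admissible (deriv \<phi>)" by (rule okL) (use True in \<open>auto simp: L_def\<close>)
    define all2 where "all2 = (\<lambda>z. \<phi> z * \<phi>1 z * deriv \<phi> z)"
    have mall2: "nz_mero all2" unfolding all2_def by (intro nz_mero_times m\<phi> m\<phi>1 True)
    have nz2: "\<phi> w \<noteq> 0 \<and> \<phi>1 w \<noteq> 0 \<and> deriv \<phi> w \<noteq> 0" if "unit_at all2 w" for w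
      using that by (simp add: unit_at_def all2_def)
    have deq: "mero_eq (deriv \<phi>) (deriv \<phi>1)"
    proof (rule mero_eqI_nz_mero[OF m\<phi>])
      fix w assume "unit_at \<phi> w"
      then have "\<phi> field_differentiable at w" by (auto simp: unit_at_def intro: analytic_on_imp_differentiable_at)
      then show "deriv \<phi> w = deriv \<phi>1 w" unfolding \<phi>1_def by (subst deriv_diff) auto
    qed
    have okd1: "admissible (deriv \<phi>1)" by (rule okL) (use nz_mero_mero_eq[OF True deq] in \<open>auto simp: L_def\<close>)
    have sA: "smallT A" unfolding A_def
      by (rule smallT_log_deriv[OF c\<phi> okd, of "{H 0, (\<lambda>z. H 1 z - 1), P, (\<lambda>z. H 0 z - k), (\<lambda>z. H 1 z - k)}"])
         (use sH sH1 sHk sP zero\<phi> in auto)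
    have sB: "smallT B" unfolding B_def
      by (rule smallT_log_deriv[OF c\<phi>1 okd1, of "{H 1, (\<lambda>z. H 0 z - 1), P, (\<lambda>z. H 1 z - k), (\<lambda>z. H 2 z - k)}"])
         (use sH sH1 sHk sP zero\<phi>1 in auto)
    have d1: "eventually (\<lambda>w. deriv \<phi> w = deriv \<phi>1 w \<and> \<phi> w \<noteq> 0 \<and> \<phi>1 w \<noteq> 0 \<and> deriv \<phi> w \<noteq> 0) (at z)" for z
      using deq[unfolded mero_eq_def, rule_format, of z] nz_mero_eventually_unit_at[OF mall2, of z]
      by eventually_elim (use nz2 in auto)
    \<comment> \<open>As \<open>\<phi> - \<phi>1 = 1\<close> and the derivatives agree, the
      difference of the logarithmic derivatives is a single fraction. Dividing \<open>B\<close> by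
      it recovers \<open>\<phi>\<close>, so smallness of \<open>A\<close> and \<open>B\<close>
      passes to \<open>\<phi>\<close>.\<close>
    have id: "B w - A w = deriv \<phi> w / (\<phi> w * \<phi>1 w)"
      if "deriv \<phi> w = deriv \<phi>1 w \<and> \<phi> w \<noteq> 0 \<and> \<phi>1 w \<noteq> 0 \<and> deriv \<phi> w \<noteq> 0" for w
      using that by (simp add: A_def B_def divide_simps) (simp add: \<phi>1_def algebra_simps)
    have "mero_eq (\<lambda>w. deriv \<phi> w / (\<phi> w * \<phi>1 w)) BA"
      unfolding mero_eq_def
    proof
      fix z show "eventually (\<lambda>w. deriv \<phi> w / (\<phi> w * \<phi>1 w) = BA w) (at z)"
        using d1[of z]
      proof eventually_elim
        case (elim w)
        show ?case unfolding BA_def by (rule id[OF elim, symmetric])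
      qed
    qed
    then have mBA: "nz_mero BA" by (rule nz_mero_mero_eq[rotated]) (intro nz_mero_divide nz_mero_times True m\<phi> m\<phi>1)
    have okBA: "admissible BA" by (rule okL) (use mBA in \<open>auto simp: L_def\<close>)
    have sBA: "smallT BA" unfolding BA_def by (rule smallT_diff[OF sB sA]) (use okBA in \<open>simp add: BA_def\<close>)
    have "mero_eq (\<lambda>w. B w / BA w) \<phi>"
      unfolding mero_eq_def
    proof
      fix z show "eventually (\<lambda>w. B w / BA w = \<phi> w) (at z)"
        using d1[of z]
      proof eventually_elim
        case (elim w)
        then have "deriv \<phi>1 w \<noteq> 0" "deriv \<phi> w = deriv \<phi>1 w" "\<phi> w \<noteq> 0" "\<phi>1 w \<noteq> 0" by auto
        then show ?case unfolding BA_def id[OF elim] by (simp add: B_def)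
      qed
    qed
    then show ?thesis by (rule smallT_mero_eq[OF smallT_divide[OF sB sBA] admissible\<phi>])
  qed
  \<comment> \<open>The closed form of \<open>Q\<close> shows that it does not vanish identically,
    because neither \<open>H 0\<close> nor \<open>H 1\<close> is identically \<open>1\<close>; only
    then may \<open>f\<close> be written as \<open>N / Q\<close>.\<close>
  have idQ: "Q w = H 0 w * (H 1 w - 1) * (1 - H 0 w) / (F 1 w - 1)" and idN: "N w = f w * Q w" if w: "unit_at all w" for w
  proof -
    have e: "\<phi> w * P w = H 0 w * (H 1 w - 1) * (F 0 w - 1) / (F 1 w - 1)" using nz[OF w] by (simp add: \<phi>_def)
    have "Q w = H 0 w * (H 1 w - 1) * ((F 0 w - 1) * H 0 w - (F 1 w - 1)) / (F 1 w - 1)"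
      unfolding Q_def e using nz[OF w] by (simp add: divide_simps) (simp add: algebra_simps)
    also have "(F 0 w - 1) * H 0 w - (F 1 w - 1) = 1 - H 0 w" unfolding F1H(1)[OF w] by (simp add: algebra_simps)
    finally show Q: "Q w = H 0 w * (H 1 w - 1) * (1 - H 0 w) / (F 1 w - 1)" .
    have "N w = H 0 w * (H 1 w - 1) * ((F 0 w - 1) - (F 1 w - 1)) / (F 1 w - 1)"
      unfolding N_def e using nz[OF w] by (simp add: divide_simps) (simp add: algebra_simps)
    also have "(F 0 w - 1) - (F 1 w - 1) = f w * (1 - H 0 w)" unfolding F1H(1)[OF w] F0 by (simp add: algebra_simps)
    finally show "N w = f w * Q w" unfolding Q by simp
  qed
  have mQ: "nz_mero Q"
  proof (rule nz_mero_mero_eq)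
    show "nz_mero (\<lambda>w. H 0 w * (H 1 w - 1) * (-1 * (H 0 w - 1)) / (F 1 w - 1))"
      by (intro nz_mero_divide nz_mero_times mH mH1 mF1 nz_mero_const) simp
    show "mero_eq (\<lambda>w. H 0 w * (H 1 w - 1) * (-1 * (H 0 w - 1)) / (F 1 w - 1)) Q"
      by (rule mero_eqI_nz_mero[OF mall]) (simp add: idQ)
  qed
  have mN: "nz_mero N"
    by (rule nz_mero_mero_eq[OF nz_mero_times[OF f(1) mQ]], rule mero_eqI_nz_mero[OF mall]) (simp add: idN)
  have okQ: "admissible Q" and okN: "admissible N" by (rule okL; use mQ mN in \<open>auto simp: L_def\<close>)+
  have sQ: "smallT Q" unfolding Q_def
    by (rule smallT_diff[OF smallT_mult[OF smallT_mult[OF s\<phi> sP] sH] smallT_mult[OF sH sH1]])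
       (use okQ in \<open>simp add: Q_def\<close>)
  have sN: "smallT N" unfolding N_def
    by (rule smallT_diff[OF smallT_mult[OF s\<phi> sP] smallT_mult[OF sH sH1]])
       (use okN in \<open>simp add: N_def\<close>)
  have "mero_eq (\<lambda>w. N w / Q w) f"
    unfolding mero_eq_def
  proof
    fix z show "eventually (\<lambda>w. N w / Q w = f w) (at z)"
      using nz_mero_eventually_unit_at[OF mall, of z] nz_mero_eventually[OF mQ, of z]
      by eventually_elim (simp add: idN)
  qed
  then have "smallT f" by (rule smallT_mero_eq[OF smallT_divide[OF sN sQ] ctrlD[OF x(3)]])
  then show False by (rule not_smallT_\<tau>) (simp add: x(2))
qed

text \<open>With \<open>l\<close> the linear combination, \<open>a * f(z + c) = l + b * f\<close>.
  Inclusion of zeros, where \<open>f\<close> vanishes, and inclusion of poles, elsewhere, both give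
  that \<open>l\<close> has at least the order of \<open>f\<close>; hence so has the sum.\<close>

lemma zorder_linear_shift_ge:
  assumes f: "nz_mero f" and ab: "a \<noteq> 0" "b \<noteq> 0"
    and E0: "E_subset 0 f 0 (\<lambda>z. a * f (z + c) - b * f z)"
    and Einf: "E_pole_subset (\<lambda>z. a * f (z + c) - b * f z) f"
  shows "zorder f z \<le> zorder f (z + c)"
proof -
  define l where "l = (\<lambda>z. a * f (z + c) - b * f z)"
  have mfc: "nz_mero (\<lambda>z. f (z + c))" by (rule nz_mero_shift[OF f])
  have "l meromorphic_on UNIV" unfolding l_def by (intro meromorphic_intros nz_mero_meromorphic f mfc)
  then consider "nz_mero l" | "mero_eq l (\<lambda>_. 0)" using nz_mero_dichotomy by (auto simp: mero_eq_def)
  then show ?thesis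
  proof cases
    \<comment> \<open>If the combination vanishes identically its orders carry no information, but
      then \<open>f(z + c)\<close> is a nonzero multiple of \<open>f(z)\<close>.\<close>
    case 2
    have "mero_eq (\<lambda>w. f (w + c)) (\<lambda>w. (b / a) * f w)"
      unfolding mero_eq_def
    proof
      fix z show "eventually (\<lambda>w. f (w + c) = (b / a) * f w) (at z)"
        using 2[unfolded mero_eq_def, rule_format, of z] by eventually_elim (use ab in \<open>auto simp: l_def field_simps\<close>)
    qed
    from zorder_mero_eq[OF this, of z] zorder_cmult[of "b / a" f z] show ?thesis using ab by (simp add: zorder_translate)
  next
    case 1
    have not0: "\<not> eventually (\<lambda>w. g w = 0) (at z)" if "nz_mero g" for g :: "complex \<Rightarrow> complex"
      using nz_mero_frequently[OF that, of z] by (simp add: frequently_def)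
    have le: "zorder f z \<le> zorder l z"
    proof (cases "0 < zorder f z")
      case True
      have "apoint_mult f 0 z \<le> apoint_mult l 0 z" using E0 by (simp add: E_subset_def l_def)
      moreover have "apoint_mult f 0 z = enat (nat (zorder f z))"
        using True not0[OF f] is_pole_iff_zorder[OF f, of z] by (simp add: apoint_mult_def)
      moreover have "apoint_mult l 0 z = (if is_pole l z then 0 else enat (nat (zorder l z)))"
        using not0[OF 1] by (simp add: apoint_mult_def)
      ultimately show ?thesis using True by (auto split: if_splits simp: zero_enat_def)
    next
      case False
      have "pole_div l z \<le> pole_div f z"
        using Einf pole_mult_eq[OF f] pole_mult_eq[OF 1] by (simp add: E_pole_subset_def l_def)
      then show ?thesis using False by (simp add: pole_div_def)
    qed
    have mbf: "nz_mero (\<lambda>w. b * f w)" and maf: "nz_mero (\<lambda>w. a * f (w + c))"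
      by (intro nz_mero_times nz_mero_const ab f mfc)+
    have sum: "(\<lambda>w. l w + b * f w) = (\<lambda>w. a * f (w + c))" by (auto simp: l_def)
    have "zorder f z \<le> zorder (\<lambda>w. l w + b * f w) z"
    proof (rule zorder_add_ge)
      show "frequently (\<lambda>w. l w + b * f w \<noteq> 0) (at z)"
        using nz_mero_frequently[OF maf, of z] unfolding fun_cong[OF sum] .
      show "zorder f z \<le> zorder (\<lambda>w. b * f w) z" using zorder_cmult[of b f z] ab by simp
    qed (fact le nz_mero_meromorphic[OF 1] nz_mero_meromorphic[OF mbf] nz_mero_frequently[OF 1] nz_mero_frequently[OF mbf])+
    then show ?thesis unfolding sum using zorder_cmult[of a "\<lambda>w. f (w + c)" z] ab by (simp add: zorder_translate)
  qed
qed

text \<open>Positive multiplicity includes the value infinity of a function that equals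
  \<open>k\<close> near \<open>z\<close>; the limit treats both cases alike.\<close>

lemma tendsto_apoint:
  assumes "u meromorphic_on UNIV" "0 < apoint_mult u k z"
  shows "(u \<longlongrightarrow> k) (at z)"
proof (cases "eventually (\<lambda>w. u w = k) (at z)")
  case True
  then show ?thesis by (rule tendsto_eventually)
next
  case False
  have "nz_mero (\<lambda>w. u w - k)" by (rule nz_mero_diff_const[OF assms(1)]) (use False in \<open>auto simp: mero_eq_def\<close>)
  moreover have "0 < zorder (\<lambda>w. u w - k) z"
    using assms(2) False by (auto simp: apoint_mult_def zero_enat_def split: if_splits)
  ultimately have "isolated_zero (\<lambda>w. u w - k) z"
    by (intro zorder_pos_imp_isolated_zero nz_mero_meromorphic nz_mero_eventually)
  then have "((\<lambda>w. u w - k) \<longlongrightarrow> 0) (at z)" by (simp add: isolated_zero_def)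
  then show ?thesis by (simp add: LIM_zero_iff)
qed

text \<open>With \<open>l\<close> the linear combination, \<open>l / f = a * H - b\<close>, so
  \<open>H - (1 + b) / a = (l / f - 1) / a\<close>. At a 1-point both \<open>l\<close> and
  \<open>f\<close> tend to \<open>1\<close>, whatever the multiplicities, and the right side tends
  to \<open>0\<close>.\<close>

lemma one_points_shift_quotient:
  assumes f: "nz_mero f" "nonconst f" and ab: "a \<noteq> 0" "b \<noteq> 0"
    and E1: "Ebar_subset 1 f 1 (\<lambda>z. a * f (z + c) - b * f z)"
    and Hk: "\<not> mero_eq (\<lambda>z. f (z + c) / f z) (\<lambda>_. (1 + b) / a)"
    and pos: "0 < zorder (\<lambda>w. f w - 1) z"
  shows "0 < zorder (\<lambda>w. f (w + c) / f w - (1 + b) / a) z"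
proof -
  define l where "l = (\<lambda>z. a * f (z + c) - b * f z)"
  have mfc: "nz_mero (\<lambda>z. f (z + c))" by (rule nz_mero_shift[OF f(1)])
  have ml: "l meromorphic_on UNIV" unfolding l_def by (intro meromorphic_intros nz_mero_meromorphic f mfc)
  have m1: "nz_mero (\<lambda>w. f w - 1)" by (rule nz_mero_not_const[OF f(2) nz_mero_meromorphic[OF f(1)]])
  have mHk: "nz_mero (\<lambda>w. f (w + c) / f w - (1 + b) / a)"
    by (rule nz_mero_diff_const[OF nz_mero_meromorphic[OF nz_mero_divide[OF mfc f(1)]] Hk])
  have np: "\<not> is_pole f z"
    using pos zorder_diff_const_neg[OF f(1), of z 1] by (auto simp: is_pole_iff_zorder[OF f(1)])
  have "\<not> eventually (\<lambda>w. f w = 1) (at z)"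
    using nz_mero_frequently[OF m1, of z] by (simp add: frequently_def)
  then have ap: "0 < apoint_mult f 1 z" using np pos by (simp add: apoint_mult_def zero_enat_def)
  then have "0 < apoint_mult l 1 z" using E1 by (simp add: Ebar_subset_def l_def)
  then have tl: "(l \<longlongrightarrow> 1) (at z)" by (rule tendsto_apoint[OF ml])
  have tf: "(f \<longlongrightarrow> 1) (at z)" by (rule tendsto_apoint[OF nz_mero_meromorphic[OF f(1)] ap])
  have "((\<lambda>w. (l w / f w - 1) / a) \<longlongrightarrow> (1 / 1 - 1) / a) (at z)" by (intro tendsto_intros tl tf ab) simp
  moreover have "eventually (\<lambda>w. (l w / f w - 1) / a = f (w + c) / f w - (1 + b) / a) (at z)"
    using nz_mero_eventually[OF f(1), of z]
    by eventually_elim (use ab in \<open>simp add: l_def field_simps\<close>)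
  ultimately have "((\<lambda>w. f (w + c) / f w - (1 + b) / a) \<longlongrightarrow> 0) (at z)"
    by (auto intro: Lim_transform_eventually)
  then have "isolated_zero (\<lambda>w. f (w + c) / f w - (1 + b) / a) z"
    using nz_mero_eventually[OF mHk] by (simp add: isolated_zero_def)
  then show ?thesis
    by (rule zorder_isolated_zero_pos') (use nz_mero_meromorphic[OF mHk, of "{z}"] in \<open>simp add: meromorphic_at_iff\<close>)
qed

theorem theorem1:
  fixes f :: "complex \<Rightarrow> complex" and a b c :: complex
  assumes "transcendental_meromorphic f"
    and "hyper_order f < 1"
    and "c \<noteq> 0" and "a \<noteq> 0" and "b \<noteq> 0"
    and "E_subset 0 f 0 (\<lambda>z. a * f (z + c) - b * f z)"
    and "E_pole_subset (\<lambda>z. a * f (z + c) - b * f z) f"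
    and "Ebar_subset 1 f 1 (\<lambda>z. a * f (z + c) - b * f z)"
  shows "(\<forall>z. \<not> is_pole f z \<and> \<not> is_pole f (z + c) \<longrightarrow> a * f (z + c) - b * f z = f z)
         \<or> (\<forall>z. f (z + c) = f z)"
proof -
  have nice: "f nicely_meromorphic_on UNIV" and rat: "\<not> rational_function f"
    using assms(1) by (auto simp: transcendental_meromorphic_def)
  have mer: "f meromorphic_on UNIV" using nice by (simp add: nicely_meromorphic_on_def)
  have an: "f analytic_on {z}" if "\<not> is_pole f z" for z
    using nicely_meromorphic_on_imp_analytic_at[OF nice _ that] by simp
  \<comment> \<open>For a nicely meromorphic function, constancy off isolated points is constancy
    everywhere, and constants are rational.\<close>
  have nc: "nonconst f"
    unfolding nonconst_def
  proof safe
    fix k assume k: "mero_eq f (\<lambda>_. k)"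
    have "f z = k" for z
    proof -
      have t: "(f \<longlongrightarrow> k) (at z)" using k by (intro tendsto_eventually) (simp add: mero_eq_def)
      then have "\<not> is_pole f z" using not_tendsto_and_filterlim_at_infinity[of "at z" f k] by (auto simp: is_pole_def)
      then have "(f \<longlongrightarrow> f z) (at z)" using nice by (auto simp: nicely_meromorphic_on_def)
      then show ?thesis using t tendsto_unique[of "at z"] by simp
    qed
    then have "rational_function f" unfolding rational_function_def
      by (intro exI[of _ "[:k:]"] exI[of _ "1"]) simp
    with rat show False by simp
  qed
  have f: "nz_mero f" using nz_mero_diff_const[OF mer, of 0] nc by (simp add: nonconst_def)
  have sl: "subexponential f" by (rule subexponential_hyper_order[OF f assms(2)])
  have mfc: "nz_mero (\<lambda>z. f (z + c))" by (rule nz_mero_shift[OF f])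
  have ge: "zorder f z \<le> zorder f (z + c)" for z
    by (rule zorder_linear_shift_ge[OF f assms(4,5,6,7)])
  define k where "k = (1 + b) / a"
  define H where "H = (\<lambda>z. f (z + c) / f z)"
  \<comment> \<open>The first two cases are the alternatives of the conclusion, since
    \<open>H = k\<close> means \<open>a * f(z + c) = (1 + b) * f(z)\<close>.\<close>
  consider "mero_eq H (\<lambda>_. k)" | "mero_eq H (\<lambda>_. 1)" | "\<not> mero_eq H (\<lambda>_. k)" "\<not> mero_eq H (\<lambda>_. 1)" by blast
  then show ?thesis
  proof cases
    case 1
    have "a * f (z + c) - b * f z = f z" if z: "\<not> is_pole f z" "\<not> is_pole f (z + c)" for z
    proof (rule analytic_eq_at[of "\<lambda>z. a * f (z + c) - b * f z" f])
      show "eventually (\<lambda>w. a * f (w + c) - b * f w = f w) (at z)"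
        using 1[unfolded mero_eq_def, rule_format, of z] nz_mero_eventually[OF f, of z]
        by eventually_elim (use assms(4) in \<open>auto simp: H_def k_def field_simps\<close>)
      show "(\<lambda>z. a * f (z + c) - b * f z) analytic_on {z}"
        by (intro analytic_intros analytic_at_shift an z)
    qed (rule an[OF z(1)])
    then show ?thesis by blast
  next
    case 2
    have e: "mero_eq (\<lambda>z. f (z + c)) f" unfolding mero_eq_def
    proof
      fix z show "eventually (\<lambda>w. f (w + c) = f w) (at z)"
        using 2[unfolded mero_eq_def, rule_format, of z] nz_mero_eventually[OF f, of z]
        by eventually_elim (auto simp: H_def)
    qed
    \<comment> \<open>Equality of germs becomes equality of values: at poles both sides are
      \<open>0\<close> by the convention for nicely meromorphic functions, and elsewhere both sides
      are analytic.\<close>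
    have "f (z + c) = f z" for z
    proof (cases "is_pole f z")
      case True
      have "zorder f (z + c) = zorder f z" using zorder_mero_eq[OF e, of z] by (simp add: zorder_translate)
      then have "is_pole f (z + c)" using True by (simp add: is_pole_iff_zorder[OF f])
      then show ?thesis using True is_pole_zero_at_nicely_mero[OF nice] by simp
    next
      case False
      have "zorder f (z + c) = zorder f z" using zorder_mero_eq[OF e, of z] by (simp add: zorder_translate)
      then have "\<not> is_pole f (z + c)" using False by (simp add: is_pole_iff_zorder[OF f])
      then show ?thesis
        using analytic_eq_at[of "\<lambda>z. f (z + c)" f z] e False an analytic_at_shift by (simp add: mero_eq_def)
    qed
    then show ?thesis by blast
  next
    case 3
    have one: "0 < zorder (\<lambda>w. f (w + c) / f w - k) z" if "0 < zorder (\<lambda>w. f w - 1) z" for z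
      unfolding k_def using 3(1) that
      by (intro one_points_shift_quotient[OF f nc assms(4,5,8)]) (simp_all add: H_def k_def)
    have False
      using shift_quotient_periodic_case[OF f nc sl ge one 3(2,1)[unfolded H_def]]
        shift_quotient_main_case[OF f nc sl ge one 3(2,1)[unfolded H_def]] by blast
    then show ?thesis ..
  qed
qed

end
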